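(* Let $p,q\ge1$ be integers, $H=Sp(p,q)$, $K=Sp(1)$, and $G$ either $Sp(p-1,q)$ or $Sp(p,q-1)$, with $G\times K\subset H$ embedded block-diagonally. Let $\mathfrak{m}\subset\mathfrak{h}$ be the $B$-orthogonal complement of $\mathfrak{k}$, with the non-associative product $[\cdot,\cdot]_{\mathfrak{m}}$. Then $Aut(\mathfrak{m})$ is an algebraic group with $\widetilde{Ad}(G\times K)$ as a finite index subgroup.
   Context: $\mathbb{H}$ denotes the quaternions, $A^*=\overline{A}^t$, $Sp(p,q)=\{A\in M_{p+q}(\mathbb{H}): A^*I_{p,q}A=I_{p,q}\}$ with $I_{p,q}=\mathrm{diag}(I_p,-I_q)$, and $Sp(n)=Sp(n,0)=Sp(0,n)$. The block-diagonal embedding is $(g,\eta)\mapsto\mathrm{diag}(g,\eta)$ if $G=Sp(p,q-1)$ and $(g,\eta)\mapsto\mathrm{diag}(\eta,g)$ if $G=Sp(p-1,q)$. $\mathfrak{h},\mathfrak{g},\mathfrak{k}$ are the Lie algebras of $H,G,K$. $B(X,Y)=\mathrm{Re}\,\mathrm{tr}(XY)$ is a non-degenerate $Ad(H)$-invariant symmetric bilinear form on $\mathfrak{h}$, and $\mathfrak{h}=\mathfrak{g}\oplus\mathfrak{k}\oplus\mathfrak{p}$ is a $B$-orthogonal decomposition with $\mathfrak{p}$ the orthogonal complement of $\mathfrak{g}\oplus\mathfrak{k}$. Put $\mathfrak{m}=\mathfrak{g}\oplus\mathfrak{p}$, and for $X,Y\in\mathfrak{m}$ let $[X,Y]_{\mathfrak{m}}$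 be the orthogonal projection of $[X,Y]$ to $\mathfrak{m}$. $Aut(\mathfrak{m})=\{T\in GL(\mathfrak{m}): T[X,Y]_{\mathfrak{m}}=[TX,TY]_{\mathfrak{m}}\ \forall X,Y\in\mathfrak{m}\}$. If $\mathfrak{m}$ is $Ad_h$-invariant for some $h\in H$ (as is the case for $h\in G\times K$), $\widetilde{Ad}_h$ denotes the restriction of $Ad_h$ to $\mathfrak{m}$; $\widetilde{Ad}(G\times K)\subset Aut(\mathfrak{m})$. *)

theory Defs
  imports
    "HOL-Analysis.Inner_Product"
    "HOL-Algebra.Coset"
    "HOL-Algebra.Bij"
    "Jordan_Normal_Form.Matrix"
begin

section \<open>Quaternions\<close>

datatype quat = Quat (qre: real) (qi: real) (qj: real) (qk: real)

lemma quat_eq_iff: "x = y \<longleftrightarrow> qre x = qre y \<and> qi x = qi y \<and> qj x = qj y \<and> qk x = qk y"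
  by (cases x; cases y) auto

instantiation quat :: ring_1
begin

definition "0 = Quat 0 0 0 0"
definition "1 = Quat 1 0 0 0"
definition "x + y = Quat (qre x + qre y) (qi x + qi y) (qj x + qj y) (qk x + qk y)"
definition "x - y = Quat (qre x - qre y) (qi x - qi y) (qj x - qj y) (qk x - qk y)"
definition "- x = Quat (- qre x) (- qi x) (- qj x) (- qk x)"
definition "x * y = Quat
  (qre x * qre y - qi x * qi y - qj x * qj y - qk x * qk y)
  (qre x * qi y + qi x * qre y + qj x * qk y - qk x * qj y)
  (qre x * qj y - qi x * qk y + qj x * qre y + qk x * qi y)
  (qre x * qk y + qi x * qj y - qj x * qi y + qk x * qre y)"

instance
  by standard
    (simp_all add: quat_eq_iff zero_quat_def one_quat_def plus_quat_def minus_quat_def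
      uminus_quat_def times_quat_def algebra_simps)

end

instantiation quat :: real_algebra_1
begin

definition "c *\<^sub>R x = Quat (c * qre x) (c * qi x) (c * qj x) (c * qk x)"

instance
  by standard
    (simp_all add: quat_eq_iff plus_quat_def times_quat_def scaleR_quat_def algebra_simps)

end

instantiation quat :: real_inner
begin

definition inner_quat :: "quat \<Rightarrow> quat \<Rightarrow> real" where
  "inner_quat x y = qre x * qre y + qi x * qi y + qj x * qj y + qk x * qk y"
definition norm_quat :: "quat \<Rightarrow> real" where
  "norm_quat x = sqrt (inner x x)"
definition sgn_quat :: "quat \<Rightarrow> quat" where
  "sgn_quat x = x /\<^sub>R norm x"
definition dist_quat :: "quat \<Rightarrow> quat \<Rightarrow> real" where
  "dist_quat x y = norm (x - y)"
definition uniformity_quat :: "(quat \<times> quat) filter" where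
  "uniformity_quat = (INF e\<in>{0 <..}. principal {(x, y). dist x y < e})"
definition open_quat :: "quat set \<Rightarrow> bool" where
  "open_quat U \<longleftrightarrow> (\<forall>x\<in>U. eventually (\<lambda>(x', y). x' = x \<longrightarrow> y \<in> U) uniformity)"

instance
proof
  fix x y z :: quat and r :: real
  show "inner x y = inner y x"
    by (simp add: inner_quat_def algebra_simps)
  show "inner (x + y) z = inner x z + inner y z"
    by (simp add: inner_quat_def plus_quat_def algebra_simps)
  show "inner (r *\<^sub>R x) y = r * inner x y"
    by (simp add: inner_quat_def scaleR_quat_def algebra_simps)
  show "0 \<le> inner x x"
    by (simp add: inner_quat_def)
  show "inner x x = 0 \<longleftrightarrow> x = 0"
    by (auto simp: inner_quat_def zero_quat_def quat_eq_iff add_nonneg_eq_0_iff)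
qed (simp_all add: norm_quat_def sgn_quat_def dist_quat_def uniformity_quat_def open_quat_def)

end

definition qcnj :: "quat \<Rightarrow> quat" where
  "qcnj x = Quat (qre x) (- qi x) (- qj x) (- qk x)"


section \<open>The groups Sp(p,q) and their Lie algebras\<close>

definition qadjoint :: "quat mat \<Rightarrow> quat mat" where
  "qadjoint A = transpose_mat (map_mat qcnj A)"

definition Ipq :: "nat \<Rightarrow> nat \<Rightarrow> quat mat" where
  "Ipq p q = mat_diag (p + q) (\<lambda>i. if i < p then 1 else - 1)"

definition Sp :: "nat \<Rightarrow> nat \<Rightarrow> quat mat set" where
  "Sp p q = {A \<in> carrier_mat (p + q) (p + q). qadjoint A * Ipq p q * A = Ipq p q}"

definition Sp_group :: "nat \<Rightarrow> nat \<Rightarrow> quat mat monoid" where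
  "Sp_group p q = \<lparr>carrier = Sp p q, monoid.mult = (*), one = 1\<^sub>m (p + q)\<rparr>"

text \<open>The Lie algebra of a matrix group is its tangent space at the identity: the set of initial
  velocities of differentiable curves that stay in the group and start at the identity.
  Derivatives of matrix-valued curves are taken entrywise.\<close>

definition lie_algebra :: "nat \<Rightarrow> quat mat set \<Rightarrow> quat mat set" where
  "lie_algebra n S = {X \<in> carrier_mat n n.
     \<exists>\<gamma> \<gamma>' :: real \<Rightarrow> quat mat. \<gamma> 0 = 1\<^sub>m n \<and> \<gamma>' 0 = X \<and>
       (\<forall>t. \<gamma> t \<in> S \<and>
         (\<forall>i<n. \<forall>j<n. ((\<lambda>s. \<gamma> s $$ (i, j)) has_vector_derivative \<gamma>' t $$ (i, j)) (at t)))}"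

definition bform :: "quat mat \<Rightarrow> quat mat \<Rightarrow> real" where
  "bform X Y = qre (\<Sum>i<dim_row X. (X * Y) $$ (i, i))"

definition borth_compl :: "quat mat set \<Rightarrow> quat mat set \<Rightarrow> quat mat set" where
  "borth_compl V W = {X \<in> V. \<forall>Y\<in>W. bform X Y = 0}"

text \<open>Only meaningful when \<open>bform\<close> is non-degenerate on \<open>V\<close>.\<close>

definition borth_proj :: "quat mat set \<Rightarrow> quat mat \<Rightarrow> quat mat" where
  "borth_proj V X = (THE Z. Z \<in> V \<and> (\<forall>Y\<in>V. bform (X - Z) Y = 0))"

definition bracket_on :: "quat mat set \<Rightarrow> quat mat \<Rightarrow> quat mat \<Rightarrow> quat mat" where
  "bracket_on V X Y = borth_proj V (X * Y - Y * X)"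


section \<open>Automorphism groups and real algebraic groups\<close>

definition linear_endo :: "quat mat set \<Rightarrow> (quat mat \<Rightarrow> quat mat) \<Rightarrow> bool" where
  "linear_endo V T \<longleftrightarrow> T \<in> V \<rightarrow> V \<and>
     (\<forall>X\<in>V. \<forall>Y\<in>V. T (X + Y) = T X + T Y) \<and>
     (\<forall>c::real. \<forall>X\<in>V. T (of_real c \<cdot>\<^sub>m X) = of_real c \<cdot>\<^sub>m T X)"

definition linear_functional :: "quat mat set \<Rightarrow> (quat mat \<Rightarrow> real) \<Rightarrow> bool" where
  "linear_functional V f \<longleftrightarrow>
     (\<forall>X\<in>V. \<forall>Y\<in>V. f (X + Y) = f X + f Y) \<and>
     (\<forall>c::real. \<forall>X\<in>V. f (of_real c \<cdot>\<^sub>m X) = c * f X)"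

text \<open>As in \<^const>\<open>BijGroup\<close>, the maps are made unique by being \<^const>\<open>undefined\<close> outside \<open>V\<close>.\<close>

definition GL :: "quat mat set \<Rightarrow> (quat mat \<Rightarrow> quat mat) monoid" where
  "GL V = BijGroup V \<lparr>carrier := {T \<in> Bij V. linear_endo V T}\<rparr>"

definition Aut :: "quat mat set \<Rightarrow> (quat mat \<Rightarrow> quat mat) set" where
  "Aut V = {T \<in> carrier (GL V).
     \<forall>X\<in>V. \<forall>Y\<in>V. T (bracket_on V X Y) = bracket_on V (T X) (T Y)}"

definition Aut_group :: "quat mat set \<Rightarrow> (quat mat \<Rightarrow> quat mat) monoid" where
  "Aut_group V = GL V \<lparr>carrier := Aut V\<rparr>"

text \<open>Real polynomial functions on the endomorphisms of \<open>V\<close>: the algebra of functions generated by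
  the constants and the matrix coefficients (with respect to arbitrary bases of \<open>V\<close>).\<close>

inductive poly_fun :: "quat mat set \<Rightarrow> ((quat mat \<Rightarrow> quat mat) \<Rightarrow> real) \<Rightarrow> bool"
  for V where
  const: "poly_fun V (\<lambda>T. c)"
| coeff: "linear_functional V f \<Longrightarrow> X \<in> V \<Longrightarrow> poly_fun V (\<lambda>T. f (T X))"
| add: "poly_fun V a \<Longrightarrow> poly_fun V b \<Longrightarrow> poly_fun V (\<lambda>T. a T + b T)"
| mult: "poly_fun V a \<Longrightarrow> poly_fun V b \<Longrightarrow> poly_fun V (\<lambda>T. a T * b T)"

text \<open>A (real, linear) algebraic group is a Zariski closed subgroup of the general linear group.\<close>

definition algebraic_group :: "quat mat set \<Rightarrow> (quat mat \<Rightarrow> quat mat) set \<Rightarrow> bool" where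
  "algebraic_group V S \<longleftrightarrow> subgroup S (GL V) \<and>
     (\<exists>P. (\<forall>f\<in>P. poly_fun V f) \<and> S = {T \<in> carrier (GL V). \<forall>f\<in>P. f T = 0})"

definition finite_index_subgroup :: "'a set \<Rightarrow> ('a, 'b) monoid_scheme \<Rightarrow> bool" where
  "finite_index_subgroup N L \<longleftrightarrow> subgroup N L \<and> finite (rcosets\<^bsub>L\<^esub> N)"

definition Ad_restr ::
  "nat \<Rightarrow> nat \<Rightarrow> quat mat set \<Rightarrow> quat mat \<Rightarrow> quat mat \<Rightarrow> quat mat" where
  "Ad_restr p q V h = (\<lambda>X\<in>V. h * X * inv\<^bsub>Sp_group p q\<^esub> h)"

end

theory Submission
  imports "HOL-Analysis.Derivative" "HOL-Library.Function_Algebras" "Jordan_Normal_Form.Determinant" Defs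
begin

text \<open>Let \<open>r\<close> be the coordinate on which \<open>K\<close> acts. An element of \<open>\<mm> = \<gg> \<oplus> \<pp>\<close> is a pair of some
  \<open>A\<close> in the Lie algebra \<open>\<gg>\<close> of \<open>G\<close> and a quaternionic vector \<open>v\<close> (column \<open>r\<close>). The Jacobi
  identity fails exactly off \<open>\<gg>\<close>, so an automorphism \<open>T\<close> preserves \<open>\<gg>\<close>; it also preserves \<open>\<pp>\<close>, by
  looking at an element of \<open>\<gg>\<close> that acts on \<open>\<pp>\<close> with square \<open>-1\<close>. Hence \<open>T\<close> induces on
  \<open>\<pp>\<close> a real-linear automorphism \<open>\<tau>\<close> of the triple product \<open>v \<langle>w, z\<rangle> - w \<langle>v, z\<rangle>\<close>. Conjugation by
  \<open>\<tau>\<close> preserves the commutant of the operators \<open>z \<mapsto> v \<langle>w, z\<rangle> - w \<langle>v, z\<rangle>\<close>, which is the algebra of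
  right multiplications by quaternions; as all automorphisms of that algebra are inner,
  \<open>\<tau> v = g v u\<close> with a unit quaternion \<open>u\<close> and a quaternionic matrix \<open>g\<close>, and the triple product forces
  \<open>g \<in> G\<close>. So \<open>Aut(\<mm>)\<close> is in fact equal to the image of \<open>G \<times> K\<close>.\<close>

section \<open>Quaternions\<close>

text \<open>Two obstacles shape the development. The Lie algebras are given by differentiable curves
  in the groups and have to be identified with explicit matrix spaces; curves
  \<open>1 + s U + c U^2\<close> for elementary \<open>U\<close> suffice, so only sin, cos, sinh and
  cosh occur. Quaternions do not commute, so scalars and matrices act from opposite sides, and
  determinants are reached only through complex matrices. The triple product is, up to a sign, the
  double bracket of three elements of the off-diagonal summand. The product of \<open>\<mm>\<close>
  differs from the commutator only by dropping the entry at \<open>(r, r)\<close>, and this spoils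
  the Jacobi identity for off-diagonal triples. On \<open>\<gg>\<close> an automorphism is
  determined by its values on the off-diagonal summand, because \<open>\<gg>\<close> acts faithfully
  there. Algebraicity is independent of this description: the automorphism condition is a system of
  polynomial equations of degree at most two in the real coordinates of the entries.\<close>

lemmas quat_simps = quat_eq_iff zero_quat_def one_quat_def plus_quat_def minus_quat_def
  uminus_quat_def times_quat_def scaleR_quat_def qcnj_def

lemma quat_of_real: "of_real c = Quat c 0 0 0"
  by (simp add: of_real_def quat_simps)

lemma qcnj_add [simp]: "qcnj (x + y) = qcnj x + qcnj y"
  and qcnj_diff [simp]: "qcnj (x - y) = qcnj x - qcnj y"
  and qcnj_uminus [simp]: "qcnj (- x) = - qcnj x"
  and qcnj_mult [simp]: "qcnj (x * y) = qcnj y * qcnj x"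
  and qcnj_qcnj [simp]: "qcnj (qcnj x) = x"
  and qcnj_zero [simp]: "qcnj 0 = 0"
  and qcnj_one [simp]: "qcnj 1 = 1"
  and qcnj_of_real [simp]: "qcnj (of_real c) = of_real c"
  by (simp_all add: quat_simps quat_of_real algebra_simps)

lemma qcnj_eq_0_iff [simp]: "qcnj x = 0 \<longleftrightarrow> x = 0"
  by (auto simp: quat_simps)

lemma qcnj_sum: "qcnj (sum f A) = (\<Sum>x\<in>A. qcnj (f x))"
  by (induction A rule: infinite_finite_induct) auto

lemma quat_real_commute: "of_real c * x = x * (of_real c :: quat)"
  by (simp add: quat_simps quat_of_real)

lemma of_real_inverse_cancel: "N \<noteq> 0 \<Longrightarrow> of_real N * (of_real (1 / N) * x) = (x :: quat)"
  by (simp add: mult.assoc[symmetric] of_real_mult[symmetric] del: of_real_mult)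

lemma quat_scaleR_conv: "of_real c * x = c *\<^sub>R x" "x * of_real c = c *\<^sub>R (x :: quat)"
  by (simp_all add: scaleR_conv_of_real quat_real_commute)

lemma qcnj_scaleR: "qcnj (c *\<^sub>R x) = c *\<^sub>R qcnj x"
  by (simp add: quat_simps)

lemma qre_zero [simp]: "qre 0 = 0"
  by (simp add: zero_quat_def)

lemma qcnj_mult_self: "qcnj x * x = of_real (inner x x)"
  and mult_qcnj_self: "x * qcnj x = of_real (inner x x)"
  by (simp_all add: quat_simps quat_of_real inner_quat_def algebra_simps)

instance quat :: ring_1_no_zero_divisors
proof
  fix x y :: quat
  assume "x \<noteq> 0" "y \<noteq> 0"
  have "qcnj x * (x * y) = inner x x *\<^sub>R y"
    by (simp add: mult.assoc [symmetric] qcnj_mult_self scaleR_conv_of_real)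
  with \<open>x \<noteq> 0\<close> \<open>y \<noteq> 0\<close> show "x * y \<noteq> 0"
    by (metis inner_eq_zero_iff mult_zero_right scaleR_eq_0_iff)
qed

abbreviation "\<i>\<i> \<equiv> Quat 0 1 0 0"
abbreviation "\<j>\<j> \<equiv> Quat 0 0 1 0"
abbreviation "\<k>\<k> \<equiv> Quat 0 0 0 1"

lemma quat_expand:
  "x = of_real (qre x) + of_real (qi x) * \<i>\<i> + of_real (qj x) * \<j>\<j> + of_real (qk x) * \<k>\<k>"
  by (simp add: quat_simps quat_of_real)

text \<open>The averaging over \<open>1, i, j, k\<close> of \<open>e x \<alpha>(e)\<^sup>-\<^sup>1\<close> intertwines; some choice of \<open>x\<close> makes it
  nonzero, since the four results for \<open>x = 1, i, j, k\<close> combine to \<open>4\<close>.\<close>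

lemma quat_endomorphism_inner:
  fixes \<alpha> :: "quat \<Rightarrow> quat"
  assumes add: "\<And>x y. \<alpha> (x + y) = \<alpha> x + \<alpha> y" and mult: "\<And>x y. \<alpha> (x * y) = \<alpha> x * \<alpha> y"
    and real: "\<And>c. \<alpha> (of_real c) = of_real c"
  obtains u where "qcnj u * u = 1" "u * qcnj u = 1" "\<And>c. \<alpha> c = qcnj u * c * u"
proof -
  define a b where "a = \<alpha> \<i>\<i>" and "b = \<alpha> \<j>\<j>"
  have m1: "\<alpha> (-1) = -1"
    using real[of "-1"] by simp
  have kk: "\<k>\<k> = \<i>\<i> * \<j>\<j>" "\<i>\<i> * \<i>\<i> = -1" "\<j>\<j> * \<j>\<j> = -1" "\<j>\<j> * \<i>\<i> = (-1) * (\<i>\<i> * \<j>\<j>)"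
    by (simp_all add: quat_simps)
  have aa: "a * a = -1" and bb: "b * b = -1" and ba: "b * a = - (a * b)"
    unfolding a_def b_def mult[symmetric] kk by (simp_all only: mult m1) simp
  have aa': "a * (a * x) = - x" and bb': "b * (b * x) = -x" and ba': "b * (a * x) = - (a * (b * x))" for x
    using aa bb ba by (simp_all add: mult.assoc[symmetric])
  have \<alpha>: "\<alpha> x = of_real (qre x) + of_real (qi x) * a + of_real (qj x) * b + of_real (qk x) * (a * b)" for x
    by (subst quat_expand[of x]) (simp add: add mult real a_def b_def kk(1) del: of_real_mult)
  \<comment> \<open>The images of i, j, k square to -1, so their inverses are their negatives; this
    explains the signs in the average.\<close>
  define \<eta> where "\<eta> x = x - \<i>\<i> * x * a - \<j>\<j> * x * b - \<k>\<k> * x * (a * b)" for x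
  have iq: "\<i>\<i> * (\<i>\<i> * x) = - x" "\<j>\<j> * (\<j>\<j> * x) = - x" "\<i>\<i> * (\<j>\<j> * x) = \<k>\<k> * x" "\<j>\<j> * (\<i>\<i> * x) = - (\<k>\<k> * x)"
    "\<k>\<k> * (\<i>\<i> * x) = \<j>\<j> * x" "\<i>\<i> * (\<k>\<k> * x) = - (\<j>\<j> * x)" "\<j>\<j> * (\<k>\<k> * x) = \<i>\<i> * x"
    "\<k>\<k> * (\<j>\<j> * x) = - (\<i>\<i> * x)" "\<k>\<k> * (\<k>\<k> * x) = - x" for x
    by (simp_all add: quat_simps algebra_simps)
  have inta: "\<i>\<i> * \<eta> x = \<eta> x * a" and intb: "\<j>\<j> * \<eta> x = \<eta> x * b" for x
    by (simp_all add: \<eta>_def algebra_simps iq aa bb ba aa' bb' ba')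
  have "\<exists>x. \<eta> x \<noteq> 0"
  proof (rule ccontr)
    assume "\<not> ?thesis"
    then have "\<eta> 1 - \<i>\<i> * \<eta> \<i>\<i> - \<j>\<j> * \<eta> \<j>\<j> - \<k>\<k> * \<eta> \<k>\<k> = 0"
      by simp
    \<comment> \<open>The sum of \<open>f^-1 e f\<close> over f = 1, i, j, k is four times the real
      part of e, so of all terms only those with e = 1 survive.\<close>
    moreover have "\<eta> 1 - \<i>\<i> * \<eta> \<i>\<i> - \<j>\<j> * \<eta> \<j>\<j> - \<k>\<k> * \<eta> \<k>\<k> = of_real 4"
      by (simp add: \<eta>_def quat_simps quat_of_real)
    ultimately show False
      by (simp only: of_real_eq_0_iff)
  qed
  then obtain x where "\<eta> x \<noteq> 0" by blast
  define w where "w = \<eta> x"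
  \<comment> \<open>Dividing by a real number makes the intertwiner a unit and keeps the
    intertwining relations, since reals are central.\<close>
  define s where "s = sqrt (inner w w)"
  have s: "s > 0" "s * s = inner w w"
    using \<open>\<eta> x \<noteq> 0\<close> by (auto simp: s_def w_def)
  define u where "u = of_real (1/s) * w"
  have u: "qcnj u * u = 1" "u * qcnj u = 1"
  proof -
    have "qcnj u * u = of_real (1/s * (1/s)) * (qcnj w * w)"
      by (simp only: u_def qcnj_mult qcnj_of_real of_real_mult) (metis mult.assoc quat_real_commute)
    also have "\<dots> = 1"
      using s by (simp only: qcnj_mult_self of_real_mult[symmetric] s(2)[symmetric]) (simp add: field_simps)
    finally show "qcnj u * u = 1" .
    then show "u * qcnj u = 1"
      by (simp add: qcnj_mult_self mult_qcnj_self)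
  qed
  have ua: "\<i>\<i> * u = u * a" "\<j>\<j> * u = u * b"
    using inta[of x] intb[of x] unfolding u_def w_def
    by (metis mult.assoc quat_real_commute)+
  then have uab: "\<k>\<k> * u = u * (a * b)"
    by (metis kk(1) mult.assoc)
  have "c * u = u * \<alpha> c" for c
    unfolding \<alpha> by (subst (1) quat_expand[of c])
      (simp only: distrib_left distrib_right mult.assoc ua uab,
       simp only: quat_real_commute mult.assoc)
  then have "\<alpha> c = qcnj u * c * u" for c
    using u(1) by (metis mult.assoc mult_1)
  with u that show thesis by blast
qed

section \<open>Quaternionic Hermitian forms and their triple product\<close>

text \<open>Scalars act from the right, so that matrices act from the left by linear maps and the
  form is linear in its second argument.\<close>

definition rsmult :: "('i \<Rightarrow> quat) \<Rightarrow> quat \<Rightarrow> 'i \<Rightarrow> quat" (infixl "\<cdot>\<^sub>r" 70) where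
  "v \<cdot>\<^sub>r q = (\<lambda>i. v i * q)"

definition std_vec :: "'i \<Rightarrow> 'i \<Rightarrow> quat" where
  "std_vec a = (\<lambda>i. if i = a then 1 else 0)"

lemma rsmult_apply [simp]: "(v \<cdot>\<^sub>r q) i = v i * q"
  by (simp add: rsmult_def)

lemma std_vec_same [simp]: "std_vec a a = 1"
  by (simp add: std_vec_def)

lemma rsmult_simps:
  "(v + w) \<cdot>\<^sub>r q = v \<cdot>\<^sub>r q + w \<cdot>\<^sub>r q" "(v - w) \<cdot>\<^sub>r q = v \<cdot>\<^sub>r q - w \<cdot>\<^sub>r q" "v \<cdot>\<^sub>r (p + q) = v \<cdot>\<^sub>r p + v \<cdot>\<^sub>r q"
  "v \<cdot>\<^sub>r (p - q) = v \<cdot>\<^sub>r p - v \<cdot>\<^sub>r q" "v \<cdot>\<^sub>r p \<cdot>\<^sub>r q = v \<cdot>\<^sub>r (p * q)" "v \<cdot>\<^sub>r 1 = v" "v \<cdot>\<^sub>r 0 = 0"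
  by (auto simp: fun_eq_iff algebra_simps)

lemma rsmult_left_cancel:
  assumes "v \<noteq> 0" and "v \<cdot>\<^sub>r p = v \<cdot>\<^sub>r q"
  shows "p = q"
proof -
  obtain i where "v i \<noteq> 0" using assms(1) by (auto simp: fun_eq_iff)
  moreover have "v i * p = v i * q" using assms(2) by (auto simp: fun_eq_iff)
  ultimately show ?thesis by simp
qed

text \<open>The index set is arbitrary, so that the coordinates other than \<open>r\<close> can
  later be used without renumbering; the signs are arbitrary as well, which treats both choices of
  \<open>G\<close> at once.\<close>

locale hermitian_space =
  fixes I :: "'i set" and \<epsilon> :: "'i \<Rightarrow> real"
  assumes finite_I: "finite I" and nonempty_I: "I \<noteq> {}" and sign: "\<And>i. \<epsilon> i * \<epsilon> i = 1"
begin

definition V :: "('i \<Rightarrow> quat) set" where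
  "V = {v. \<forall>i. i \<notin> I \<longrightarrow> v i = 0}"

definition hform :: "('i \<Rightarrow> quat) \<Rightarrow> ('i \<Rightarrow> quat) \<Rightarrow> quat" where
  "hform v w = (\<Sum>i\<in>I. qcnj (v i) * of_real (\<epsilon> i) * w i)"

text \<open>For fixed \<open>v\<close> and \<open>w\<close> this is a skew operator of the form, of
  rank at most two. It equals a double bracket of three off-diagonal elements up to a sign, see
  \<open>br_PPP\<close>.\<close>

definition triple :: "('i \<Rightarrow> quat) \<Rightarrow> ('i \<Rightarrow> quat) \<Rightarrow> ('i \<Rightarrow> quat) \<Rightarrow> 'i \<Rightarrow> quat" where
  "triple v w z = v \<cdot>\<^sub>r hform w z - w \<cdot>\<^sub>r hform v z"

lemma V_closed [simp]:
  "0 \<in> V" "v \<in> V \<Longrightarrow> w \<in> V \<Longrightarrow> v + w \<in> V" "v \<in> V \<Longrightarrow> w \<in> V \<Longrightarrow> v - w \<in> V" "v \<in> V \<Longrightarrow> v \<cdot>\<^sub>r q \<in> V"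
  "a \<in> I \<Longrightarrow> std_vec a \<in> V" "v \<in> V \<Longrightarrow> w \<in> V \<Longrightarrow> triple v w z \<in> V"
  by (auto simp: V_def std_vec_def triple_def)

lemma hform_simps:
  "hform (v + w) z = hform v z + hform w z" "hform v (w + z) = hform v w + hform v z"
  "hform (v \<cdot>\<^sub>r q) w = qcnj q * hform v w" "hform v (w \<cdot>\<^sub>r q) = hform v w * q"
  by (simp_all add: hform_def sum.distrib sum_distrib_left sum_distrib_right algebra_simps)

lemma hform_std_vec: "a \<in> I \<Longrightarrow> hform (std_vec a) w = of_real (\<epsilon> a) * w a"
proof -
  assume a: "a \<in> I"
  have "hform (std_vec a) w = (\<Sum>i\<in>I. if i = a then of_real (\<epsilon> a) * w a else 0)"
    unfolding hform_def std_vec_def by (intro sum.cong) auto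
  with a finite_I show ?thesis by simp
qed

lemma sign_mult_quat: "of_real (\<epsilon> a) * (of_real (\<epsilon> a) * x) = (x :: quat)"
  using sign[of a] by (simp add: mult.assoc[symmetric] of_real_mult[symmetric] del: of_real_mult)

lemma vec_expand: "v \<in> V \<Longrightarrow> v = (\<Sum>a\<in>I. std_vec a \<cdot>\<^sub>r v a)"
proof
  fix i assume v: "v \<in> V"
  have "(\<Sum>a\<in>I. std_vec a \<cdot>\<^sub>r v a) i = (\<Sum>a\<in>I. (std_vec a \<cdot>\<^sub>r v a) i)"
    by (induction I rule: infinite_finite_induct) auto
  also have "\<dots> = (\<Sum>a\<in>I. if i = a then v i else 0)"
    by (intro sum.cong) (auto simp: std_vec_def)
  also have "\<dots> = v i"
    using v finite_I by (simp add: V_def)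
  finally show "v i = (\<Sum>a\<in>I. std_vec a \<cdot>\<^sub>r v a) i" by simp
qed

lemma additive_expand:
  assumes add: "\<And>v w. v \<in> V \<Longrightarrow> w \<in> V \<Longrightarrow> T (v + w) = T v + T w" and v: "v \<in> V"
  shows "(T v :: 'i \<Rightarrow> quat) = (\<Sum>a\<in>I. T (std_vec a \<cdot>\<^sub>r v a))"
proof -
  have T0: "T 0 = 0"
    using add[of 0 0] by simp
  have "T (\<Sum>a\<in>J. std_vec a \<cdot>\<^sub>r v a) = (\<Sum>a\<in>J. T (std_vec a \<cdot>\<^sub>r v a)) \<and> (\<Sum>a\<in>J. std_vec a \<cdot>\<^sub>r v a) \<in> V"
    if "finite J" "J \<subseteq> I" for J
    using that by (induction J) (auto simp: T0 add)
  from this[of I] finite_I have "T (\<Sum>a\<in>I. std_vec a \<cdot>\<^sub>r v a) = (\<Sum>a\<in>I. T (std_vec a \<cdot>\<^sub>r v a))"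
    by simp
  then show ?thesis
    using vec_expand[OF v] by simp
qed

text \<open>For imaginary \<open>q\<close> the conjugate of \<open>-q/2\<close> is
  \<open>q/2\<close>, so the two terms add up instead of cancelling. The resulting operators of rank
  at most one are all that the commutant computation uses.\<close>

lemma triple_rsmult:
  assumes "qre q = 0"
  shows "triple v (v \<cdot>\<^sub>r (of_real (-1/2) * q)) z = v \<cdot>\<^sub>r (q * hform v z)"
proof -
  have "qcnj (of_real (-1/2) * q) - of_real (-1/2) * q = q"
    using assms by (simp add: quat_simps quat_of_real)
  then show ?thesis
    by (simp only: triple_def hform_simps rsmult_simps left_diff_distrib[symmetric] flip: rsmult_simps(4))
qed

text \<open>The operators \<open>z \<mapsto> triple v w z\<close> span the Lie algebra of the unitary group of the form, so this
  is the computation of the commutant of its standard representation.\<close>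

lemma commutant_of_triple:
  assumes LV: "\<And>v. v \<in> V \<Longrightarrow> L v \<in> V"
    and add: "\<And>v w. v \<in> V \<Longrightarrow> w \<in> V \<Longrightarrow> L (v + w) = L v + L w"
    and comm: "\<And>v w z. v \<in> V \<Longrightarrow> w \<in> V \<Longrightarrow> z \<in> V \<Longrightarrow> L (triple v w z) = triple v w (L z)"
  obtains c where "\<And>v. v \<in> V \<Longrightarrow> L v = v \<cdot>\<^sub>r c"
proof -
  have imag: "L (v \<cdot>\<^sub>r (q * hform v z)) = v \<cdot>\<^sub>r (q * hform v (L z))" if "v \<in> V" "z \<in> V" "qre q = 0" for v z q
    using that by (simp add: comm flip: triple_rsmult)
  define l where "l a x = L (std_vec a \<cdot>\<^sub>r x) a" for a x
  have L1: "L (std_vec a \<cdot>\<^sub>r (q * x)) = std_vec a \<cdot>\<^sub>r (q * l a x)" if a: "a \<in> I" and q: "qre q = 0" for a q x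
  proof -
    have "qre (q * of_real (\<epsilon> a)) = 0" using q by (simp add: quat_simps quat_of_real)
    from imag[OF _ _ this, of "std_vec a" "std_vec a \<cdot>\<^sub>r x"] a show ?thesis
      by (simp add: hform_std_vec mult.assoc sign_mult_quat l_def)
  qed
  have lq: "l a (q * x) = q * l a x" if "a \<in> I" "qre q = 0" for a q x
    using L1[OF that, of x] by (simp add: l_def[of a "q * x"] std_vec_def)
  have Ll: "L (std_vec a \<cdot>\<^sub>r x) = std_vec a \<cdot>\<^sub>r l a x" if a: "a \<in> I" for a x
  proof -
    \<comment> \<open>Every quaternion is an imaginary multiple of another one, so the rule for
      imaginary multiples reaches all \<open>x\<close>.\<close>
    have x: "x = \<i>\<i> * (- \<i>\<i> * x)" by (simp add: quat_simps)
    show ?thesis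
      by (subst x, subst L1[OF a], simp, subst (2) x, subst lq[OF a], simp_all)
  qed
  have l1: "l a x = x * l a 1" if a: "a \<in> I" for a x
  proof -
    have re: "l a (of_real c) = of_real c * l a 1" for c
    proof -
      \<comment> \<open>A real number is a product of two imaginary quaternions, so
        \<open>lq\<close> can be applied twice.\<close>
      have "of_real c = (of_real (- c) * \<i>\<i>) * (\<i>\<i> * 1)" by (simp add: quat_simps quat_of_real)
      moreover have "l a ((of_real (- c) * \<i>\<i>) * (\<i>\<i> * 1)) = (of_real (- c) * \<i>\<i>) * (\<i>\<i> * l a 1)"
        by (subst lq[OF a] | simp add: quat_simps quat_of_real)+
      ultimately show ?thesis
        by (simp add: mult.assoc[symmetric])
    qed
    define y where "y = x - of_real (qre x)"
    have y: "qre y = 0" by (simp add: y_def quat_simps quat_of_real)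
    have "l a (of_real (qre x) + y * 1) = l a (of_real (qre x)) + l a (y * 1)"
      using add[of "std_vec a \<cdot>\<^sub>r of_real (qre x)" "std_vec a \<cdot>\<^sub>r y"] a by (simp add: l_def rsmult_simps)
    also have "\<dots> = (of_real (qre x) + y) * l a 1"
      by (simp only: re lq[OF a y] distrib_right)
    finally show ?thesis by (simp add: y_def)
  qed
  have c_eq: "l a 1 = l b 1" if a: "a \<in> I" and b: "b \<in> I" for a b
  proof (cases "a = b")
    case False
    \<comment> \<open>The rank-one operator of this vector mixes the coordinates \<open>a\<close>
      and \<open>b\<close> and thereby ties their constants together.\<close>
    let ?v = "std_vec a + std_vec b"
    have "std_vec b a = 0" "std_vec a b = 0" "std_vec a a = 1" "std_vec b b = 1"
      using False by (simp_all add: std_vec_def)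
    note u = this
    have q: "qre (\<i>\<i> * of_real (\<epsilon> a)) = 0" by (simp add: quat_simps quat_of_real)
    have "hform ?v (std_vec a) = of_real (\<epsilon> a)" "hform ?v (L (std_vec a)) = of_real (\<epsilon> a) * l a 1"
      using Ll[OF a, of 1] a b by (simp_all add: hform_simps hform_std_vec u rsmult_simps)
    with imag[OF _ _ q, of ?v "std_vec a"] a b have "L (?v \<cdot>\<^sub>r \<i>\<i>) = ?v \<cdot>\<^sub>r (\<i>\<i> * l a 1)"
      using sign_mult_quat[of a 1] by (simp add: mult.assoc sign_mult_quat)
    also have "L (?v \<cdot>\<^sub>r \<i>\<i>) = std_vec a \<cdot>\<^sub>r (\<i>\<i> * l a 1) + std_vec b \<cdot>\<^sub>r (\<i>\<i> * l b 1)"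
      using a b by (simp add: rsmult_simps add Ll l1[of _ "\<i>\<i>"])
    finally have "\<i>\<i> * l b 1 = \<i>\<i> * l a 1"
      by (auto simp: fun_eq_iff u dest: spec[of _ b])
    moreover have "\<i>\<i> \<noteq> 0" by (simp add: zero_quat_def)
    ultimately show ?thesis by simp
  qed simp
  obtain b where b: "b \<in> I" using nonempty_I by blast
  have "L v = v \<cdot>\<^sub>r l b 1" if v: "v \<in> V" for v
  proof -
    have "L v = (\<Sum>a\<in>I. L (std_vec a \<cdot>\<^sub>r v a))"
      by (rule additive_expand[OF add v])
    also have "\<dots> = (\<Sum>a\<in>I. (std_vec a \<cdot>\<^sub>r v a) \<cdot>\<^sub>r l b 1)"
      by (intro sum.cong refl) (metis Ll b c_eq l1 rsmult_simps(5))
    also have "\<dots> = v \<cdot>\<^sub>r l b 1"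
      by (rule additive_expand[OF _ v, of "\<lambda>v. v \<cdot>\<^sub>r l b 1", symmetric]) (rule rsmult_simps)
    finally show ?thesis .
  qed
  with that show thesis .
qed

text \<open>The triple product determines both the scalars, as the commutant of its operators, and
  the form, since a scaled form would give a scaled product. This is why real linearity of
  \<open>\<tau>\<close> is enough to start from.\<close>

theorem triple_automorphism:
  assumes bij: "bij_betw \<tau> V V"
    and add: "\<And>v w. v \<in> V \<Longrightarrow> w \<in> V \<Longrightarrow> \<tau> (v + w) = \<tau> v + \<tau> w"
    and real: "\<And>v c. v \<in> V \<Longrightarrow> \<tau> (v \<cdot>\<^sub>r of_real c) = \<tau> v \<cdot>\<^sub>r of_real c"
    and tri: "\<And>v w z. v \<in> V \<Longrightarrow> w \<in> V \<Longrightarrow> z \<in> V \<Longrightarrow> \<tau> (triple v w z) = triple (\<tau> v) (\<tau> w) (\<tau> z)"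
  shows "\<exists>g u. qcnj u * u = 1 \<and> u * qcnj u = 1 \<and>
    (\<forall>v\<in>V. \<forall>i. \<tau> v i = (\<Sum>j\<in>I. g i j * v j) * u) \<and>
    (\<forall>j\<in>I. \<forall>k\<in>I. (\<Sum>i\<in>I. qcnj (g i j) * of_real (\<epsilon> i) * g i k) = (if j = k then of_real (\<epsilon> j) else 0))"
proof -
  define \<tau>' where "\<tau>' = inv_into V \<tau>"
  have \<tau>V: "\<tau> v \<in> V" and \<tau>'V: "\<tau>' v \<in> V" and inv: "\<tau> (\<tau>' v) = v" "\<tau>' (\<tau> v) = v" if "v \<in> V" for v
    using bij that unfolding \<tau>'_def bij_betw_def by (auto simp: f_inv_into_f inv_into_into)
  have \<tau>'_eq: "\<tau>' x = y" if "y \<in> V" "\<tau> y = x" for x y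
    using inv that by auto
  have \<tau>'_add: "\<tau>' (v + w) = \<tau>' v + \<tau>' w" if "v \<in> V" "w \<in> V" for v w
    using that by (intro \<tau>'_eq) (simp_all add: add inv \<tau>'V)
  have \<tau>'_tri: "\<tau>' (triple v w z) = triple (\<tau>' v) (\<tau>' w) (\<tau>' z)" if "v \<in> V" "w \<in> V" "z \<in> V" for v w z
    using that by (intro \<tau>'_eq) (simp_all add: tri inv \<tau>'V)
  have "\<exists>d. \<forall>v\<in>V. \<tau> (v \<cdot>\<^sub>r c) = \<tau> v \<cdot>\<^sub>r d" for c
  proof -
    \<comment> \<open>Right multiplication by \<open>c\<close> commutes with the operators
      \<open>triple v w\<close>. Its conjugate under \<open>\<tau>\<close> does so too, because
      \<open>\<tau>\<close> permutes these operators.\<close>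
    have tc: "triple v w z \<cdot>\<^sub>r c = triple v w (z \<cdot>\<^sub>r c)" for v w z
      by (simp add: triple_def rsmult_simps hform_simps)
    obtain d where d: "\<And>v. v \<in> V \<Longrightarrow> \<tau> (\<tau>' v \<cdot>\<^sub>r c) = v \<cdot>\<^sub>r d"
      by (rule commutant_of_triple[of "\<lambda>v. \<tau> (\<tau>' v \<cdot>\<^sub>r c)"])
        (auto simp: \<tau>V \<tau>'V \<tau>'_add add rsmult_simps \<tau>'_tri tc tri inv)
    have "\<tau> (v \<cdot>\<^sub>r c) = \<tau> v \<cdot>\<^sub>r d" if "v \<in> V" for v
      using d[of "\<tau> v"] that by (simp add: inv \<tau>V)
    then show ?thesis by blast
  qed
  then obtain \<alpha> where \<alpha>: "\<And>v c. v \<in> V \<Longrightarrow> \<tau> (v \<cdot>\<^sub>r c) = \<tau> v \<cdot>\<^sub>r \<alpha> c"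
    by metis
  have \<tau>0: "\<tau> 0 = 0"
    using add[of 0 0] by simp
  have \<tau>_nz: "\<tau> v \<noteq> 0" if "v \<in> V" "v \<noteq> 0" for v
    using inv(2)[of v] inv(2)[of 0] that by (auto simp: \<tau>0)
  obtain a where a: "a \<in> I" using nonempty_I by blast
  define e :: "'i \<Rightarrow> quat" where "e = std_vec a"
  have e: "e \<in> V" "e \<noteq> 0"
    using a by (simp add: e_def) (auto simp: e_def std_vec_def fun_eq_iff)
  note cancel = rsmult_left_cancel[OF \<tau>_nz[OF e]]
  have \<alpha>1: "\<alpha> (x + y) = \<alpha> x + \<alpha> y" for x y
    by (rule cancel) (use e in \<open>simp add: rsmult_simps add flip: \<alpha>\<close>)
  have \<alpha>2: "\<alpha> (x * y) = \<alpha> x * \<alpha> y" for x y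
    by (rule cancel) (use e in \<open>simp flip: \<alpha> rsmult_simps(5)\<close>)
  have \<alpha>3: "\<alpha> (of_real c) = of_real c" for c
    by (rule cancel) (use e in \<open>simp add: real flip: \<alpha>\<close>)
  obtain u where u: "qcnj u * u = 1" "u * qcnj u = 1" and \<alpha>u: "\<And>c. \<alpha> c = qcnj u * c * u"
    using quat_endomorphism_inner[OF \<alpha>1 \<alpha>2 \<alpha>3] by blast
  \<comment> \<open>Undoing the twist by \<open>u\<close> turns the semilinear \<open>\<tau>\<close>
    into a right-linear map, which is given by a matrix.\<close>
  define \<sigma> where "\<sigma> v = \<tau> v \<cdot>\<^sub>r qcnj u" for v
  have \<sigma>V: "\<sigma> v \<in> V" if "v \<in> V" for v
    using that by (simp add: \<sigma>_def \<tau>V)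
  have \<sigma>_add: "\<sigma> (v + w) = \<sigma> v + \<sigma> w" if "v \<in> V" "w \<in> V" for v w
    using that by (simp add: \<sigma>_def add rsmult_simps)
  have \<sigma>_rs: "\<sigma> (v \<cdot>\<^sub>r c) = \<sigma> v \<cdot>\<^sub>r c" if "v \<in> V" for v c
    using that u by (simp add: \<sigma>_def \<alpha> \<alpha>u rsmult_simps mult.assoc)
  have \<sigma>_tri: "\<sigma> (triple v w z) = triple (\<sigma> v) (\<sigma> w) (\<sigma> z)" if "v \<in> V" "w \<in> V" "z \<in> V" for v w z
  proof -
    \<comment> \<open>Scaling both arguments by the unit \<open>qcnj u\<close> conjugates the form
      by \<open>u\<close>; in the triple product all but one overall factor \<open>qcnj u\<close>
      cancel.\<close>
    have "u * (hform x y * qcnj u) = hform (x \<cdot>\<^sub>r qcnj u) (y \<cdot>\<^sub>r qcnj u)" for x y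
      by (simp add: hform_simps mult.assoc)
    then have "qcnj u * hform (x \<cdot>\<^sub>r qcnj u) (y \<cdot>\<^sub>r qcnj u) = hform x y * qcnj u" for x y
      by (metis mult.assoc mult_1 u(1))
    with that show ?thesis
      by (simp add: \<sigma>_def tri) (simp add: triple_def rsmult_simps)
  qed
  have \<sigma>_form: "hform (\<sigma> w) (\<sigma> z) = hform w z" if w: "w \<in> V" "w \<noteq> 0" and z: "z \<in> V" for w z
  proof -
    \<comment> \<open>The defect of the form. Comparing the two triple products yields
      \<open>\<sigma> v D(w) = \<sigma> w D(v)\<close>.\<close>
    define D where "D x = hform (\<sigma> x) (\<sigma> z) - hform x z" for x
    have "\<sigma> v \<cdot>\<^sub>r D w = \<sigma> w \<cdot>\<^sub>r D v" if v: "v \<in> V" for v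
    proof -
      have "triple v w z + w \<cdot>\<^sub>r hform v z = v \<cdot>\<^sub>r hform w z"
        by (simp add: triple_def)
      then have "\<sigma> (triple v w z) + \<sigma> w \<cdot>\<^sub>r hform v z = \<sigma> v \<cdot>\<^sub>r hform w z"
        using v w z by (metis V_closed(4,6) \<sigma>_add \<sigma>_rs)
      then have "triple (\<sigma> v) (\<sigma> w) (\<sigma> z) + \<sigma> w \<cdot>\<^sub>r hform v z = \<sigma> v \<cdot>\<^sub>r hform w z"
        using v w z by (simp add: \<sigma>_tri)
      then show ?thesis
        by (simp add: triple_def D_def rsmult_simps algebra_simps)
    qed
    \<comment> \<open>The choice v = w i works even in dimension one; conjugate linearity turns the
      identity into i D(w) = - i D(w).\<close>
    from this[of "w \<cdot>\<^sub>r \<i>\<i>"] have "\<sigma> w \<cdot>\<^sub>r (\<i>\<i> * D w) = \<sigma> w \<cdot>\<^sub>r (qcnj \<i>\<i> * D w)"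
      using w by (simp add: \<sigma>_rs rsmult_simps D_def hform_simps right_diff_distrib)
    moreover have "\<sigma> w \<noteq> 0"
    proof
      assume "\<sigma> w = 0"
      then have "\<tau> w \<cdot>\<^sub>r (qcnj u * u) = 0" by (simp add: \<sigma>_def fun_eq_iff)
      with \<tau>_nz[OF w] u show False by (simp add: rsmult_simps)
    qed
    ultimately have "\<i>\<i> * D w = qcnj \<i>\<i> * D w"
      by (rule rsmult_left_cancel[rotated])
    then have "D w = 0"
      by (simp add: quat_simps)
    then show ?thesis by (simp add: D_def)
  qed
  define g where "g i j = \<sigma> (std_vec j) i" for i j
  show ?thesis
  proof (intro exI[of _ g] exI[of _ u] conjI ballI allI u)
    fix v i assume v: "v \<in> V"
    have fs: "sum f J i = (\<Sum>x\<in>J. f x i)" for f :: "'i \<Rightarrow> 'i \<Rightarrow> quat" and J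
      by (induction J rule: infinite_finite_induct) auto
    have "\<sigma> v = (\<Sum>j\<in>I. \<sigma> (std_vec j \<cdot>\<^sub>r v j))"
      by (rule additive_expand[OF \<sigma>_add v])
    also have "\<dots> = (\<Sum>j\<in>I. \<sigma> (std_vec j) \<cdot>\<^sub>r v j)"
      by (intro sum.cong refl) (simp add: \<sigma>_rs)
    finally have "\<sigma> v i = (\<Sum>j\<in>I. g i j * v j)"
      by (simp add: fs g_def)
    moreover have "\<tau> v = \<sigma> v \<cdot>\<^sub>r u"
      using u by (simp add: \<sigma>_def rsmult_simps)
    ultimately show "\<tau> v i = (\<Sum>j\<in>I. g i j * v j) * u" by simp
  next
    fix j k assume jk: "j \<in> I" "k \<in> I"
    have "std_vec j \<noteq> 0" by (auto simp: std_vec_def fun_eq_iff)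
    with jk have "hform (\<sigma> (std_vec j)) (\<sigma> (std_vec k)) = of_real (\<epsilon> j) * std_vec k j"
      by (simp add: \<sigma>_form hform_std_vec)
    then show "(\<Sum>i\<in>I. qcnj (g i j) * of_real (\<epsilon> i) * g i k) = (if j = k then of_real (\<epsilon> j) else 0)"
      by (auto simp: hform_def g_def std_vec_def)
  qed
qed

end

section \<open>The Lie algebras of the matrix groups\<close>

instance quat :: real_normed_algebra_1
proof
  show "norm (1 :: quat) = 1"
    by (simp add: norm_quat_def inner_quat_def one_quat_def)
  show "norm (x * y) \<le> norm x * norm y" for x y :: quat
  proof -
    have "inner (x * y) (x * y) = inner x x * inner y y"
      by (simp add: inner_quat_def times_quat_def algebra_simps)
    then show ?thesis
      by (simp add: norm_quat_def real_sqrt_mult)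
  qed
qed

lemma bounded_linear_qcnj: "bounded_linear qcnj"
  by (rule bounded_linear_intro[where K = 1])
    (simp_all add: quat_simps norm_quat_def inner_quat_def)

lemmas has_vector_derivative_qcnj = bounded_linear.has_vector_derivative[OF bounded_linear_qcnj]

lemma has_vector_derivative_const_eq:
  assumes "(f has_vector_derivative d) (at t)" and "f = (\<lambda>s. c)"
  shows "d = 0"
  by (rule vector_derivative_unique_at[OF assms(1)[unfolded assms(2)] has_vector_derivative_const])

lemma mult_mat_index:
  "A \<in> carrier_mat n n \<Longrightarrow> B \<in> carrier_mat n n \<Longrightarrow> i < n \<Longrightarrow> j < n \<Longrightarrow>
    (A * B) $$ (i, j) = (\<Sum>k<n. A $$ (i, k) * B $$ (k, j))"
  by (auto simp: scalar_prod_def atLeast0LessThan intro!: sum.cong)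

text \<open>The diagonal of \<open>Ipq\<close> is kept real-valued, so that it commutes with all
  quaternions.\<close>

definition sgnat :: "nat \<Rightarrow> nat \<Rightarrow> real" where
  "sgnat p i = (if i < p then 1 else -1)"

lemma sgnat_square [simp]: "sgnat p i * sgnat p i = 1"
  by (simp add: sgnat_def)

text \<open>The columns are orthonormal for the indefinite form. This entrywise shape is the one
  that can be differentiated along curves and checked for block matrices.\<close>

lemma Sp_iff:
  "A \<in> Sp p q \<longleftrightarrow> A \<in> carrier_mat (p + q) (p + q) \<and>
    (\<forall>i<p+q. \<forall>j<p+q. (\<Sum>k<p+q. qcnj (A $$ (k, i)) * of_real (sgnat p k) * A $$ (k, j)) =
      (if i = j then of_real (sgnat p i) else 0))"
proof (cases "A \<in> carrier_mat (p + q) (p + q)")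
  case A: True
  let ?n = "p + q"
  have adj: "qadjoint A \<in> carrier_mat ?n ?n"
    using A by (simp add: qadjoint_def)
  have Ipq: "Ipq p q = mat_diag ?n (\<lambda>i. of_real (sgnat p i))"
    by (auto simp: Ipq_def mat_diag_def sgnat_def intro!: eq_matI)
  have e: "(qadjoint A * Ipq p q * A) $$ (i, j) =
      (\<Sum>k<?n. qcnj (A $$ (k, i)) * of_real (sgnat p k) * A $$ (k, j))" if "i < ?n" "j < ?n" for i j
  proof -
    have "qadjoint A * Ipq p q = mat ?n ?n (\<lambda>(i, k). qcnj (A $$ (k, i)) * of_real (sgnat p k))"
      unfolding Ipq mat_diag_mult_right[OF adj]
      using A by (auto simp: qadjoint_def intro!: eq_matI)
    then show ?thesis
      using A that by (subst mult_mat_index[of _ ?n]) (auto intro!: sum.cong)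
  qed
  have d: "dim_row (qadjoint A * Ipq p q * A) = ?n" "dim_col (qadjoint A * Ipq p q * A) = ?n"
    "dim_row (Ipq p q) = ?n" "dim_col (Ipq p q) = ?n"
    using A adj by (simp_all add: Ipq_def mat_diag_def)
  have I: "Ipq p q $$ (i, j) = (if i = j then of_real (sgnat p i) else 0)" if "i < ?n" "j < ?n" for i j
    using that by (simp add: Ipq mat_diag_def)
  have "qadjoint A * Ipq p q * A = Ipq p q \<longleftrightarrow>
      (\<forall>i<?n. \<forall>j<?n. (qadjoint A * Ipq p q * A) $$ (i, j) = Ipq p q $$ (i, j))"
    using eq_matI[of "Ipq p q" "qadjoint A * Ipq p q * A"] unfolding d by metis
  also have "\<dots> \<longleftrightarrow> (\<forall>i<?n. \<forall>j<?n. (\<Sum>k<?n. qcnj (A $$ (k, i)) * of_real (sgnat p k) * A $$ (k, j)) =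
      (if i = j then of_real (sgnat p i) else 0))"
    by (intro all_cong) (simp only: e I)
  finally show ?thesis
    using A by (simp add: Sp_def)
qed (auto simp: Sp_def)

lemma Sp_mult:
  assumes A: "A \<in> Sp p q" and B: "B \<in> Sp p q"
  shows "A * B \<in> Sp p q"
proof -
  let ?n = "p + q"
  have c: "A \<in> carrier_mat ?n ?n" "B \<in> carrier_mat ?n ?n" "Ipq p q \<in> carrier_mat ?n ?n"
    "qadjoint A \<in> carrier_mat ?n ?n" "qadjoint B \<in> carrier_mat ?n ?n"
    using A B by (auto simp: Sp_def qadjoint_def Ipq_def)
  have "qadjoint (A * B) = qadjoint B * qadjoint A"
    using c by (intro eq_matI) (auto simp: qadjoint_def scalar_prod_def qcnj_sum intro!: sum.cong)
  then have "qadjoint (A * B) * Ipq p q * (A * B) = qadjoint B * (qadjoint A * Ipq p q * A) * B"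
    using c by (simp add: assoc_mult_mat[of _ ?n ?n _ ?n _ ?n])
  with A B c show ?thesis
    by (simp add: Sp_def)
qed

section \<open>The tangent space at the identity as a real vector space\<close>

lemma lie_algebraI:
  assumes "X \<in> carrier_mat n n" and "\<gamma> 0 = 1\<^sub>m n" and "\<And>t. \<gamma> t \<in> S"
    and "\<And>t i j. i < n \<Longrightarrow> j < n \<Longrightarrow> ((\<lambda>s. \<gamma> s $$ (i, j)) has_vector_derivative D t i j) (at t)"
    and "\<And>i j. i < n \<Longrightarrow> j < n \<Longrightarrow> D 0 i j = X $$ (i, j)"
  shows "X \<in> lie_algebra n S"
proof -
  have "mat n n (\<lambda>(i, j). D 0 i j) = X"
    using assms(1,5) by (auto intro!: eq_matI)
  then show ?thesis
    using assms(1-4) unfolding lie_algebra_def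
    by (intro CollectI conjI exI[of _ \<gamma>] exI[of _ "\<lambda>t. mat n n (\<lambda>(i, j). D t i j)"]) auto
qed

lemma lie_algebraE:
  assumes "X \<in> lie_algebra n S"
  obtains \<gamma> D where "X \<in> carrier_mat n n" "\<gamma> 0 = 1\<^sub>m n" "\<And>t. \<gamma> t \<in> S"
    "\<And>t i j. i < n \<Longrightarrow> j < n \<Longrightarrow> ((\<lambda>s. \<gamma> s $$ (i, j)) has_vector_derivative D t i j) (at t)"
    "\<And>i j. D (0::real) i j = X $$ (i, j)"
proof -
  from assms obtain \<gamma> \<gamma>' where "X \<in> carrier_mat n n" "\<gamma> 0 = 1\<^sub>m n" "\<gamma>' 0 = X" and
    *: "\<forall>t. \<gamma> t \<in> S \<and>
         (\<forall>i<n. \<forall>j<n. ((\<lambda>s. \<gamma> s $$ (i, j)) has_vector_derivative \<gamma>' t $$ (i, j)) (at t))"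
    unfolding lie_algebra_def by blast
  then show thesis
    by (intro that[of \<gamma> "\<lambda>t i j. \<gamma>' t $$ (i, j)"]) auto
qed

text \<open>By the Leibniz rule the product of two curves through the identity has the sum of their
  velocities there; hence the assumption that \<open>S\<close> is closed under products.\<close>

lemma lie_algebra_add:
  assumes S: "S \<subseteq> carrier_mat n n" and mult: "\<And>A B. A \<in> S \<Longrightarrow> B \<in> S \<Longrightarrow> A * B \<in> S"
    and X: "X \<in> lie_algebra n S" and Y: "Y \<in> lie_algebra n S"
  shows "X + Y \<in> lie_algebra n S"
proof -
  obtain \<gamma> D where 1: "X \<in> carrier_mat n n" "\<gamma> 0 = 1\<^sub>m n" "\<And>t. \<gamma> t \<in> S"
    "\<And>t i j. i < n \<Longrightarrow> j < n \<Longrightarrow> ((\<lambda>s. \<gamma> s $$ (i, j)) has_vector_derivative D t i j) (at t)"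
    "\<And>i j. D (0::real) i j = X $$ (i, j)"
    using lie_algebraE[OF X] by blast
  obtain \<delta> E where 2: "Y \<in> carrier_mat n n" "\<delta> 0 = 1\<^sub>m n" "\<And>t. \<delta> t \<in> S"
    "\<And>t i j. i < n \<Longrightarrow> j < n \<Longrightarrow> ((\<lambda>s. \<delta> s $$ (i, j)) has_vector_derivative E t i j) (at t)"
    "\<And>i j. E (0::real) i j = Y $$ (i, j)"
    using lie_algebraE[OF Y] by blast
  have c: "\<gamma> t \<in> carrier_mat n n" "\<delta> t \<in> carrier_mat n n" for t
    using 1(3) 2(3) S by auto
  show ?thesis
  proof (rule lie_algebraI[where \<gamma> = "\<lambda>t. \<gamma> t * \<delta> t"
        and D = "\<lambda>t i j. \<Sum>k<n. \<gamma> t $$ (i, k) * E t k j + D t i k * \<delta> t $$ (k, j)"])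
    show "((\<lambda>s. (\<gamma> s * \<delta> s) $$ (i, j)) has_vector_derivative
        (\<Sum>k<n. \<gamma> t $$ (i, k) * E t k j + D t i k * \<delta> t $$ (k, j))) (at t)" if "i < n" "j < n" for t i j
      unfolding mult_mat_index[OF c that] using that
      by (intro has_vector_derivative_sum has_vector_derivative_mult 1(4) 2(4)) auto
    show "(\<Sum>k<n. \<gamma> 0 $$ (i, k) * E 0 k j + D 0 i k * \<delta> 0 $$ (k, j)) = (X + Y) $$ (i, j)"
      if "i < n" "j < n" for i j
    proof -
      have "(\<Sum>k<n. \<gamma> 0 $$ (i, k) * E 0 k j + D 0 i k * \<delta> 0 $$ (k, j)) =
          (\<Sum>k<n. (if k = i then Y $$ (i, j) else 0) + (if k = j then X $$ (i, j) else 0))"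
        using that by (intro sum.cong) (auto simp: 1 2)
      with that 1(1) 2(1) show ?thesis
        by (simp add: sum.distrib)
    qed
  qed (use 1 2 in \<open>auto intro: mult\<close>)
qed

text \<open>The curve is run at speed \<open>c\<close>, which may be zero or negative.\<close>

lemma lie_algebra_scale:
  assumes X: "X \<in> lie_algebra n S"
  shows "of_real c \<cdot>\<^sub>m X \<in> lie_algebra n S"
proof -
  obtain \<gamma> D where 1: "X \<in> carrier_mat n n" "\<gamma> 0 = 1\<^sub>m n" "\<And>t. \<gamma> t \<in> S"
    "\<And>t i j. i < n \<Longrightarrow> j < n \<Longrightarrow> ((\<lambda>s. \<gamma> s $$ (i, j)) has_vector_derivative D t i j) (at t)"
    "\<And>i j. D (0::real) i j = X $$ (i, j)"
    using lie_algebraE[OF X] by blast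
  show ?thesis
  proof (rule lie_algebraI[where \<gamma> = "\<lambda>t. \<gamma> (c * t)" and D = "\<lambda>t i j. c *\<^sub>R D (c * t) i j"])
    show "((\<lambda>s. \<gamma> (c * s) $$ (i, j)) has_vector_derivative c *\<^sub>R D (c * t) i j) (at t)"
      if "i < n" "j < n" for t i j
    proof -
      have "((\<lambda>s. c * s) has_real_derivative c) (at t)"
        by (auto intro!: derivative_eq_intros)
      from vector_diff_chain_at[OF this[unfolded has_real_derivative_iff_has_vector_derivative] 1(4)[OF that]]
      show ?thesis by (simp add: o_def)
    qed
  qed (use 1 in \<open>auto simp: scaleR_conv_of_real\<close>)
qed

text \<open>If \<open>U\<^sup>3 = \<kappa> U\<close>, then \<open>exp (t U) = 1 + s U + c U\<^sup>2\<close> with \<open>(s, c)\<close> equal to \<open>(sin t, 1 - cos t)\<close>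
  for \<open>\<kappa> = -1\<close> and to \<open>(sinh t, cosh t - 1)\<close> for \<open>\<kappa> = 1\<close>; both satisfy \<open>2 c = s\<^sup>2 - \<kappa> c\<^sup>2\<close>.\<close>

lemma lie_algebra_one_parameter:
  fixes Q :: "nat \<Rightarrow> nat \<Rightarrow> quat"
  assumes U: "U \<in> carrier_mat n n" and \<kappa>: "\<kappa> = 1 \<or> \<kappa> = (-1::real)"
    and S: "\<And>s c. 2 * c - s * s + \<kappa> * c * c = 0 \<Longrightarrow>
      mat n n (\<lambda>(i, j). (if i = j then 1 else 0) + s *\<^sub>R U $$ (i, j) + c *\<^sub>R Q i j) \<in> S"
  shows "U \<in> lie_algebra n S"
proof -
  obtain s c s' c' :: "real \<Rightarrow> real" where sc:
    "\<And>t. (s has_real_derivative s' t) (at t)" "\<And>t. (c has_real_derivative c' t) (at t)"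
    "\<And>t. 2 * c t - s t * s t + \<kappa> * c t * c t = 0" "s 0 = 0" "c 0 = 0" "s' 0 = 1" "c' 0 = 0"
  proof (cases "\<kappa> = 1")
    case True
    have "cosh t * cosh t = 1 + sinh t * sinh t" for t :: real
      using cosh_square_eq[of t] by (simp add: power2_eq_square)
    with True show thesis
      by (intro that[of sinh cosh "\<lambda>t. cosh t - 1" sinh]) (auto intro!: derivative_eq_intros simp: algebra_simps)
  next
    case False
    with \<kappa> have "\<kappa> = -1" by simp
    moreover have "cos t * cos t = 1 - sin t * sin t" for t :: real
      using sin_cos_squared_add3[of t] by linarith
    ultimately show thesis
      by (intro that[of sin cos "\<lambda>t. 1 - cos t" sin]) (auto intro!: derivative_eq_intros simp: algebra_simps)
  qed
  let ?\<gamma> = "\<lambda>t. mat n n (\<lambda>(i, j). (if i = j then 1 else 0) + s t *\<^sub>R U $$ (i, j) + c t *\<^sub>R Q i j)"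
  show ?thesis
  proof (rule lie_algebraI[where \<gamma> = ?\<gamma> and D = "\<lambda>t i j. s' t *\<^sub>R U $$ (i, j) + c' t *\<^sub>R Q i j"])
    show "((\<lambda>t. ?\<gamma> t $$ (i, j)) has_vector_derivative (s' t *\<^sub>R U $$ (i, j) + c' t *\<^sub>R Q i j)) (at t)"
      if "i < n" "j < n" for t i j
      using that sc(1,2) by (auto intro!: derivative_eq_intros)
  qed (use U sc S in \<open>auto intro!: eq_matI\<close>)
qed

text \<open>Entrywise form of \<open>X* I + I X = 0\<close> with \<open>I = Ipq p q\<close>, the
  defining equation of the group differentiated at the identity.\<close>

definition skew_Sp :: "nat \<Rightarrow> nat \<Rightarrow> quat mat set" where
  "skew_Sp p q = {X \<in> carrier_mat (p + q) (p + q). \<forall>i<p+q. \<forall>j<p+q.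
    X $$ (j, i) = - (of_real (sgnat p i * sgnat p j) * qcnj (X $$ (i, j)))}"

lemma skew_Sp_carrier: "X \<in> skew_Sp p q \<Longrightarrow> X \<in> carrier_mat (p + q) (p + q)"
  by (simp add: skew_Sp_def)

lemma skew_SpI:
  assumes "X \<in> carrier_mat (p + q) (p + q)"
    and "\<And>i j. i < p + q \<Longrightarrow> j < p + q \<Longrightarrow>
      X $$ (j, i) = - (of_real (sgnat p i * sgnat p j) * qcnj (X $$ (i, j)))"
  shows "X \<in> skew_Sp p q"
  using assms unfolding skew_Sp_def by blast

lemma of_real_sgnat_cancel [simp]: "of_real (sgnat p i) * (of_real (sgnat p i) * x) = (x :: quat)"
  by (simp add: sgnat_def)

lemma skew_SpD:
  assumes "X \<in> skew_Sp p q" "i < p + q" "j < p + q"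
  shows "X $$ (j, i) = - (of_real (sgnat p i * sgnat p j) * qcnj (X $$ (i, j)))"
    and "qcnj (X $$ (j, i)) * of_real (sgnat p j) = - (of_real (sgnat p i) * X $$ (i, j))"
proof -
  show X: "X $$ (j, i) = - (of_real (sgnat p i * sgnat p j) * qcnj (X $$ (i, j)))"
    using assms unfolding skew_Sp_def by blast
  show "qcnj (X $$ (j, i)) * of_real (sgnat p j) = - (of_real (sgnat p i) * X $$ (i, j))"
    unfolding X by (cases "i < p"; cases "j < p") (simp_all add: sgnat_def)
qed

text \<open>The sums in \<open>Sp_iff\<close> are constant along a curve in the group, so their
  derivative at 0 vanishes; there the curve is the identity and only two terms are left.\<close>

lemma lie_algebra_Sp_subset: "lie_algebra (p + q) (Sp p q) \<subseteq> skew_Sp p q"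
proof
  let ?n = "p + q"
  fix X assume X: "X \<in> lie_algebra ?n (Sp p q)"
  obtain \<gamma> D where 1: "X \<in> carrier_mat ?n ?n" "\<gamma> 0 = 1\<^sub>m ?n" "\<And>t. \<gamma> t \<in> Sp p q"
    "\<And>t i j. i < ?n \<Longrightarrow> j < ?n \<Longrightarrow> ((\<lambda>s. \<gamma> s $$ (i, j)) has_vector_derivative D t i j) (at t)"
    "\<And>i j. D (0::real) i j = X $$ (i, j)"
    using lie_algebraE[OF X] by blast
  have "X $$ (j, i) = - (of_real (sgnat p i * sgnat p j) * qcnj (X $$ (i, j)))" if ij: "i < ?n" "j < ?n" for i j
  proof -
    have "((\<lambda>t. \<Sum>k<?n. qcnj (\<gamma> t $$ (k, i)) * (of_real (sgnat p k) * \<gamma> t $$ (k, j))) has_vector_derivative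
        (\<Sum>k<?n. qcnj (\<gamma> 0 $$ (k, i)) * (of_real (sgnat p k) * D 0 k j) +
          qcnj (D 0 k i) * (of_real (sgnat p k) * \<gamma> 0 $$ (k, j)))) (at 0)"
      using ij by (intro has_vector_derivative_sum has_vector_derivative_mult has_vector_derivative_qcnj
          has_vector_derivative_mult_right 1(4)) simp_all
    moreover have "(\<lambda>t. \<Sum>k<?n. qcnj (\<gamma> t $$ (k, i)) * (of_real (sgnat p k) * \<gamma> t $$ (k, j))) =
        (\<lambda>t. if i = j then of_real (sgnat p i) else 0)"
      using 1(3) ij unfolding Sp_iff by (intro ext) (simp only: mult.assoc)
    ultimately have "(\<Sum>k<?n. qcnj (\<gamma> 0 $$ (k, i)) * (of_real (sgnat p k) * D 0 k j) +
          qcnj (D 0 k i) * (of_real (sgnat p k) * \<gamma> 0 $$ (k, j))) = 0"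
      by (rule has_vector_derivative_const_eq)
    also have "(\<Sum>k<?n. qcnj (\<gamma> 0 $$ (k, i)) * (of_real (sgnat p k) * D 0 k j) +
          qcnj (D 0 k i) * (of_real (sgnat p k) * \<gamma> 0 $$ (k, j))) =
        (\<Sum>k<?n. (if k = i then of_real (sgnat p i) * X $$ (i, j) else 0) +
          (if k = j then qcnj (X $$ (j, i)) * of_real (sgnat p j) else 0))"
      using ij by (intro sum.cong) (auto simp: 1(2,5))
    also have "\<dots> = of_real (sgnat p i) * X $$ (i, j) + qcnj (X $$ (j, i)) * of_real (sgnat p j)"
      using ij by (simp add: sum.distrib)
    finally have "of_real (sgnat p i) * X $$ (i, j) + qcnj (X $$ (j, i)) * of_real (sgnat p j) = 0" .
    then show ?thesis
      by (cases "i < p"; cases "j < p") (auto simp: sgnat_def quat_simps)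
  qed
  with 1(1) show "X \<in> skew_Sp p q"
    by (rule skew_SpI)
qed

text \<open>Here \<open>Q\<close> is \<open>X^2\<close>. Skew symmetry turns the adjoint factor into
  \<open>1 - s X + c Q\<close>. Its product with \<open>1 + s X + c Q\<close> is
  \<open>1 + (2 c - s^2 + \<kappa> c^2) Q\<close>, because \<open>X^3 = \<kappa> X\<close> makes the
  odd terms cancel.\<close>

lemma one_parameter_in_Sp:
  assumes X: "X \<in> skew_Sp p q"
    and Q: "\<And>i j. i < p + q \<Longrightarrow> j < p + q \<Longrightarrow> (\<Sum>k<p+q. X $$ (i, k) * X $$ (k, j)) = Q i j"
    and cube: "\<And>i j. i < p + q \<Longrightarrow> j < p + q \<Longrightarrow> (\<Sum>k<p+q. Q i k * X $$ (k, j)) = \<kappa> *\<^sub>R X $$ (i, j)"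
    and cube': "\<And>i j. i < p + q \<Longrightarrow> j < p + q \<Longrightarrow> (\<Sum>k<p+q. X $$ (i, k) * Q k j) = \<kappa> *\<^sub>R X $$ (i, j)"
    and quart: "\<And>i j. i < p + q \<Longrightarrow> j < p + q \<Longrightarrow> (\<Sum>k<p+q. Q i k * Q k j) = \<kappa> *\<^sub>R Q i j"
    and sc: "2 * c - s * s + \<kappa> * c * c = 0"
  shows "mat (p + q) (p + q) (\<lambda>(i, j). (if i = j then 1 else 0) + s *\<^sub>R X $$ (i, j) + c *\<^sub>R Q i j) \<in> Sp p q"
    (is "?A \<in> _")
proof -
  let ?n = "p + q"
  let ?e = "\<lambda>i. of_real (sgnat p i) :: quat"
  have Qs: "qcnj (Q j i) * ?e j = ?e i * Q i j" if ij: "i < ?n" "j < ?n" for i j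
  proof -
    have "qcnj (Q j i) * ?e j = (\<Sum>k<?n. qcnj (X $$ (k, i)) * (qcnj (X $$ (j, k)) * ?e j))"
      using ij by (simp add: qcnj_sum sum_distrib_right mult.assoc flip: Q)
    also have "\<dots> = (\<Sum>k<?n. ?e i * (X $$ (i, k) * X $$ (k, j)))"
    proof (intro sum.cong refl)
      fix k assume "k \<in> {..<?n}"
      with ij have "qcnj (X $$ (j, k)) * ?e j = - (?e k * X $$ (k, j))"
        by (simp add: skew_SpD(2)[OF X])
      then have "qcnj (X $$ (k, i)) * (qcnj (X $$ (j, k)) * ?e j) =
          - ((qcnj (X $$ (k, i)) * ?e k) * X $$ (k, j))"
        by (simp add: mult.assoc)
      also have "qcnj (X $$ (k, i)) * ?e k = - (?e i * X $$ (i, k))"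
        using ij \<open>k \<in> _\<close> by (simp add: skew_SpD(2)[OF X])
      also have "- (- (?e i * X $$ (i, k)) * X $$ (k, j)) = ?e i * (X $$ (i, k) * X $$ (k, j))"
        by (simp add: mult.assoc)
      finally show "qcnj (X $$ (k, i)) * (qcnj (X $$ (j, k)) * ?e j) = ?e i * (X $$ (i, k) * X $$ (k, j))" .
    qed
    finally show ?thesis
      using ij by (simp add: sum_distrib_left flip: Q)
  qed
  have "(\<Sum>k<?n. qcnj (?A $$ (k, i)) * ?e k * ?A $$ (k, j)) = (if i = j then ?e i else 0)"
    if ij: "i < ?n" "j < ?n" for i j
  proof -
    define d where "d a b = (if a = b then 1 else 0 :: quat)" for a b :: nat
    have ds: "(\<Sum>k<?n. d i k * f k) = f i" "(\<Sum>k<?n. f k * d k j) = f j" for f :: "nat \<Rightarrow> quat"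
      using ij by (simp_all add: d_def if_distrib[of "\<lambda>x. x * _"] if_distrib[of "\<lambda>x. _ * x"] cong: if_cong)
    have sR: "qcnj (r *\<^sub>R x) = r *\<^sub>R qcnj x" for r x
      by (simp add: scaleR_conv_of_real quat_real_commute)
    have "qcnj (?A $$ (k, i)) * ?e k = ?e i * (d i k - s *\<^sub>R X $$ (i, k) + c *\<^sub>R Q i k)" if "k < ?n" for k
      using ij that skew_SpD(2)[OF X, of i k] Qs[of i k]
      by (auto simp: sR d_def distrib_right distrib_left right_diff_distrib)
    then have "(\<Sum>k<?n. qcnj (?A $$ (k, i)) * ?e k * ?A $$ (k, j)) =
        (\<Sum>k<?n. ?e i * (d i k - s *\<^sub>R X $$ (i, k) + c *\<^sub>R Q i k) * (d k j + s *\<^sub>R X $$ (k, j) + c *\<^sub>R Q k j))"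
      using ij by (intro sum.cong) (auto simp: d_def)
    also have "\<dots> = ?e i * (\<Sum>k<?n. d i k * (d k j + s *\<^sub>R X $$ (k, j) + c *\<^sub>R Q k j) - s *\<^sub>R (X $$ (i, k) * d k j) -
        (s * s) *\<^sub>R (X $$ (i, k) * X $$ (k, j)) - (s * c) *\<^sub>R (X $$ (i, k) * Q k j) +
        c *\<^sub>R (Q i k * d k j) + (s * c) *\<^sub>R (Q i k * X $$ (k, j)) + (c * c) *\<^sub>R (Q i k * Q k j))"
      unfolding sum_distrib_left by (intro sum.cong refl) (simp add: algebra_simps)
    also have "\<dots> = ?e i * (d i j + s *\<^sub>R X $$ (i, j) + c *\<^sub>R Q i j - s *\<^sub>R X $$ (i, j) - (s * s) *\<^sub>R Q i j -
        (s * c) *\<^sub>R (\<kappa> *\<^sub>R X $$ (i, j)) + c *\<^sub>R Q i j + (s * c) *\<^sub>R (\<kappa> *\<^sub>R X $$ (i, j)) + (c * c) *\<^sub>R (\<kappa> *\<^sub>R Q i j))"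
      using ij by (simp only: sum.distrib sum_subtractf ds scaleR_right.sum[symmetric] Q cube cube' quart)
    also have "\<dots> = ?e i * (d i j + (c *\<^sub>R Q i j + c *\<^sub>R Q i j - (s * s) *\<^sub>R Q i j + (\<kappa> * c * c) *\<^sub>R Q i j))"
      by (simp add: algebra_simps)
    also have "\<dots> = ?e i * (d i j + (c + c - s * s + \<kappa> * c * c) *\<^sub>R Q i j)"
      by (simp only: scaleR_add_left scaleR_diff_left)
    also have "c + c - s * s + \<kappa> * c * c = 0"
      using sc by simp
    finally show ?thesis
      by (simp add: d_def)
  qed
  then show ?thesis
    unfolding Sp_iff by simp
qed

text \<open>On the coordinates \<open>i\<close> and \<open>j\<close> the square of \<open>Y\<close>
  is the scalar \<open>\<kappa>\<close>, the entries at \<open>(i, j)\<close> and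
  \<open>(j, i)\<close> being \<open>b\<close> and \<open>\<kappa> qcnj b\<close>. Equal signs of
  the form give rotations, opposite signs hyperbolic rotations. The case \<open>i = j\<close> is
  included: there \<open>b\<close> is an imaginary unit.\<close>

lemma elementary_in_lie_algebra:
  assumes Y: "Y \<in> skew_Sp p q" and ij: "i < p + q" "j < p + q"
    and supp: "\<And>k l. k < p + q \<Longrightarrow> l < p + q \<Longrightarrow> (k, l) \<noteq> (i, j) \<Longrightarrow> (k, l) \<noteq> (j, i) \<Longrightarrow> Y $$ (k, l) = 0"
    and unit: "Y $$ (i, j) * qcnj (Y $$ (i, j)) = 1"
  shows "Y \<in> lie_algebra (p + q) (Sp p q)"
proof -
  let ?n = "p + q"
  define b where "b = Y $$ (i, j)"
  define \<kappa> where "\<kappa> = - (sgnat p i * sgnat p j)"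
  define Q :: "nat \<Rightarrow> nat \<Rightarrow> quat" where "Q k l = (if k = l \<and> (k = i \<or> k = j) then of_real \<kappa> else 0)" for k l
  have b: "b * qcnj b = 1" "qcnj b * b = 1"
    using unit by (simp_all add: b_def mult_qcnj_self qcnj_mult_self)
  have bd: "Y $$ (j, i) = of_real \<kappa> * qcnj b"
    using skew_SpD(1)[OF Y ij] by (simp add: \<kappa>_def b_def)
  have Yij: "Y $$ (k, l) = (if k = i \<and> l = j then b else if k = j \<and> l = i then of_real \<kappa> * qcnj b else 0)"
    if "k < ?n" "l < ?n" for k l
  proof (cases "k = i \<and> l = j")
    case False
    then show ?thesis
      using supp[OF that] by (cases "k = j \<and> l = i") (auto simp: bd)
  qed (simp add: b_def)
  have b\<kappa>b: "b * (of_real \<kappa> * qcnj b) = of_real \<kappa>"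
  proof -
    have "b * (of_real \<kappa> * qcnj b) = of_real \<kappa> * (b * qcnj b)"
      by (metis mult.assoc quat_real_commute)
    with b(1) show ?thesis by simp
  qed
  have QQ: "(\<Sum>m<?n. Y $$ (k, m) * Y $$ (m, l)) = Q k l" if kl: "k < ?n" "l < ?n" for k l
  proof -
    consider "k = i" | "k = j" "k \<noteq> i" | "k \<noteq> i" "k \<noteq> j" by blast
    then show ?thesis
    proof cases
      case 1
      then have "(\<Sum>m<?n. Y $$ (k, m) * Y $$ (m, l)) = (\<Sum>m<?n. if m = j then b * Y $$ (j, l) else 0)"
        using kl by (intro sum.cong refl) (auto simp: Yij)
      then have "(\<Sum>m<?n. Y $$ (k, m) * Y $$ (m, l)) = b * Y $$ (j, l)"
        using ij by simp
      also have "Y $$ (j, l) = (if l = i then of_real \<kappa> * qcnj b else 0)"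
        using supp[of j l] kl ij bd by (cases "(j, l) = (i, j)") auto
      finally show ?thesis
        using 1 b\<kappa>b by (simp add: Q_def)
    next
      case 2
      then have "(\<Sum>m<?n. Y $$ (k, m) * Y $$ (m, l)) =
          (\<Sum>m<?n. if m = i then (of_real \<kappa> * qcnj b) * Y $$ (i, l) else 0)"
        using kl by (intro sum.cong refl) (auto simp: Yij)
      then show ?thesis
        using 2 kl ij b by (auto simp: Yij Q_def mult.assoc)
    next
      case 3
      with kl show ?thesis by (simp add: Yij Q_def)
    qed
  qed
  have Qr: "(\<Sum>m<?n. Q k m * f m) = (if k = i \<or> k = j then of_real \<kappa> * f k else 0)" if "k < ?n" for k f
  proof -
    have "(\<Sum>m<?n. Q k m * f m) = (\<Sum>m<?n. if m = k then (if k = i \<or> k = j then of_real \<kappa> * f k else 0) else 0)"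
      by (intro sum.cong refl) (auto simp: Q_def)
    with that show ?thesis by simp
  qed
  have Ql: "(\<Sum>m<?n. f m * Q m k) = (if k = i \<or> k = j then f k * of_real \<kappa> else 0)" if "k < ?n" for k f
  proof -
    have "(\<Sum>m<?n. f m * Q m k) = (\<Sum>m<?n. if m = k then (if k = i \<or> k = j then f k * of_real \<kappa> else 0) else 0)"
      by (intro sum.cong refl) (auto simp: Q_def)
    with that show ?thesis by simp
  qed
  show ?thesis
  proof (rule lie_algebra_one_parameter[where \<kappa> = \<kappa> and Q = Q])
    show "Y \<in> carrier_mat ?n ?n" using Y by (rule skew_Sp_carrier)
    show "\<kappa> = 1 \<or> \<kappa> = -1" by (simp add: \<kappa>_def sgnat_def)
    show "mat ?n ?n (\<lambda>(i, j). (if i = j then 1 else 0) + s *\<^sub>R Y $$ (i, j) + c *\<^sub>R Q i j) \<in> Sp p q"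
      if "2 * c - s * s + \<kappa> * c * c = 0" for s c
    proof (rule one_parameter_in_Sp[OF Y QQ _ _ _ that])
      show "(\<Sum>m<?n. Q k m * Y $$ (m, l)) = \<kappa> *\<^sub>R Y $$ (k, l)" if "k < ?n" "l < ?n" for k l
        using that by (simp add: Qr scaleR_conv_of_real) (auto simp: Yij)
      show "(\<Sum>m<?n. Y $$ (k, m) * Q m l) = \<kappa> *\<^sub>R Y $$ (k, l)" if "k < ?n" "l < ?n" for k l
        using that by (simp add: Ql scaleR_conv_of_real quat_real_commute) (auto simp: Yij)
      show "(\<Sum>m<?n. Q k m * Q m l) = \<kappa> *\<^sub>R Q k l" if "k < ?n" "l < ?n" for k l
        using that by (simp add: Qr scaleR_conv_of_real) (auto simp: Q_def)
    qed
  qed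
qed

lemma one_in_Sp: "1\<^sub>m (p + q) \<in> Sp p q"
proof -
  have I: "Ipq p q \<in> carrier_mat (p + q) (p + q)"
    by (simp add: Ipq_def)
  have "qadjoint (1\<^sub>m (p + q)) = 1\<^sub>m (p + q)"
    by (rule eq_matI) (simp_all add: qadjoint_def)
  then have "qadjoint (1\<^sub>m (p + q)) * Ipq p q * 1\<^sub>m (p + q) = Ipq p q"
    using left_mult_one_mat[OF I] right_mult_one_mat[OF I] by simp
  then show ?thesis
    by (simp add: Sp_def)
qed

text \<open>Induction on the number of nonzero entries: a skew matrix is a sum of pieces supported
  at one pair of positions \<open>(i, j)\<close>, \<open>(j, i)\<close>, each a real multiple of a
  matrix for which \<open>elementary_in_lie_algebra\<close> supplies a curve.\<close>

theorem lie_algebra_Sp: "lie_algebra (p + q) (Sp p q) = skew_Sp p q"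
proof (rule antisym[OF lie_algebra_Sp_subset], rule subsetI)
  let ?n = "p + q"
  fix X assume "X \<in> skew_Sp p q"
  then show "X \<in> lie_algebra ?n (Sp p q)"
  proof (induction "card {x \<in> {..<?n} \<times> {..<?n}. X $$ x \<noteq> 0}" arbitrary: X rule: less_induct)
    case less
    note X = \<open>X \<in> skew_Sp p q\<close>
    show ?case
    proof (cases "\<forall>i<?n. \<forall>j<?n. X $$ (i, j) = 0")
      case True
      then show ?thesis
        using skew_Sp_carrier[OF X]
        by (intro lie_algebraI[where \<gamma> = "\<lambda>_. 1\<^sub>m ?n" and D = "\<lambda>_ _ _. 0"]) (auto simp: one_in_Sp)
    next
      case False
      then obtain i j where ij: "i < ?n" "j < ?n" "X $$ (i, j) \<noteq> 0" by blast
      \<comment> \<open>Dividing by the norm makes the entry at \<open>(i, j)\<close> a unit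
        quaternion, which the elementary curves require.\<close>
      define N where "N = norm (X $$ (i, j))"
      have N: "N > 0" "of_real (N * N) = X $$ (i, j) * qcnj (X $$ (i, j))"
        using ij by (simp_all add: N_def mult_qcnj_self dot_square_norm power2_eq_square)
      define Y where "Y = mat ?n ?n (\<lambda>x. if x = (i, j) \<or> x = (j, i) then X $$ x else 0)"
      define Z where "Z = mat ?n ?n (\<lambda>x. if x = (i, j) \<or> x = (j, i) then 0 else X $$ x)"
      define U where "U = of_real (1 / N) \<cdot>\<^sub>m Y"
      have UY: "Y = of_real N \<cdot>\<^sub>m U"
        using N by (auto simp: U_def Y_def of_real_inverse_cancel intro!: eq_matI)
      have "U \<in> skew_Sp p q"
      proof (rule skew_SpI)
        fix k l assume kl: "k < ?n" "l < ?n"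
        show "U $$ (l, k) = - (of_real (sgnat p k * sgnat p l) * qcnj (U $$ (k, l)))"
        proof (cases "(l, k) = (i, j) \<or> (l, k) = (j, i)")
          case True
          then have e: "U $$ (l, k) = (1 / N) *\<^sub>R X $$ (l, k)" "U $$ (k, l) = (1 / N) *\<^sub>R X $$ (k, l)"
            using kl by (auto simp: U_def Y_def quat_scaleR_conv)
          show ?thesis
            unfolding e skew_SpD(1)[OF X kl]
            by (simp add: quat_scaleR_conv qcnj_scaleR del: of_real_mult)
        next
          case False
          then have "U $$ (l, k) = 0" "U $$ (k, l) = 0"
            using kl by (auto simp: U_def Y_def)
          then show ?thesis by simp
        qed
      qed (simp add: U_def Y_def)
      moreover have "U $$ (i, j) * qcnj (U $$ (i, j)) = 1"
      proof -
        have "U $$ (i, j) * qcnj (U $$ (i, j)) = of_real (1 / N) * (X $$ (i, j) * qcnj (X $$ (i, j))) * of_real (1 / N)"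
          using ij by (simp add: U_def Y_def mult.assoc del: of_real_mult)
        also have "\<dots> = of_real (1 / N * (N * N) * (1 / N))"
          by (simp only: N(2)[symmetric] of_real_mult)
        finally show ?thesis using N(1) by simp
      qed
      ultimately have "U \<in> lie_algebra ?n (Sp p q)"
        using ij by (intro elementary_in_lie_algebra[of _ _ _ i j]) (auto simp: U_def Y_def)
      then have Yl: "Y \<in> lie_algebra ?n (Sp p q)"
        unfolding UY by (rule lie_algebra_scale)
      have "Z $$ x \<noteq> 0 \<longrightarrow> X $$ x \<noteq> 0" if "x \<in> {..<?n} \<times> {..<?n}" for x
        using that unfolding Z_def by (cases x) (simp split: if_split)
      then have "{x \<in> {..<?n} \<times> {..<?n}. Z $$ x \<noteq> 0} \<subseteq> {x \<in> {..<?n} \<times> {..<?n}. X $$ x \<noteq> 0}"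
        by blast
      moreover have "(i, j) \<in> {x \<in> {..<?n} \<times> {..<?n}. X $$ x \<noteq> 0}" "(i, j) \<notin> {x \<in> {..<?n} \<times> {..<?n}. Z $$ x \<noteq> 0}"
        using ij by (simp_all add: Z_def)
      ultimately have "{x \<in> {..<?n} \<times> {..<?n}. Z $$ x \<noteq> 0} \<subset> {x \<in> {..<?n} \<times> {..<?n}. X $$ x \<noteq> 0}"
        by blast
      then have "card {x \<in> {..<?n} \<times> {..<?n}. Z $$ x \<noteq> 0} < card {x \<in> {..<?n} \<times> {..<?n}. X $$ x \<noteq> 0}"
        by (intro psubset_card_mono) auto
      moreover have "Z \<in> skew_Sp p q"
      proof (rule skew_SpI)
        fix k l assume kl: "k < ?n" "l < ?n"
        show "Z $$ (l, k) = - (of_real (sgnat p k * sgnat p l) * qcnj (Z $$ (k, l)))"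
        proof (cases "(l, k) = (i, j) \<or> (l, k) = (j, i)")
          case False
          then have e: "Z $$ (l, k) = X $$ (l, k)" "Z $$ (k, l) = X $$ (k, l)"
            using kl by (auto simp: Z_def)
          show ?thesis
            unfolding e by (rule skew_SpD(1)[OF X kl])
        next
          case True
          then have "Z $$ (l, k) = 0" "Z $$ (k, l) = 0"
            using kl by (auto simp: Z_def)
          then show ?thesis by simp
        qed
      qed (simp add: Z_def)
      ultimately have Zl: "Z \<in> lie_algebra ?n (Sp p q)"
        by (rule less.hyps)
      have "Sp p q \<subseteq> carrier_mat ?n ?n"
        unfolding Sp_def by blast
      then have "Y + Z \<in> lie_algebra ?n (Sp p q)"
        by (rule lie_algebra_add[OF _ _ Yl Zl]) (rule Sp_mult)
      also have "Y + Z = X"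
        using skew_Sp_carrier[OF X] by (auto simp: Y_def Z_def intro!: eq_matI)
      finally show ?thesis .
    qed
  qed
qed

text \<open>The Lie algebra of the embedded \<open>K\<close>. Differentiating
  \<open>qcnj \<eta> * \<eta> = 1\<close> leaves an imaginary velocity; conversely, an imaginary
  unit has square -1 and generates a circle, and the other velocities follow by real
  scaling.\<close>

lemma lie_algebra_circle:
  assumes r: "r < n"
  shows "lie_algebra n {mat n n (\<lambda>(i, j). if i = j then if i = r then \<eta> else 1 else 0) | \<eta>. qcnj \<eta> * \<eta> = 1} =
    {mat n n (\<lambda>x. if x = (r, r) then a else 0) | a. qre a = 0}" (is "lie_algebra n ?S = ?R")
proof (intro antisym subsetI)
  fix X assume X: "X \<in> lie_algebra n ?S"
  obtain \<gamma> D where 1: "X \<in> carrier_mat n n" "\<gamma> 0 = 1\<^sub>m n" "\<And>t. \<gamma> t \<in> ?S"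
    "\<And>t i j. i < n \<Longrightarrow> j < n \<Longrightarrow> ((\<lambda>s. \<gamma> s $$ (i, j)) has_vector_derivative D t i j) (at t)"
    "\<And>i j. D (0::real) i j = X $$ (i, j)"
    using lie_algebraE[OF X] by blast
  have \<gamma>: "\<exists>\<eta>. qcnj \<eta> * \<eta> = 1 \<and> (\<forall>i<n. \<forall>j<n. \<gamma> s $$ (i, j) = (if i = j then if i = r then \<eta> else 1 else 0))" for s
    using 1(3)[of s] by fastforce
  have "X $$ (i, j) = 0" if ij: "i < n" "j < n" "(i, j) \<noteq> (r, r)" for i j
  proof -
    have "\<gamma> s $$ (i, j) = (if i = j then 1 else 0)" for s
      using \<gamma>[of s] ij by auto
    then have "D 0 i j = 0"
      by (intro has_vector_derivative_const_eq[OF 1(4)[OF ij(1,2), of 0]]) (rule ext)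
    then show ?thesis
      by (simp add: 1(5))
  qed
  moreover have "qre (X $$ (r, r)) = 0"
  proof -
    have d: "((\<lambda>s. qcnj (\<gamma> s $$ (r, r)) * \<gamma> s $$ (r, r)) has_vector_derivative
        (qcnj (\<gamma> 0 $$ (r, r)) * D 0 r r + qcnj (D 0 r r) * \<gamma> 0 $$ (r, r))) (at 0)"
      using r by (intro has_vector_derivative_mult has_vector_derivative_qcnj 1(4))
    have "qcnj (\<gamma> s $$ (r, r)) * \<gamma> s $$ (r, r) = 1" for s
      using \<gamma>[of s] r by auto
    then have "qcnj (\<gamma> 0 $$ (r, r)) * D 0 r r + qcnj (D 0 r r) * \<gamma> 0 $$ (r, r) = 0"
      by (intro has_vector_derivative_const_eq[OF d]) (rule ext)
    then have "X $$ (r, r) + qcnj (X $$ (r, r)) = 0"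
      using r by (simp add: 1(2,5))
    then show ?thesis
      by (simp add: quat_simps)
  qed
  ultimately show "X \<in> ?R"
    using 1(1) by (intro CollectI exI[of _ "X $$ (r, r)"]) (auto intro!: eq_matI)
next
  fix X assume "X \<in> ?R"
  then obtain a where a: "qre a = 0" and X: "X = mat n n (\<lambda>x. if x = (r, r) then a else 0)" by blast
  show "X \<in> lie_algebra n ?S"
  proof (cases "a = 0")
    case True
    then show ?thesis
      by (intro lie_algebraI[where \<gamma> = "\<lambda>_. 1\<^sub>m n" and D = "\<lambda>_ _ _. 0"])
        (auto simp: X intro!: exI[of _ 1] eq_matI)
  next
    case False
    define N where "N = norm a"
    have N: "N > 0" using False by (simp add: N_def)
    define b where "b = of_real (1 / N) * a"
    have "inner a a = N * N" by (simp add: N_def dot_square_norm power2_eq_square)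
    then have "(qi a)\<^sup>2 + (qj a)\<^sup>2 + (qk a)\<^sup>2 = N\<^sup>2"
      using a by (simp add: inner_quat_def power2_eq_square)
    then have b1: "(qi b)\<^sup>2 + (qj b)\<^sup>2 + (qk b)\<^sup>2 = 1"
      using N a by (simp add: b_def quat_of_real times_quat_def power_divide flip: add_divide_distrib)
    have b0: "qre b = 0"
      using a by (simp add: b_def quat_of_real times_quat_def)
    define U where "U = mat n n (\<lambda>x. if x = (r, r) then b else 0)"
    have Ul: "U \<in> lie_algebra n ?S"
    proof (rule lie_algebra_one_parameter[where \<kappa> = "-1" and Q = "\<lambda>i j. if i = r \<and> j = r then -1 else 0"])
      fix s c :: real assume sc: "2 * c - s * s + - 1 * c * c = 0"
      \<comment> \<open>This is \<open>cos t + b sin t\<close> for \<open>s = sin t\<close> and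
        \<open>c = 1 - cos t\<close>.\<close>
      let ?\<eta> = "1 + s *\<^sub>R b + c *\<^sub>R (-1)"
      have "qcnj ?\<eta> * ?\<eta> = of_real ((1 - c) * (1 - c) + s * s * ((qi b)\<^sup>2 + (qj b)\<^sup>2 + (qk b)\<^sup>2))"
        using b0 by (simp add: quat_simps quat_of_real algebra_simps power2_eq_square)
      also have "\<dots> = 1"
        using sc by (simp only: b1) (simp add: algebra_simps)
      finally show "mat n n (\<lambda>(i, j). (if i = j then 1 else 0) + s *\<^sub>R U $$ (i, j) +
          c *\<^sub>R (if i = r \<and> j = r then -1 else 0)) \<in> ?S"
        by (intro CollectI exI[of _ ?\<eta>]) (auto simp: U_def intro!: eq_matI)
    qed (auto simp: U_def)
    have "X = of_real N \<cdot>\<^sub>m U"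
      using N by (auto simp: X U_def b_def of_real_inverse_cancel intro!: eq_matI)
    then show ?thesis
      using lie_algebra_scale[OF Ul, of N] by metis
  qed
qed

section \<open>Automorphism groups of real algebras of matrices\<close>

text \<open>Closure under the operations is all that is assumed, so the group-theoretic facts hold
  for a product that violates the Jacobi identity.\<close>

locale bracket_space =
  fixes V :: "quat mat set"
  assumes V_add: "X \<in> V \<Longrightarrow> Y \<in> V \<Longrightarrow> X + Y \<in> V"
    and V_smult: "X \<in> V \<Longrightarrow> of_real c \<cdot>\<^sub>m X \<in> V"
    and V_bracket: "X \<in> V \<Longrightarrow> Y \<in> V \<Longrightarrow> bracket_on V X Y \<in> V"
begin

lemma linear_endo_compose:
  assumes "S \<in> Bij V" "linear_endo V S" "T \<in> Bij V" "linear_endo V T"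
  shows "linear_endo V (compose V S T)"
  using assms V_add V_smult by (auto simp: linear_endo_def compose_def Pi_iff)

lemma Bij_inv:
  assumes "T \<in> Bij V" "X \<in> V"
  shows "inv_into V T X \<in> V" "T (inv_into V T X) = X"
  using assms by (auto simp: Bij_def bij_betw_def f_inv_into_f inv_into_into)

lemma Bij_inv_eq:
  assumes "T \<in> Bij V" "X \<in> V" "T X = Y"
  shows "inv_into V T Y = X"
  using assms by (auto simp: Bij_def bij_betw_def)

lemma linear_endo_inv:
  assumes T: "T \<in> Bij V" "linear_endo V T"
  shows "linear_endo V (restrict (inv_into V T) V)"
proof -
  note i = Bij_inv[OF T(1)]
  have "inv_into V T (X + Y) = inv_into V T X + inv_into V T Y" if "X \<in> V" "Y \<in> V" for X Y
    using that T(2) i by (intro Bij_inv_eq[OF T(1)]) (auto simp: linear_endo_def V_add)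
  moreover have "inv_into V T (of_real c \<cdot>\<^sub>m X) = of_real c \<cdot>\<^sub>m inv_into V T X" if "X \<in> V" for X c
    using that T(2) i by (intro Bij_inv_eq[OF T(1)]) (auto simp: linear_endo_def V_smult)
  ultimately show ?thesis
    using i by (auto simp: linear_endo_def V_add V_smult)
qed

lemma subgroup_GL: "subgroup {T \<in> Bij V. linear_endo V T} (BijGroup V)"
proof (rule subgroup.intro)
  show "{T \<in> Bij V. linear_endo V T} \<subseteq> carrier (BijGroup V)"
    by (auto simp: BijGroup_def)
  show "\<one>\<^bsub>BijGroup V\<^esub> \<in> {T \<in> Bij V. linear_endo V T}"
    by (simp add: BijGroup_def id_Bij linear_endo_def V_add V_smult)
  show "S \<otimes>\<^bsub>BijGroup V\<^esub> T \<in> {T \<in> Bij V. linear_endo V T}"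
    if "S \<in> {T \<in> Bij V. linear_endo V T}" "T \<in> {T \<in> Bij V. linear_endo V T}" for S T
    using that by (simp add: BijGroup_def compose_Bij linear_endo_compose)
  show "inv\<^bsub>BijGroup V\<^esub> T \<in> {T \<in> Bij V. linear_endo V T}" if "T \<in> {T \<in> Bij V. linear_endo V T}" for T
    using that linear_endo_inv[of T] by (simp add: inv_BijGroup restrict_inv_into_Bij)
qed

lemma Aut_iff:
  "T \<in> Aut V \<longleftrightarrow> T \<in> Bij V \<and> linear_endo V T \<and>
    (\<forall>X\<in>V. \<forall>Y\<in>V. T (bracket_on V X Y) = bracket_on V (T X) (T Y))"
  by (auto simp: Aut_def GL_def)

lemma subgroup_Aut_Bij: "subgroup (Aut V) (BijGroup V)"
proof (rule subgroup.intro)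
  show "Aut V \<subseteq> carrier (BijGroup V)"
    by (auto simp: Aut_iff BijGroup_def)
  show "\<one>\<^bsub>BijGroup V\<^esub> \<in> Aut V"
    by (simp add: Aut_iff BijGroup_def id_Bij linear_endo_def V_add V_smult V_bracket)
  show "S \<otimes>\<^bsub>BijGroup V\<^esub> T \<in> Aut V" if "S \<in> Aut V" "T \<in> Aut V" for S T
    using that Bij_imp_funcset[of T V]
    by (auto simp: Aut_iff BijGroup_def compose_Bij linear_endo_compose) (auto simp: compose_def V_bracket Pi_iff)
  show "inv\<^bsub>BijGroup V\<^esub> T \<in> Aut V" if "T \<in> Aut V" for T
  proof -
    have T: "T \<in> Bij V" "linear_endo V T" and
      b: "\<And>X Y. X \<in> V \<Longrightarrow> Y \<in> V \<Longrightarrow> T (bracket_on V X Y) = bracket_on V (T X) (T Y)"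
      using that by (auto simp: Aut_iff)
    note i = Bij_inv[OF T(1)]
    have "inv_into V T (bracket_on V X Y) = bracket_on V (inv_into V T X) (inv_into V T Y)"
      if "X \<in> V" "Y \<in> V" for X Y
      using that by (intro Bij_inv_eq[OF T(1)]) (simp_all add: i b V_bracket)
    then show ?thesis
      using T linear_endo_inv[OF T] by (simp add: Aut_iff inv_BijGroup restrict_inv_into_Bij V_bracket)
  qed
qed

lemma subgroup_Aut_GL: "subgroup (Aut V) (GL V)"
  unfolding GL_def
  by (rule group.subgroup_incl[OF group_BijGroup subgroup_Aut_Bij subgroup_GL]) (auto simp: Aut_iff)

text \<open>The image of the block group turns out to be all of \<open>Aut V\<close>, so the index
  in question is that of the whole group in itself, with a single coset.\<close>

lemma finite_index_Aut: "finite_index_subgroup (Aut V) (Aut_group V)"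
proof -
  have "group (GL V)"
    unfolding GL_def by (rule subgroup.subgroup_is_group[OF subgroup_GL group_BijGroup])
  then interpret A: group "Aut_group V"
    unfolding Aut_group_def by (rule subgroup.subgroup_is_group[OF subgroup_Aut_GL])
  have c: "carrier (Aut_group V) = Aut V"
    by (simp add: Aut_group_def)
  have "subgroup (Aut V) (Aut_group V)"
    using A.subgroup_self by (simp add: c)
  moreover have "rcosets\<^bsub>Aut_group V\<^esub> (Aut V) \<subseteq> {Aut V}"
    using A.coset_join2[OF _ calculation] by (auto simp: RCOSETS_def c)
  ultimately show ?thesis
    unfolding finite_index_subgroup_def using finite_subset by blast
qed

end

section \<open>The complement of the Lie algebra of Sp(1)\<close>

text \<open>\<open>r\<close> is the coordinate of \<open>K\<close>: the first one in one embedding,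
  the last one in the other. The bound on \<open>p + q\<close> leaves at least one further
  coordinate.\<close>

locale Sp_complement =
  fixes p q r :: nat
  assumes r: "r < p + q" and two: "2 \<le> p + q"
begin

abbreviation "n \<equiv> p + q"
abbreviation "\<epsilon> \<equiv> sgnat p"

definition \<mm> :: "quat mat set" where
  "\<mm> = {X \<in> skew_Sp p q. X $$ (r, r) = 0}"

text \<open>The projection to \<open>\<mm>\<close> along the Lie algebra of \<open>K\<close>;
  \<open>borth_proj_\<mm>\<close> shows that it is the orthogonal one.\<close>

definition cut :: "quat mat \<Rightarrow> quat mat" where
  "cut Z = mat n n (\<lambda>x. if x = (r, r) then 0 else Z $$ x)"

text \<open>The adjoint with respect to the form reverses products and negates skew matrices, so it
  exchanges \<open>X Y\<close> and \<open>Y X\<close>.\<close>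

lemma skew_commutator:
  assumes X: "X \<in> skew_Sp p q" and Y: "Y \<in> skew_Sp p q"
  shows "X * Y - Y * X \<in> skew_Sp p q"
proof (rule skew_SpI)
  note c = skew_Sp_carrier[OF X] skew_Sp_carrier[OF Y]
  show "X * Y - Y * X \<in> carrier_mat n n" using c by auto
  fix i j assume ij: "i < n" "j < n"
  have e: "(X * Y - Y * X) $$ (k, l) = (\<Sum>m<n. X $$ (k, m) * Y $$ (m, l)) - (\<Sum>m<n. Y $$ (k, m) * X $$ (m, l))"
    if "k < n" "l < n" for k l
    using that c by (simp add: mult_mat_index del: index_mult_mat(1))
  have sw: "(\<Sum>m<n. A $$ (j, m) * B $$ (m, i)) =
      of_real (\<epsilon> i * \<epsilon> j) * qcnj (\<Sum>m<n. B $$ (i, m) * A $$ (m, j))"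
    if A: "A \<in> skew_Sp p q" and B: "B \<in> skew_Sp p q" for A B
    unfolding qcnj_sum sum_distrib_left
  proof (intro sum.cong refl)
    fix m assume "m \<in> {..<n}"
    then have m: "m < n" by simp
    have "A $$ (j, m) * B $$ (m, i) = (of_real (\<epsilon> m * \<epsilon> j) * qcnj (A $$ (m, j))) * (of_real (\<epsilon> i * \<epsilon> m) * qcnj (B $$ (i, m)))"
      unfolding skew_SpD(1)[OF A m ij(2)] skew_SpD(1)[OF B ij(1) m] by simp
    also have "\<dots> = ((\<epsilon> m * \<epsilon> m) * (\<epsilon> i * \<epsilon> j)) *\<^sub>R (qcnj (A $$ (m, j)) * qcnj (B $$ (i, m)))"
      by (simp add: quat_scaleR_conv mult.assoc mult.left_commute del: of_real_mult sgnat_square)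
    also have "\<dots> = of_real (\<epsilon> i * \<epsilon> j) * qcnj (B $$ (i, m) * A $$ (m, j))"
      by (simp add: quat_scaleR_conv del: of_real_mult)
    finally show "A $$ (j, m) * B $$ (m, i) = of_real (\<epsilon> i * \<epsilon> j) * qcnj (B $$ (i, m) * A $$ (m, j))" .
  qed
  show "(X * Y - Y * X) $$ (j, i) = - (of_real (\<epsilon> i * \<epsilon> j) * qcnj ((X * Y - Y * X) $$ (i, j)))"
    unfolding e[OF ij] e[OF ij(2) ij(1)] sw[OF X Y] sw[OF Y X]
    by (simp add: right_diff_distrib del: of_real_mult)
qed

lemma \<mm>_carrier: "X \<in> \<mm> \<Longrightarrow> X \<in> carrier_mat n n"
  by (simp add: \<mm>_def skew_Sp_carrier)

lemma skew_Sp_linear: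
  "X \<in> skew_Sp p q \<Longrightarrow> Y \<in> skew_Sp p q \<Longrightarrow> X + Y \<in> skew_Sp p q"
  "X \<in> skew_Sp p q \<Longrightarrow> Y \<in> skew_Sp p q \<Longrightarrow> X - Y \<in> skew_Sp p q"
  "X \<in> skew_Sp p q \<Longrightarrow> of_real c \<cdot>\<^sub>m X \<in> skew_Sp p q"
  "0\<^sub>m n n \<in> skew_Sp p q"
proof -
  assume X: "X \<in> skew_Sp p q"
  note c = skew_Sp_carrier[OF X]
  show "of_real c \<cdot>\<^sub>m X \<in> skew_Sp p q"
  proof (rule skew_SpI)
    fix i j assume ij: "i < n" "j < n"
    have "(of_real c \<cdot>\<^sub>m X) $$ (j, i) = of_real c * X $$ (j, i)"
      using c ij by simp
    also have "\<dots> = - (of_real (\<epsilon> i * \<epsilon> j) * qcnj (of_real c * X $$ (i, j)))"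
      unfolding skew_SpD(1)[OF X ij] by (simp add: quat_scaleR_conv qcnj_scaleR mult.commute del: of_real_mult)
    finally show "(of_real c \<cdot>\<^sub>m X) $$ (j, i) = - (of_real (\<epsilon> i * \<epsilon> j) * qcnj ((of_real c \<cdot>\<^sub>m X) $$ (i, j)))"
      using c ij by simp
  qed (use c in simp)
next
  assume X: "X \<in> skew_Sp p q" and Y: "Y \<in> skew_Sp p q"
  note c = skew_Sp_carrier[OF X] skew_Sp_carrier[OF Y]
  show "X + Y \<in> skew_Sp p q"
  proof (rule skew_SpI)
    fix i j assume ij: "i < n" "j < n"
    have "(X + Y) $$ (j, i) = X $$ (j, i) + Y $$ (j, i)" "(X + Y) $$ (i, j) = X $$ (i, j) + Y $$ (i, j)"
      using c ij by auto
    note e = this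
    show "(X + Y) $$ (j, i) = - (of_real (\<epsilon> i * \<epsilon> j) * qcnj ((X + Y) $$ (i, j)))"
      unfolding e skew_SpD(1)[OF X ij] skew_SpD(1)[OF Y ij] by (simp add: distrib_left del: of_real_mult)
  qed (use c in simp)
  show "X - Y \<in> skew_Sp p q"
  proof (rule skew_SpI)
    fix i j assume ij: "i < n" "j < n"
    have "(X - Y) $$ (j, i) = X $$ (j, i) - Y $$ (j, i)" "(X - Y) $$ (i, j) = X $$ (i, j) - Y $$ (i, j)"
      using c ij by auto
    note e = this
    show "(X - Y) $$ (j, i) = - (of_real (\<epsilon> i * \<epsilon> j) * qcnj ((X - Y) $$ (i, j)))"
      unfolding e skew_SpD(1)[OF X ij] skew_SpD(1)[OF Y ij] by (simp add: right_diff_distrib del: of_real_mult)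
  qed (rule minus_carrier_mat[OF c(2)])
qed (rule skew_SpI; simp)

lemma \<mm>_linear:
  "X \<in> \<mm> \<Longrightarrow> Y \<in> \<mm> \<Longrightarrow> X + Y \<in> \<mm>" "X \<in> \<mm> \<Longrightarrow> Y \<in> \<mm> \<Longrightarrow> X - Y \<in> \<mm>"
  "X \<in> \<mm> \<Longrightarrow> of_real c \<cdot>\<^sub>m X \<in> \<mm>" "0\<^sub>m n n \<in> \<mm>"
  using r by (auto simp: \<mm>_def skew_Sp_linear dest!: skew_Sp_carrier)

lemma cut_\<mm>: "Z \<in> skew_Sp p q \<Longrightarrow> cut Z \<in> \<mm>"
proof -
  assume Z: "Z \<in> skew_Sp p q"
  have "cut Z \<in> skew_Sp p q"
  proof (rule skew_SpI)
    fix i j assume ij: "i < n" "j < n"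
    show "cut Z $$ (j, i) = - (of_real (\<epsilon> i * \<epsilon> j) * qcnj (cut Z $$ (i, j)))"
    proof (cases "i = r \<and> j = r")
      case False
      then have e: "cut Z $$ (j, i) = Z $$ (j, i)" "cut Z $$ (i, j) = Z $$ (i, j)"
        using ij by (auto simp: cut_def)
      show ?thesis unfolding e by (rule skew_SpD(1)[OF Z ij])
    qed (use r in \<open>simp add: cut_def\<close>)
  qed (simp add: cut_def)
  then show ?thesis
    using r by (simp add: \<mm>_def cut_def)
qed

lemma bform_sum:
  assumes "X \<in> carrier_mat n n" "Y \<in> carrier_mat n n"
  shows "bform X Y = (\<Sum>i<n. \<Sum>k<n. qre (X $$ (i, k) * Y $$ (k, i)))"
proof -
  have qre_sum: "qre (sum f A) = (\<Sum>x\<in>A. qre (f x))" for f :: "nat \<Rightarrow> quat" and A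
    by (induction A rule: infinite_finite_induct) (simp_all add: zero_quat_def plus_quat_def)
  show ?thesis
    using assms by (simp add: bform_def mult_mat_index[OF assms] qre_sum del: index_mult_mat(1))
qed

text \<open>Against the matrix with \<open>a\<close> at \<open>(r, r)\<close> the form reads off the
  real part of \<open>X $$ (r, r) * a\<close>. The entry is imaginary by skew symmetry, so it may
  itself be taken for \<open>a\<close>, which gives minus its squared norm.\<close>

lemma borth_compl_eq: "borth_compl (skew_Sp p q) {mat n n (\<lambda>x. if x = (r, r) then a else 0) | a. qre a = 0} = \<mm>"
proof -
  have b: "bform X (mat n n (\<lambda>x. if x = (r, r) then a else 0)) = qre (X $$ (r, r) * a)" if "X \<in> skew_Sp p q" for X a
  proof -
    have "bform X (mat n n (\<lambda>x. if x = (r, r) then a else 0)) =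
        (\<Sum>i<n. \<Sum>k<n. qre (X $$ (i, k) * mat n n (\<lambda>x. if x = (r, r) then a else 0) $$ (k, i)))"
      using skew_Sp_carrier[OF that] by (intro bform_sum) auto
    also have "\<dots> = (\<Sum>i<n. \<Sum>k<n. if k = r then if i = r then qre (X $$ (r, r) * a) else 0 else 0)"
      by (intro sum.cong refl) auto
    also have "\<dots> = qre (X $$ (r, r) * a)"
      using r by simp
    finally show ?thesis .
  qed
  have im: "qre (X $$ (r, r)) = 0" if "X \<in> skew_Sp p q" for X
  proof -
    have "X $$ (r, r) = - qcnj (X $$ (r, r))"
      using skew_SpD(1)[OF that r r] by simp
    then have "qre (X $$ (r, r)) = qre (- qcnj (X $$ (r, r)))"
      by (rule arg_cong)
    then show ?thesis
      by (simp add: quat_simps)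
  qed
  show ?thesis
  proof (intro antisym subsetI)
    fix X assume X: "X \<in> borth_compl (skew_Sp p q) {mat n n (\<lambda>x. if x = (r, r) then a else 0) | a. qre a = 0}"
    then have s: "X \<in> skew_Sp p q" by (simp add: borth_compl_def)
    let ?x = "X $$ (r, r)"
    have "qre (?x * ?x) = 0"
      using X b[OF s, of ?x] im[OF s] by (auto simp: borth_compl_def)
    then have "qi ?x * qi ?x + qj ?x * qj ?x + qk ?x * qk ?x = 0"
      using im[OF s] by (simp add: times_quat_def)
    then have "qi ?x = 0" "qj ?x = 0" "qk ?x = 0"
      by (smt (verit) zero_le_square mult_eq_0_iff)+
    then have "?x = 0"
      using im[OF s] by (simp add: quat_simps)
    with s show "X \<in> \<mm>" by (simp add: \<mm>_def)
  next
    fix X assume "X \<in> \<mm>"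
    then show "X \<in> borth_compl (skew_Sp p q) {mat n n (\<lambda>x. if x = (r, r) then a else 0) | a. qre a = 0}"
      by (auto simp: borth_compl_def \<mm>_def b)
  qed
qed

text \<open>The form is non-degenerate on \<open>\<mm>\<close> because \<open>\<mm>\<close> is closed under conjugate transposition.\<close>

lemma borth_proj_\<mm>:
  assumes Z: "Z \<in> skew_Sp p q"
  shows "borth_proj \<mm> Z = cut Z"
  unfolding borth_proj_def
proof (rule the_equality)
  have Zc: "Z \<in> carrier_mat n n" and cc: "cut Z \<in> carrier_mat n n"
    using skew_Sp_carrier[OF Z] by (auto simp: cut_def)
  have orth: "bform (Z - cut Z) Y = 0" if "Y \<in> \<mm>" for Y
  proof -
    have "bform (Z - cut Z) Y = (\<Sum>i<n. \<Sum>k<n. qre ((Z - cut Z) $$ (i, k) * Y $$ (k, i)))"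
      using Zc cc \<mm>_carrier[OF that] by (intro bform_sum) auto
    also have "\<dots> = 0"
    proof (intro sum.neutral ballI)
      fix i k assume "i \<in> {..<n}" "k \<in> {..<n}"
      then have ik: "i < n" "k < n" by auto
      have "(Z - cut Z) $$ (i, k) = Z $$ (i, k) - cut Z $$ (i, k)"
        using Zc cc ik by auto
      then show "qre ((Z - cut Z) $$ (i, k) * Y $$ (k, i)) = 0"
        using ik that by (cases "i = r \<and> k = r") (auto simp: cut_def \<mm>_def)
    qed
    finally show ?thesis .
  qed
  with cut_\<mm>[OF Z] show "cut Z \<in> \<mm> \<and> (\<forall>Y\<in>\<mm>. bform (Z - cut Z) Y = 0)" by blast
  fix W assume W: "W \<in> \<mm> \<and> (\<forall>Y\<in>\<mm>. bform (Z - W) Y = 0)"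
  define D where "D = W - cut Z"
  have D: "D \<in> skew_Sp p q" "D \<in> \<mm>"
    using W cut_\<mm>[OF Z] \<mm>_linear(2) by (auto simp: D_def \<mm>_def)
  note Dc = skew_Sp_carrier[OF D(1)]
  have Wc: "W \<in> carrier_mat n n" using W \<mm>_carrier by blast
  \<comment> \<open>Pairing \<open>D\<close> with its conjugate transpose gives the sum of the
    squared norms of the entries of \<open>D\<close>.\<close>
  define Y where "Y = qadjoint D"
  have Yc: "Y \<in> carrier_mat n n" using Dc by (simp add: Y_def qadjoint_def)
  have Yij: "Y $$ (i, j) = qcnj (D $$ (j, i))" if "i < n" "j < n" for i j
    using that Dc by (simp add: Y_def qadjoint_def)
  have "Y \<in> skew_Sp p q"
  proof (rule skew_SpI[OF Yc])
    fix i j assume ij: "i < n" "j < n"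
    show "Y $$ (j, i) = - (of_real (\<epsilon> i * \<epsilon> j) * qcnj (Y $$ (i, j)))"
      unfolding Yij[OF ij] Yij[OF ij(2,1)] qcnj_qcnj
      unfolding skew_SpD(1)[OF D(1) ij(2,1)]
      by (simp add: quat_scaleR_conv qcnj_scaleR mult.commute del: of_real_mult)
  qed
  then have Ym: "Y \<in> \<mm>"
    using D(2) r by (simp add: \<mm>_def Yij)
  have s: "(\<Sum>i<n. \<Sum>k<n. qre (D $$ (i, k) * Y $$ (k, i))) = 0"
  proof -
    have "qre (D $$ (i, k) * Y $$ (k, i)) = qre ((Z - cut Z) $$ (i, k) * Y $$ (k, i)) - qre ((Z - W) $$ (i, k) * Y $$ (k, i))"
      if "i < n" "k < n" for i k
    proof -
      have "D $$ (i, k) = (Z - cut Z) $$ (i, k) - (Z - W) $$ (i, k)"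
        using that Zc cc Wc by (simp add: D_def)
      then show ?thesis by (simp add: left_diff_distrib) (simp add: minus_quat_def)
    qed
    then have "(\<Sum>i<n. \<Sum>k<n. qre (D $$ (i, k) * Y $$ (k, i))) = bform (Z - cut Z) Y - bform (Z - W) Y"
      unfolding bform_sum[OF minus_carrier_mat[OF cc] Yc] bform_sum[OF minus_carrier_mat[OF Wc] Yc]
        sum_subtractf[symmetric] by (intro sum.cong refl) simp
    then show ?thesis using orth[OF Ym] W Ym by simp
  qed
  have "D $$ (i, k) = 0" if "i < n" "k < n" for i k
  proof -
    have t: "qre (D $$ (i, k) * Y $$ (k, i)) = inner (D $$ (i, k)) (D $$ (i, k))" if "i < n" "k < n" for i k
      using that by (simp add: Yij mult_qcnj_self) (simp add: quat_of_real)
    have "(\<Sum>i<n. \<Sum>k<n. inner (D $$ (i, k)) (D $$ (i, k))) = 0"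
      using s by (simp add: t)
    then have "\<forall>i\<in>{..<n}. (\<Sum>k<n. inner (D $$ (i, k)) (D $$ (i, k))) = 0"
      by (subst (asm) sum_nonneg_eq_0_iff) (auto intro: sum_nonneg)
    with that(1) have "(\<Sum>k<n. inner (D $$ (i, k)) (D $$ (i, k))) = 0" by blast
    then have "\<forall>k\<in>{..<n}. inner (D $$ (i, k)) (D $$ (i, k)) = 0"
      by (subst (asm) sum_nonneg_eq_0_iff) auto
    with that(2) show ?thesis by auto
  qed
  then show "W = cut Z"
    using Wc cc by (intro eq_matI) (auto simp: D_def)
qed

text \<open>A closed formula for the product on \<open>\<mm>\<close>, so that the definite
  description behind \<open>borth_proj\<close> is dealt with once.\<close>

definition br :: "quat mat \<Rightarrow> quat mat \<Rightarrow> quat mat" where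
  "br X Y = mat n n (\<lambda>(i, j). if i = r \<and> j = r then 0
    else (\<Sum>k<n. X $$ (i, k) * Y $$ (k, j)) - (\<Sum>k<n. Y $$ (i, k) * X $$ (k, j)))"

lemma bracket_on_\<mm>:
  assumes X: "X \<in> \<mm>" and Y: "Y \<in> \<mm>"
  shows "bracket_on \<mm> X Y = br X Y" and "br X Y \<in> \<mm>"
proof -
  have s: "X * Y - Y * X \<in> skew_Sp p q"
    using X Y by (intro skew_commutator) (auto simp: \<mm>_def)
  have "cut (X * Y - Y * X) = br X Y"
    unfolding cut_def br_def using \<mm>_carrier[OF X] \<mm>_carrier[OF Y]
    by (intro cong_mat refl) (auto simp: mult_mat_index simp del: index_mult_mat(1))
  then show "bracket_on \<mm> X Y = br X Y" "br X Y \<in> \<mm>"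
    using borth_proj_\<mm>[OF s] cut_\<mm>[OF s] by (simp_all add: bracket_on_def)
qed

sublocale bracket_space \<mm>
  by unfold_locales (auto simp: \<mm>_linear bracket_on_\<mm>)

section \<open>The automorphism condition as real polynomial equations\<close>

definition "quat_comps = {qre, qi, qj, qk}"

lemma quat_eq_comps: "x = y \<longleftrightarrow> (\<forall>f\<in>quat_comps. f x = f y)"
  by (simp add: quat_comps_def quat_eq_iff)

lemma poly_fun_sum:
  "finite A \<Longrightarrow> (\<And>x. x \<in> A \<Longrightarrow> poly_fun W (f x)) \<Longrightarrow> poly_fun W (\<lambda>T. \<Sum>x\<in>A. f x T)"
  by (induction A rule: finite_induct) (auto intro: poly_fun.intros)

lemma poly_fun_diff: "poly_fun W a \<Longrightarrow> poly_fun W b \<Longrightarrow> poly_fun W (\<lambda>T. a T - b T)"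
  using poly_fun.add[OF _ poly_fun.mult[OF poly_fun.const[of W "-1"]], of a b] by simp

lemma poly_fun_entry:
  assumes "X \<in> \<mm>" "i < n" "j < n" "f \<in> quat_comps"
  shows "poly_fun \<mm> (\<lambda>T. f (T X $$ (i, j)))"
proof -
  have "linear_functional \<mm> (\<lambda>X. f (X $$ (i, j)))"
    unfolding linear_functional_def
  proof (intro conjI ballI allI)
    fix X Y assume "X \<in> \<mm>" "Y \<in> \<mm>"
    then have "(X + Y) $$ (i, j) = X $$ (i, j) + Y $$ (i, j)"
      using \<mm>_carrier assms(2,3) by (metis carrier_matD index_add_mat(1))
    then show "f ((X + Y) $$ (i, j)) = f (X $$ (i, j)) + f (Y $$ (i, j))"
      using assms(4) by (auto simp: quat_comps_def plus_quat_def)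
  next
    fix c X assume "X \<in> \<mm>"
    then have "(of_real c \<cdot>\<^sub>m X) $$ (i, j) = c *\<^sub>R X $$ (i, j)"
      using \<mm>_carrier assms(2,3) by (metis carrier_matD index_smult_mat(1) quat_scaleR_conv(1))
    then show "f ((of_real c \<cdot>\<^sub>m X) $$ (i, j)) = c * f (X $$ (i, j))"
      using assms(4) by (auto simp: quat_comps_def scaleR_quat_def)
  qed
  from poly_fun.coeff[OF this assms(1)] show ?thesis .
qed

text \<open>Each real coordinate of a quaternion product is bilinear in the coordinates of the
  factors.\<close>

lemma poly_fun_entry_mult:
  assumes "X \<in> \<mm>" "i < n" "j < n" "Y \<in> \<mm>" "k < n" "l < n" "f \<in> quat_comps"
  shows "poly_fun \<mm> (\<lambda>T. f (T X $$ (i, j) * T Y $$ (k, l)))"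
proof -
  note e = poly_fun_entry[OF assms(1-3)] poly_fun_entry[OF assms(4-6)]
  show ?thesis
    using assms(7) by (auto simp: quat_comps_def times_quat_def intro!: poly_fun.add poly_fun_diff poly_fun.mult e)
qed

text \<open>The condition compares \<open>T (br X Y)\<close>, linear in \<open>T\<close>, with
  \<open>br (T X) (T Y)\<close>, quadratic in \<open>T\<close>. One equation is taken for every pair
  \<open>X\<close>, \<open>Y\<close>, every position and every real coordinate; a defining family
  may be infinite.\<close>

theorem algebraic_Aut: "algebraic_group \<mm> (Aut \<mm>)"
proof -
  define F where "F X Y i j f T = (f (T (br X Y) $$ (i, j)) :: real) -
    (if i = r \<and> j = r then 0 else (\<Sum>k<n. f (T X $$ (i, k) * T Y $$ (k, j))) - (\<Sum>k<n. f (T Y $$ (i, k) * T X $$ (k, j))))"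
    for X Y i j and f :: "quat \<Rightarrow> real" and T :: "quat mat \<Rightarrow> quat mat"
  define P where "P = {F X Y i j f | X Y i j f. X \<in> \<mm> \<and> Y \<in> \<mm> \<and> i < n \<and> j < n \<and> f \<in> quat_comps}"
  have "poly_fun \<mm> g" if g: "g \<in> P" for g
  proof -
    obtain X Y i j f where g: "g = F X Y i j f" and a: "X \<in> \<mm>" "Y \<in> \<mm>" "i < n" "j < n" "f \<in> quat_comps"
      using g unfolding P_def by blast
    show ?thesis
    proof (cases "i = r \<and> j = r")
      case True
      then have "g = (\<lambda>T. f (T (br X Y) $$ (i, j)))"
        unfolding g F_def by simp
      then show ?thesis
        using a by (simp add: poly_fun_entry bracket_on_\<mm>)
    next
      case False
      then have "g = (\<lambda>T. f (T (br X Y) $$ (i, j)) -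
          ((\<Sum>k<n. f (T X $$ (i, k) * T Y $$ (k, j))) - (\<Sum>k<n. f (T Y $$ (i, k) * T X $$ (k, j)))))"
        unfolding g F_def by auto
      then show ?thesis
        using a by (auto intro!: poly_fun_diff poly_fun_sum poly_fun_entry poly_fun_entry_mult simp: bracket_on_\<mm>)
    qed
  qed
  moreover have "Aut \<mm> = {T \<in> carrier (GL \<mm>). \<forall>f\<in>P. f T = 0}"
  proof -
    have "(\<forall>X\<in>\<mm>. \<forall>Y\<in>\<mm>. T (bracket_on \<mm> X Y) = bracket_on \<mm> (T X) (T Y)) \<longleftrightarrow> (\<forall>f\<in>P. f T = 0)"
      if T: "T \<in> carrier (GL \<mm>)" for T
    proof -
      have Tm: "T X \<in> \<mm>" if "X \<in> \<mm>" for X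
        using T that by (auto simp: GL_def linear_endo_def)
      have comp: "f (sum h A) = (\<Sum>x\<in>A. f (h x))" "f (a - b) = f a - f b" "f 0 = 0"
        if "f \<in> quat_comps" for f and h :: "nat \<Rightarrow> quat" and A a b
      proof -
        show s: "f (a - b) = f a - f b" "f 0 = 0" for a b
          using that by (auto simp: quat_comps_def minus_quat_def zero_quat_def)
        have "f (a + b) = f a + f b" for a b
          using that by (auto simp: quat_comps_def plus_quat_def)
        with s show "f (sum h A) = (\<Sum>x\<in>A. f (h x))"
          by (induction A rule: infinite_finite_induct) auto
      qed
      have "T (br X Y) = br (T X) (T Y) \<longleftrightarrow> (\<forall>i<n. \<forall>j<n. \<forall>f\<in>quat_comps. F X Y i j f T = 0)"
        if XY: "X \<in> \<mm>" "Y \<in> \<mm>" for X Y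
      proof -
        have c: "T (br X Y) \<in> carrier_mat n n" "br (T X) (T Y) \<in> carrier_mat n n"
          using XY Tm \<mm>_carrier bracket_on_\<mm>(2) by blast+
        have F: "F X Y i j f T = f (T (br X Y) $$ (i, j)) - f (br (T X) (T Y) $$ (i, j))"
          if "i < n" "j < n" "f \<in> quat_comps" for i j f
          using that by (simp add: F_def br_def comp)
        have "T (br X Y) = br (T X) (T Y) \<longleftrightarrow> (\<forall>i<n. \<forall>j<n. T (br X Y) $$ (i, j) = br (T X) (T Y) $$ (i, j))"
        proof
          assume "\<forall>i<n. \<forall>j<n. T (br X Y) $$ (i, j) = br (T X) (T Y) $$ (i, j)"
          with c show "T (br X Y) = br (T X) (T Y)" by (intro eq_matI) auto
        qed simp
        also have "\<dots> \<longleftrightarrow> (\<forall>i<n. \<forall>j<n. \<forall>f\<in>quat_comps. f (T (br X Y) $$ (i, j)) = f (br (T X) (T Y) $$ (i, j)))"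
          by (simp only: quat_eq_comps)
        also have "\<dots> \<longleftrightarrow> (\<forall>i<n. \<forall>j<n. \<forall>f\<in>quat_comps. F X Y i j f T = 0)"
          using F by auto
        finally show ?thesis .
      qed
      moreover have "(\<forall>f\<in>P. f T = 0) \<longleftrightarrow>
          (\<forall>X\<in>\<mm>. \<forall>Y\<in>\<mm>. \<forall>i<n. \<forall>j<n. \<forall>f\<in>quat_comps. F X Y i j f T = 0)"
        unfolding P_def by blast
      ultimately show ?thesis
        by (simp add: bracket_on_\<mm> Tm)
    qed
    then show ?thesis
      unfolding Aut_def by blast
  qed
  ultimately show ?thesis
    unfolding algebraic_group_def using subgroup_Aut_GL by blast
qed

end

section \<open>Inverses of quaternionic matrices and the adjoint action\<close>

text \<open>One-sided inverses are two-sided: pass to complex \<open>2n \<times> 2n\<close> matrices by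
  \<open>z + w j \<mapsto> [[z, w], [- cnj w, cnj z]]\<close>.\<close>

definition qblock :: "quat \<Rightarrow> nat \<Rightarrow> nat \<Rightarrow> complex" where
  "qblock x a b = (if a = 0 then if b = 0 then Complex (qre x) (qi x) else Complex (qj x) (qk x)
    else if b = 0 then Complex (- qj x) (qk x) else Complex (qre x) (- qi x))"

definition qcomplexify :: "nat \<Rightarrow> quat mat \<Rightarrow> complex mat" where
  "qcomplexify n A = mat (n * 2) (n * 2) (\<lambda>(a, b). qblock (A $$ (a div 2, b div 2)) (a mod 2) (b mod 2))"

lemma qblock_sum: "qblock (sum f A) a b = (\<Sum>x\<in>A. qblock (f x) a b)"
proof -
  have "qblock 0 a b = 0" "qblock (x + y) a b = qblock x a b + qblock y a b" for x y
    by (simp_all add: qblock_def zero_quat_def plus_quat_def complex_eq_iff)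
  then show ?thesis
    by (induction A rule: infinite_finite_induct) simp_all
qed

lemma qblock_mult:
  "qblock (x * y) a b = qblock x a 0 * qblock y 0 b + qblock x a (Suc 0) * qblock y (Suc 0) b"
  by (simp add: qblock_def times_quat_def complex_eq_iff algebra_simps)

lemma qcomplexify_mult:
  assumes "A \<in> carrier_mat n n" "B \<in> carrier_mat n n"
  shows "qcomplexify n (A * B) = qcomplexify n A * qcomplexify n B"
proof (rule eq_matI)
  fix a b assume "a < dim_row (qcomplexify n A * qcomplexify n B)" "b < dim_col (qcomplexify n A * qcomplexify n B)"
  then have ab: "a < n * 2" "b < n * 2" by (simp_all add: qcomplexify_def)
  define i j where "i = a div 2" and "j = b div 2"
  have ij: "i < n" "j < n" using ab by (auto simp: i_def j_def)
  have c: "qcomplexify n A \<in> carrier_mat (n * 2) (n * 2)" "qcomplexify n B \<in> carrier_mat (n * 2) (n * 2)"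
    by (simp_all add: qcomplexify_def)
  have "(qcomplexify n A * qcomplexify n B) $$ (a, b) = (\<Sum>m<n * 2. qcomplexify n A $$ (a, m) * qcomplexify n B $$ (m, b))"
    using c ab by (auto simp: scalar_prod_def atLeast0LessThan intro!: sum.cong)
  \<comment> \<open>The summation index is grouped into the pairs \<open>2 k\<close>,
    \<open>2 k + 1\<close>, which turns the sum into one of products of two-by-two blocks.\<close>
  also have "\<dots> = (\<Sum>k<n. \<Sum>m\<in>{k * 2..<k * 2 + 2}. qcomplexify n A $$ (a, m) * qcomplexify n B $$ (m, b))"
    by (rule sum.nat_group[symmetric])
  also have "\<dots> = (\<Sum>k<n. qblock (A $$ (i, k) * B $$ (k, j)) (a mod 2) (b mod 2))"
  proof (intro sum.cong refl)
    fix k assume "k \<in> {..<n}"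
    then have k: "k < n" by simp
    have "{k * 2..<k * 2 + 2} = {k * 2, Suc (k * 2)}" by auto
    moreover have "Suc (k * 2) < n * 2" "Suc (k * 2) div 2 = k" "Suc (k * 2) mod 2 = Suc 0"
      using k by (auto, presburger)
    ultimately show "(\<Sum>m\<in>{k * 2..<k * 2 + 2}. qcomplexify n A $$ (a, m) * qcomplexify n B $$ (m, b)) =
        qblock (A $$ (i, k) * B $$ (k, j)) (a mod 2) (b mod 2)"
      using ab k by (simp add: qcomplexify_def qblock_mult i_def j_def)
  qed
  also have "\<dots> = qblock ((A * B) $$ (i, j)) (a mod 2) (b mod 2)"
    by (simp only: mult_mat_index[OF assms ij] qblock_sum)
  finally show "qcomplexify n (A * B) $$ (a, b) = (qcomplexify n A * qcomplexify n B) $$ (a, b)"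
    using ab by (simp add: qcomplexify_def i_def j_def)
qed (simp_all add: qcomplexify_def)

lemma qcomplexify_one: "qcomplexify n (1\<^sub>m n) = 1\<^sub>m (n * 2)"
proof (rule eq_matI)
  fix a b assume "a < dim_row (1\<^sub>m (n * 2) :: complex mat)" "b < dim_col (1\<^sub>m (n * 2) :: complex mat)"
  then have ab: "a < n * 2" "b < n * 2" by simp_all
  have "a div 2 = b div 2 \<and> a mod 2 = b mod 2 \<longleftrightarrow> a = b"
    by (metis div_mult_mod_eq)
  moreover have "a mod 2 = 0 \<or> a mod 2 = Suc 0" "b mod 2 = 0 \<or> b mod 2 = Suc 0"
    by auto
  ultimately show "qcomplexify n (1\<^sub>m n) $$ (a, b) = 1\<^sub>m (n * 2) $$ (a, b)"
    using ab by (auto simp: qcomplexify_def qblock_def one_quat_def zero_quat_def complex_eq_iff less_mult_imp_div_less)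
qed (simp_all add: qcomplexify_def)

lemma qcomplexify_inj:
  assumes A: "A \<in> carrier_mat n n" and B: "B \<in> carrier_mat n n" and eq: "qcomplexify n A = qcomplexify n B"
  shows "A = B"
proof (rule eq_matI)
  fix i j assume "i < dim_row B" "j < dim_col B"
  then have ij: "i < n" "j < n" using B by auto
  \<comment> \<open>The first row of a block already contains all four real coordinates.\<close>
  have "qblock (A $$ (i, j)) 0 b = qblock (B $$ (i, j)) 0 b" if "b < 2" for b
  proof -
    have "qcomplexify n A $$ (i * 2, j * 2 + b) = qcomplexify n B $$ (i * 2, j * 2 + b)"
      using eq by simp
    then show ?thesis
      using ij that by (simp add: qcomplexify_def)
  qed
  from this[of 0] this[of 1] show "A $$ (i, j) = B $$ (i, j)"
    by (simp add: qblock_def quat_eq_iff)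
qed (use A B in auto)

lemma quat_mat_left_right_inverse:
  assumes A: "(A :: quat mat) \<in> carrier_mat n n" and B: "B \<in> carrier_mat n n" and AB: "A * B = 1\<^sub>m n"
  shows "B * A = 1\<^sub>m n"
proof -
  have c: "qcomplexify n A \<in> carrier_mat (n * 2) (n * 2)" "qcomplexify n B \<in> carrier_mat (n * 2) (n * 2)"
    by (simp_all add: qcomplexify_def)
  have "qcomplexify n A * qcomplexify n B = 1\<^sub>m (n * 2)"
    using qcomplexify_mult[OF A B] by (simp add: AB qcomplexify_one)
  then have "qcomplexify n B * qcomplexify n A = 1\<^sub>m (n * 2)"
    by (rule mat_mult_left_right_inverse[OF c])
  then have "qcomplexify n (B * A) = qcomplexify n (1\<^sub>m n)"
    using qcomplexify_mult[OF B A] by (simp add: qcomplexify_one)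
  then show ?thesis
    by (rule qcomplexify_inj[rotated 2]) (use A B in auto)
qed

text \<open>This is \<open>I A* I\<close> with \<open>I = Ipq p q\<close>; the defining equation
  \<open>A* I A = I\<close> makes it a left inverse.\<close>

definition Sp_inv :: "nat \<Rightarrow> nat \<Rightarrow> quat mat \<Rightarrow> quat mat" where
  "Sp_inv p q A = mat (p + q) (p + q) (\<lambda>(i, j). of_real (sgnat p i) * qcnj (A $$ (j, i)) * of_real (sgnat p j))"

lemma Sp_inv_carrier [simp]: "Sp_inv p q A \<in> carrier_mat (p + q) (p + q)"
  by (simp add: Sp_inv_def)

lemma Sp_carrier: "A \<in> Sp p q \<Longrightarrow> A \<in> carrier_mat (p + q) (p + q)"
  by (simp add: Sp_def)

text \<open>The right inverse comes from the passage to complex matrices. It says that the rows are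
  orthonormal as well, which is what membership of the inverse in the group amounts to.\<close>

lemma Sp_inv:
  assumes A: "A \<in> Sp p q"
  shows "Sp_inv p q A * A = 1\<^sub>m (p + q)" "A * Sp_inv p q A = 1\<^sub>m (p + q)" "Sp_inv p q A \<in> Sp p q"
proof -
  let ?n = "p + q" and ?B = "Sp_inv p q A" and ?e = "\<lambda>i. of_real (sgnat p i) :: quat"
  note Ac = Sp_carrier[OF A]
  show l: "?B * A = 1\<^sub>m ?n"
  proof (rule eq_matI)
    fix i j assume "i < dim_row (1\<^sub>m ?n :: quat mat)" "j < dim_col (1\<^sub>m ?n :: quat mat)"
    then have ij: "i < ?n" "j < ?n" by simp_all
    have "(?B * A) $$ (i, j) = (\<Sum>k<?n. ?B $$ (i, k) * A $$ (k, j))"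
      by (rule mult_mat_index[OF Sp_inv_carrier Ac ij])
    also have "\<dots> = ?e i * (\<Sum>k<?n. qcnj (A $$ (k, i)) * ?e k * A $$ (k, j))"
      unfolding sum_distrib_left using ij by (intro sum.cong) (auto simp: Sp_inv_def mult.assoc)
    also have "\<dots> = 1\<^sub>m ?n $$ (i, j)"
      using A ij unfolding Sp_iff by (simp add: sgnat_def)
    finally show "(?B * A) $$ (i, j) = 1\<^sub>m ?n $$ (i, j)" .
  qed (use Ac in \<open>auto simp: Sp_inv_def\<close>)
  show r: "A * ?B = 1\<^sub>m ?n"
    by (rule quat_mat_left_right_inverse[OF Sp_inv_carrier Ac l])
  have "(\<Sum>k<?n. qcnj (?B $$ (k, i)) * ?e k * ?B $$ (k, j)) = (if i = j then ?e i else 0)"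
    if ij: "i < ?n" "j < ?n" for i j
  proof -
    have "(\<Sum>k<?n. qcnj (?B $$ (k, i)) * ?e k * ?B $$ (k, j)) = ?e i * (\<Sum>k<?n. A $$ (i, k) * ?B $$ (k, j))"
      unfolding sum_distrib_left using ij by (intro sum.cong) (auto simp: Sp_inv_def mult.assoc)
    also have "\<dots> = ?e i * (1\<^sub>m ?n $$ (i, j))"
      by (simp only: mult_mat_index[OF Ac Sp_inv_carrier ij, symmetric] r)
    finally show ?thesis using ij by simp
  qed
  then show "?B \<in> Sp p q"
    unfolding Sp_iff by simp
qed

lemma m_inv_Sp_group:
  assumes A: "A \<in> Sp p q"
  shows "inv\<^bsub>Sp_group p q\<^esub> A = Sp_inv p q A"
  unfolding m_inv_def
proof (rule the_equality)
  show "Sp_inv p q A \<in> carrier (Sp_group p q) \<and> A \<otimes>\<^bsub>Sp_group p q\<^esub> Sp_inv p q A = \<one>\<^bsub>Sp_group p q\<^esub> \<and>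
      Sp_inv p q A \<otimes>\<^bsub>Sp_group p q\<^esub> A = \<one>\<^bsub>Sp_group p q\<^esub>"
    using Sp_inv[OF A] by (simp add: Sp_group_def)
  fix B assume "B \<in> carrier (Sp_group p q) \<and> A \<otimes>\<^bsub>Sp_group p q\<^esub> B = \<one>\<^bsub>Sp_group p q\<^esub> \<and>
      B \<otimes>\<^bsub>Sp_group p q\<^esub> A = \<one>\<^bsub>Sp_group p q\<^esub>"
  then have B: "B \<in> carrier_mat (p + q) (p + q)" "A * B = 1\<^sub>m (p + q)"
    by (auto simp: Sp_group_def Sp_carrier)
  have "Sp_inv p q A * (A * B) = B"
    using assoc_mult_mat[OF Sp_inv_carrier[of p q A] Sp_carrier[OF A] B(1)] Sp_inv(1)[OF A] B(1) by simp
  then show "B = Sp_inv p q A"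
    using B(2) right_mult_one_mat[OF Sp_inv_carrier] by simp
qed

lemma Sp_inv_inv: "A \<in> Sp p q \<Longrightarrow> Sp_inv p q (Sp_inv p q A) = A"
  using Sp_carrier[of A p q] by (intro eq_matI) (auto simp: Sp_inv_def mult.assoc sgnat_def)

section \<open>The adjoint action of block-diagonal matrices\<close>

context Sp_complement
begin

text \<open>The image of \<open>G\<close> and \<open>K\<close> described without reference to the
  embedding; \<open>embed_in_block_Sp\<close> and \<open>block_Sp_embed\<close> provide the
  identification.\<close>

definition block_Sp :: "quat mat set" where
  "block_Sp = {h \<in> Sp p q. \<forall>i<n. i \<noteq> r \<longrightarrow> h $$ (i, r) = 0 \<and> h $$ (r, i) = 0}"

lemma block_Sp_inv: "h \<in> block_Sp \<Longrightarrow> Sp_inv p q h \<in> block_Sp"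
  using r Sp_inv(3)[of h p q] by (auto simp: block_Sp_def Sp_inv_def)

definition Ad :: "quat mat \<Rightarrow> quat mat \<Rightarrow> quat mat" where
  "Ad h X = h * X * Sp_inv p q h"

lemma Ad_carrier: "h \<in> Sp p q \<Longrightarrow> X \<in> carrier_mat n n \<Longrightarrow> Ad h X \<in> carrier_mat n n"
  using mult_carrier_mat[OF mult_carrier_mat[OF Sp_carrier] Sp_inv_carrier] by (simp add: Ad_def)

lemma Ad_index:
  assumes h: "h \<in> Sp p q" and X: "X \<in> carrier_mat n n" and ij: "i < n" "j < n"
  shows "Ad h X $$ (i, j) = (\<Sum>k<n. \<Sum>l<n. (\<epsilon> l * \<epsilon> j) *\<^sub>R (h $$ (i, k) * X $$ (k, l) * qcnj (h $$ (j, l))))"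
proof -
  note hc = Sp_carrier[OF h]
  have hX: "h * X \<in> carrier_mat n n" using hc X by simp
  have "Ad h X $$ (i, j) = (\<Sum>l<n. \<Sum>k<n. (\<epsilon> l * \<epsilon> j) *\<^sub>R (h $$ (i, k) * X $$ (k, l) * qcnj (h $$ (j, l))))"
    unfolding Ad_def mult_mat_index[OF hX Sp_inv_carrier ij]
  proof (intro sum.cong refl)
    fix l assume "l \<in> {..<n}"
    then have l: "l < n" by simp
    show "(h * X) $$ (i, l) * Sp_inv p q h $$ (l, j) =
        (\<Sum>k<n. (\<epsilon> l * \<epsilon> j) *\<^sub>R (h $$ (i, k) * X $$ (k, l) * qcnj (h $$ (j, l))))"
      unfolding mult_mat_index[OF hc X ij(1) l] sum_distrib_right
      using l ij by (intro sum.cong refl) (simp add: Sp_inv_def quat_scaleR_conv mult.assoc mult.commute del: of_real_mult)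
  qed
  then show ?thesis by (subst sum.swap)
qed

text \<open>Column \<open>r\<close> carries the off-diagonal part: there the block of
  \<open>G\<close> acts from the left and the entry of \<open>K\<close> from the right.\<close>

lemma Ad_block_index:
  assumes h: "h \<in> block_Sp" and X: "X \<in> carrier_mat n n" and ij: "i < n" "j < n"
  shows "Ad h X $$ (i, r) = (\<Sum>k<n. h $$ (i, k) * X $$ (k, r)) * qcnj (h $$ (r, r))"
proof -
  have hS: "h \<in> Sp p q" using h by (simp add: block_Sp_def)
  have "Ad h X $$ (i, r) = (\<Sum>k<n. \<Sum>l<n. if l = r then h $$ (i, k) * X $$ (k, r) * qcnj (h $$ (r, r)) else 0)"
    unfolding Ad_index[OF hS X ij(1) r] using h by (intro sum.cong refl) (auto simp: block_Sp_def)
  then show ?thesis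
    using r by (simp add: sum_distrib_right)
qed

lemma Ad_skew:
  assumes h: "h \<in> Sp p q" and X: "X \<in> skew_Sp p q"
  shows "Ad h X \<in> skew_Sp p q"
proof (rule skew_SpI)
  note Xc = skew_Sp_carrier[OF X]
  show "Ad h X \<in> carrier_mat n n" by (rule Ad_carrier[OF h Xc])
  fix i j assume ij: "i < n" "j < n"
  have "Ad h X $$ (j, i) = (\<Sum>l<n. \<Sum>k<n. (\<epsilon> l * \<epsilon> i) *\<^sub>R (h $$ (j, k) * X $$ (k, l) * qcnj (h $$ (i, l))))"
    unfolding Ad_index[OF h Xc ij(2,1)] by (rule sum.swap)
  also have "\<dots> = (\<Sum>l<n. \<Sum>k<n. - ((\<epsilon> i * \<epsilon> j) *\<^sub>R qcnj ((\<epsilon> k * \<epsilon> j) *\<^sub>R (h $$ (i, l) * X $$ (l, k) * qcnj (h $$ (j, k))))))"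
  proof (intro sum.cong refl)
    fix l k assume "l \<in> {..<n}" "k \<in> {..<n}"
    then have lk: "l < n" "k < n" by auto
    have "(\<epsilon> l * \<epsilon> i) *\<^sub>R (h $$ (j, k) * X $$ (k, l) * qcnj (h $$ (i, l))) =
        - ((\<epsilon> l * \<epsilon> i * (\<epsilon> l * \<epsilon> k)) *\<^sub>R (h $$ (j, k) * qcnj (X $$ (l, k)) * qcnj (h $$ (i, l))))"
      unfolding skew_SpD(1)[OF X lk] by (simp add: quat_scaleR_conv del: of_real_mult)
    also have "\<epsilon> l * \<epsilon> i * (\<epsilon> l * \<epsilon> k) = \<epsilon> i * \<epsilon> j * (\<epsilon> k * \<epsilon> j)"
      by (simp add: sgnat_def)
    finally show "(\<epsilon> l * \<epsilon> i) *\<^sub>R (h $$ (j, k) * X $$ (k, l) * qcnj (h $$ (i, l))) =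
        - ((\<epsilon> i * \<epsilon> j) *\<^sub>R qcnj ((\<epsilon> k * \<epsilon> j) *\<^sub>R (h $$ (i, l) * X $$ (l, k) * qcnj (h $$ (j, k)))))"
      by (simp add: qcnj_scaleR mult.assoc)
  qed
  also have "\<dots> = - ((\<epsilon> i * \<epsilon> j) *\<^sub>R qcnj (Ad h X $$ (i, j)))"
    unfolding Ad_index[OF h Xc ij] by (simp add: qcnj_sum scaleR_right.sum sum_negf)
  finally show "Ad h X $$ (j, i) = - (of_real (\<epsilon> i * \<epsilon> j) * qcnj (Ad h X $$ (i, j)))"
    by (simp add: quat_scaleR_conv del: of_real_mult)
qed

text \<open>Conjugation by a block matrix does not mix the \<open>(r, r)\<close> entry with the
  others, so it commutes with the projection. Invariance of \<open>\<mm>\<close> and compatibility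
  with the product both rest on this.\<close>

lemma cut_Ad:
  assumes h: "h \<in> block_Sp" and Z: "Z \<in> carrier_mat n n"
  shows "cut (Ad h Z) = Ad h (cut Z)"
proof (rule eq_matI)
  have hS: "h \<in> Sp p q" using h by (simp add: block_Sp_def)
  have cc: "cut Z \<in> carrier_mat n n" by (simp add: cut_def)
  note c = Ad_carrier[OF hS Z] Ad_carrier[OF hS cc]
  fix i j assume "i < dim_row (Ad h (cut Z))" "j < dim_col (Ad h (cut Z))"
  then have ij: "i < n" "j < n" using c by auto
  show "cut (Ad h Z) $$ (i, j) = Ad h (cut Z) $$ (i, j)"
  proof (cases "i = r \<and> j = r")
    case True
    have "Ad h (cut Z) $$ (r, r) = 0"
      unfolding Ad_index[OF hS cc r r] using h
      by (intro sum.neutral ballI) (auto simp: block_Sp_def cut_def)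
    with True r show ?thesis by (simp add: cut_def)
  next
    case False
    have "Ad h (cut Z) $$ (i, j) = Ad h Z $$ (i, j)"
      unfolding Ad_index[OF hS cc ij] Ad_index[OF hS Z ij]
    proof (intro sum.cong refl)
      fix k l assume "k \<in> {..<n}" "l \<in> {..<n}"
      with False ij h show "(\<epsilon> l * \<epsilon> j) *\<^sub>R (h $$ (i, k) * cut Z $$ (k, l) * qcnj (h $$ (j, l))) =
          (\<epsilon> l * \<epsilon> j) *\<^sub>R (h $$ (i, k) * Z $$ (k, l) * qcnj (h $$ (j, l)))"
        by (cases "k = r \<and> l = r") (auto simp: block_Sp_def cut_def)
    qed
    moreover have "cut (Ad h Z) $$ (i, j) = Ad h Z $$ (i, j)"
      using False ij by (auto simp: cut_def)
    ultimately show ?thesis by simp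
  qed
qed (use Z h Ad_carrier[of h "cut Z"] in \<open>auto simp: cut_def block_Sp_def\<close>)

lemma cut_id: "X \<in> \<mm> \<Longrightarrow> cut X = X"
  using \<mm>_carrier[of X] by (intro eq_matI) (auto simp: cut_def \<mm>_def)

lemma Ad_\<mm>:
  assumes h: "h \<in> block_Sp" and X: "X \<in> \<mm>"
  shows "Ad h X \<in> \<mm>"
proof -
  have "cut (Ad h X) = Ad h X"
    using cut_Ad[OF h \<mm>_carrier[OF X]] by (simp add: cut_id[OF X])
  moreover have "Ad h X \<in> skew_Sp p q"
    using h X by (intro Ad_skew) (auto simp: block_Sp_def \<mm>_def)
  ultimately show ?thesis
    using cut_\<mm> by metis
qed

lemma br_eq_cut: "X \<in> \<mm> \<Longrightarrow> Y \<in> \<mm> \<Longrightarrow> br X Y = cut (X * Y - Y * X)"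
  unfolding cut_def br_def using \<mm>_carrier[of X] \<mm>_carrier[of Y]
  by (intro cong_mat refl) (auto simp: mult_mat_index simp del: index_mult_mat(1))

lemma Ad_mult:
  assumes h: "h \<in> Sp p q" and X: "X \<in> carrier_mat n n" and Y: "Y \<in> carrier_mat n n"
  shows "Ad h X * Ad h Y = Ad h (X * Y)"
proof -
  note hc = Sp_carrier[OF h] and ic = Sp_inv_carrier[of p q h] and [simp] = mult_carrier_mat[of _ n n _ n]
  have "Ad h X * Ad h Y = h * X * (Sp_inv p q h * (h * (Y * Sp_inv p q h)))"
    using hc ic X Y by (simp add: Ad_def assoc_mult_mat[of _ n n _ n _ n])
  also have "Sp_inv p q h * (h * (Y * Sp_inv p q h)) = Y * Sp_inv p q h"
    using hc ic Y Sp_inv(1)[OF h] by (simp flip: assoc_mult_mat[of _ n n _ n _ n])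
  finally show ?thesis
    using hc ic X Y by (simp add: Ad_def assoc_mult_mat[of _ n n _ n _ n])
qed

lemma Ad_minus:
  assumes h: "h \<in> Sp p q" and X: "X \<in> carrier_mat n n" and Y: "Y \<in> carrier_mat n n"
  shows "Ad h (X - Y) = Ad h X - Ad h Y"
proof -
  note hc = Sp_carrier[OF h] and ic = Sp_inv_carrier[of p q h]
  show ?thesis
    using hc ic X Y unfolding Ad_def
    by (subst mult_minus_distrib_mat[of _ n n _ n]) (auto intro!: minus_mult_distrib_mat[of _ n n _ _ n])
qed

lemma Ad_br:
  assumes h: "h \<in> block_Sp" and X: "X \<in> \<mm>" and Y: "Y \<in> \<mm>"
  shows "Ad h (br X Y) = br (Ad h X) (Ad h Y)"
proof -
  have hS: "h \<in> Sp p q" using h by (simp add: block_Sp_def)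
  note c = \<mm>_carrier[OF X] \<mm>_carrier[OF Y]
  have "Ad h (br X Y) = cut (Ad h (X * Y - Y * X))"
    using c by (subst br_eq_cut[OF X Y], subst cut_Ad[OF h]) (auto intro: minus_carrier_mat)
  also have "Ad h (X * Y - Y * X) = Ad h X * Ad h Y - Ad h Y * Ad h X"
    using c by (simp add: Ad_minus[OF hS] Ad_mult[OF hS])
  also have "cut \<dots> = br (Ad h X) (Ad h Y)"
    by (rule br_eq_cut[symmetric]) (intro Ad_\<mm> assms)+
  finally show ?thesis .
qed

lemma Ad_inv:
  assumes h: "h \<in> Sp p q" and X: "X \<in> carrier_mat n n"
  shows "Ad (Sp_inv p q h) (Ad h X) = X"
proof -
  note hc = Sp_carrier[OF h] and ic = Sp_inv_carrier[of p q h] and [simp] = mult_carrier_mat[of _ n n _ n]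
  have "Ad (Sp_inv p q h) (Ad h X) = Sp_inv p q h * (h * X * Sp_inv p q h) * h"
    by (simp add: Ad_def Sp_inv_inv[OF h])
  also have "\<dots> = (Sp_inv p q h * h) * X * (Sp_inv p q h * h)"
    using hc ic X by (simp add: assoc_mult_mat[of _ n n _ n _ n])
  finally show ?thesis
    using X by (simp add: Sp_inv(1)[OF h])
qed

lemma Ad_restr_eq: "h \<in> Sp p q \<Longrightarrow> Ad_restr p q W h = restrict (Ad h) W"
  by (simp add: Ad_restr_def Ad_def[abs_def] m_inv_Sp_group)

lemma Ad_linear:
  assumes h: "h \<in> Sp p q" and X: "X \<in> carrier_mat n n"
  shows "Y \<in> carrier_mat n n \<Longrightarrow> Ad h (X + Y) = Ad h X + Ad h Y"
    and "Ad h (of_real c \<cdot>\<^sub>m X) = of_real c \<cdot>\<^sub>m Ad h X"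
proof -
  have cX: "of_real c \<cdot>\<^sub>m X \<in> carrier_mat n n" using X by simp
  note AX = Ad_carrier[OF h X]
  show "Ad h (of_real c \<cdot>\<^sub>m X) = of_real c \<cdot>\<^sub>m Ad h X"
  proof (rule eq_matI)
    fix i j assume "i < dim_row (of_real c \<cdot>\<^sub>m Ad h X)" "j < dim_col (of_real c \<cdot>\<^sub>m Ad h X)"
    then have ij: "i < n" "j < n" using AX by auto
    have "Ad h (of_real c \<cdot>\<^sub>m X) $$ (i, j) = c *\<^sub>R Ad h X $$ (i, j)"
      unfolding Ad_index[OF h cX ij] Ad_index[OF h X ij] scaleR_right.sum
      using X by (intro sum.cong refl) (simp add: quat_scaleR_conv mult.commute)
    then show "Ad h (of_real c \<cdot>\<^sub>m X) $$ (i, j) = (of_real c \<cdot>\<^sub>m Ad h X) $$ (i, j)"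
      using AX ij by (simp add: quat_scaleR_conv)
  qed (use AX Ad_carrier[OF h cX] in auto)
  assume Y: "Y \<in> carrier_mat n n"
  show "Ad h (X + Y) = Ad h X + Ad h Y"
    using Sp_carrier[OF h] Sp_inv_carrier[of p q h] X Y unfolding Ad_def
    by (subst mult_add_distrib_mat[of _ n n _ n]) (auto intro!: add_mult_distrib_mat[of _ n n _ _ n])
qed

lemma Ad_in_Aut:
  assumes h: "h \<in> block_Sp"
  shows "Ad_restr p q \<mm> h \<in> Aut \<mm>"
proof -
  have hS: "h \<in> Sp p q" using h by (simp add: block_Sp_def)
  note hi = block_Sp_inv[OF h]
  have "bij_betw (Ad h) \<mm> \<mm>"
  proof (rule bij_betw_byWitness[where f' = "Ad (Sp_inv p q h)"])
    show "\<forall>a\<in>\<mm>. Ad (Sp_inv p q h) (Ad h a) = a"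
      using \<mm>_carrier Ad_inv[OF hS] by blast
    show "\<forall>a\<in>\<mm>. Ad h (Ad (Sp_inv p q h) a) = a"
      using \<mm>_carrier Ad_inv[OF Sp_inv(3)[OF hS]] by (simp add: Sp_inv_inv[OF hS])
  qed (use Ad_\<mm>[OF h] Ad_\<mm>[OF hi] in auto)
  then have "bij_betw (restrict (Ad h) \<mm>) \<mm> \<mm>"
    by (simp cong: bij_betw_cong)
  moreover have "linear_endo \<mm> (restrict (Ad h) \<mm>)"
    using Ad_\<mm>[OF h] \<mm>_linear \<mm>_carrier Ad_linear[OF hS] by (auto simp: linear_endo_def)
  ultimately show ?thesis
    using Ad_br[OF h] Ad_\<mm>[OF h] by (auto simp: Aut_iff Ad_restr_eq[OF hS] Bij_def bracket_on_\<mm>)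
qed

end

section \<open>Determination of the automorphisms\<close>

context Sp_complement
begin

abbreviation "J \<equiv> {..<n} - {r}"

lemma index_other: "\<exists>i. i \<in> J"
proof -
  have "(if r = 0 then 1 else 0) \<in> J" using two by auto
  then show ?thesis by blast
qed

sublocale H: hermitian_space J \<epsilon>
  by unfold_locales (use index_other in auto)

lemma sum_split: "(\<Sum>k<n. f k) = (f r :: quat) + (\<Sum>k\<in>J. f k)"
  using r by (simp add: sum.remove[of "{..<n}" r])

definition colr :: "quat mat \<Rightarrow> nat \<Rightarrow> quat" where
  "colr X = (\<lambda>i. if i \<in> J then X $$ (i, r) else 0)"

text \<open>The off-diagonal element with column \<open>v\<close>; its row is dictated by skew
  symmetry.\<close>

definition P :: "(nat \<Rightarrow> quat) \<Rightarrow> quat mat" where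
  "P v = mat n n (\<lambda>(i, j). if i = r then if j = r then 0 else - ((\<epsilon> r * \<epsilon> j) *\<^sub>R qcnj (v j))
    else if j = r then v i else 0)"

definition \<gg> :: "quat mat set" where
  "\<gg> = {X \<in> \<mm>. colr X = 0}"

text \<open>The standard representation of \<open>\<gg>\<close>; the value 0 outside
  \<open>J\<close> keeps the result in \<open>H.V\<close> for every matrix \<open>A\<close>.\<close>

definition act :: "quat mat \<Rightarrow> (nat \<Rightarrow> quat) \<Rightarrow> nat \<Rightarrow> quat" where
  "act A v = (\<lambda>i. if i \<in> J then \<Sum>j\<in>J. A $$ (i, j) * v j else 0)"

lemma P_index:
  "j \<in> J \<Longrightarrow> P v $$ (r, j) = - ((\<epsilon> r * \<epsilon> j) *\<^sub>R qcnj (v j))" "i \<in> J \<Longrightarrow> P v $$ (i, r) = v i"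
  "i \<in> J \<Longrightarrow> j \<in> J \<Longrightarrow> P v $$ (i, j) = 0" "P v $$ (r, r) = 0"
  using r by (auto simp: P_def)

lemma P_\<mm> [simp]: "P v \<in> \<mm>"
proof -
  have "P v \<in> skew_Sp p q"
  proof (rule skew_SpI)
    fix i j assume "i < n" "j < n"
    then consider "i = r" "j = r" | "i = r" "j \<in> J" | "i \<in> J" "j = r" | "i \<in> J" "j \<in> J" by blast
    then show "P v $$ (j, i) = - (of_real (\<epsilon> i * \<epsilon> j) * qcnj (P v $$ (i, j)))"
    proof cases
      case 2
      have "\<epsilon> r * \<epsilon> j * (\<epsilon> r * \<epsilon> j) = 1" by (simp add: sgnat_def)
      with 2 show ?thesis by (simp add: P_index quat_scaleR_conv qcnj_scaleR del: of_real_mult)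
    next
      case 3
      then show ?thesis by (simp add: P_index quat_scaleR_conv qcnj_scaleR mult.commute del: of_real_mult)
    qed (simp_all add: P_index)
  qed (simp add: P_def)
  then show ?thesis by (simp add: \<mm>_def P_index)
qed

lemma colr_P: "v \<in> H.V \<Longrightarrow> colr (P v) = v"
  by (auto simp: colr_def P_index H.V_def fun_eq_iff)

lemma colr_V [simp]: "colr X \<in> H.V"
  by (auto simp: colr_def H.V_def)

lemma act_V [simp]: "act A v \<in> H.V"
  by (auto simp: act_def H.V_def)

lemma \<mm>_index:
  assumes "X \<in> \<mm>"
  shows "X $$ (r, r) = 0" "j \<in> J \<Longrightarrow> X $$ (r, j) = - (of_real (\<epsilon> j * \<epsilon> r) * qcnj (X $$ (j, r)))"
  using assms r skew_SpD(1)[of X p q j r] by (auto simp: \<mm>_def)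

lemma \<mm>_eqI:
  assumes X: "X \<in> \<mm>" and Y: "Y \<in> \<mm>" and c: "colr X = colr Y"
    and e: "\<And>i j. i \<in> J \<Longrightarrow> j \<in> J \<Longrightarrow> X $$ (i, j) = Y $$ (i, j)"
  shows "X = Y"
proof (rule eq_matI)
  have c': "X $$ (i, r) = Y $$ (i, r)" if "i \<in> J" for i
    using fun_cong[OF c, of i] that by (simp add: colr_def)
  fix i j assume "i < dim_row Y" "j < dim_col Y"
  then have "i < n" "j < n" using \<mm>_carrier[OF Y] by auto
  then consider "i = r" "j = r" | "i = r" "j \<in> J" | "i \<in> J" "j = r" | "i \<in> J" "j \<in> J" by blast
  then show "X $$ (i, j) = Y $$ (i, j)"
    by cases (simp_all add: \<mm>_index[OF X] \<mm>_index[OF Y] c' e del: of_real_mult)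
qed (use \<mm>_carrier[OF X] \<mm>_carrier[OF Y] in auto)

lemma \<gg>_\<mm>: "A \<in> \<gg> \<Longrightarrow> A \<in> \<mm>"
  by (simp add: \<gg>_def)

lemma \<gg>_index:
  assumes "A \<in> \<gg>" "i < n"
  shows "A $$ (i, r) = 0" "A $$ (r, i) = 0"
proof -
  note m = \<mm>_index[OF \<gg>_\<mm>[OF assms(1)]]
  show c: "A $$ (i, r) = 0"
  proof (cases "i = r")
    case False
    then have i: "i \<in> J" using assms(2) by simp
    have "colr A i = 0" using assms(1) by (simp add: \<gg>_def)
    with i show ?thesis by (simp add: colr_def)
  qed (simp add: m)
  show "A $$ (r, i) = 0"
    using m(2)[of i] c assms(2) m(1) by (cases "i = r") auto
qed

lemma colr_linear:
  assumes "X \<in> \<mm>"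
  shows "Y \<in> \<mm> \<Longrightarrow> colr (X + Y) = colr X + colr Y" "Y \<in> \<mm> \<Longrightarrow> colr (X - Y) = colr X - colr Y"
    "colr (of_real c \<cdot>\<^sub>m X) = colr X \<cdot>\<^sub>r of_real c" "colr (0\<^sub>m n n) = 0"
proof -
  note X = \<mm>_carrier[OF assms]
  show "colr (of_real c \<cdot>\<^sub>m X) = colr X \<cdot>\<^sub>r of_real c" "colr (0\<^sub>m n n) = 0"
    using X r by (auto simp: colr_def fun_eq_iff quat_scaleR_conv)
  assume "Y \<in> \<mm>"
  from \<mm>_carrier[OF this] show "colr (X + Y) = colr X + colr Y" "colr (X - Y) = colr X - colr Y"
    using X r by (auto simp: colr_def fun_eq_iff)
qed

lemma P_linear: "P (v + w) = P v + P w" "P (v \<cdot>\<^sub>r of_real c) = of_real c \<cdot>\<^sub>m P v"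
  by (auto simp: P_def quat_scaleR_conv qcnj_scaleR algebra_simps intro!: eq_matI)

lemma P_inj: "v \<in> H.V \<Longrightarrow> w \<in> H.V \<Longrightarrow> P v = P w \<Longrightarrow> v = w"
  by (metis colr_P)

lemma \<mm>_decomp:
  assumes X: "X \<in> \<mm>"
  obtains A where "A \<in> \<gg>" "X = A + P (colr X)"
proof
  show "X - P (colr X) \<in> \<gg>"
    using X by (simp add: \<gg>_def \<mm>_linear colr_linear colr_P)
  show "X = (X - P (colr X)) + P (colr X)"
    using \<mm>_carrier[OF X] \<mm>_carrier[OF P_\<mm>, of "colr X"] by (intro eq_matI) auto
qed

section \<open>Products of diagonal and off-diagonal elements\<close>

lemma br_\<mm> [simp]: "X \<in> \<mm> \<Longrightarrow> Y \<in> \<mm> \<Longrightarrow> br X Y \<in> \<mm>"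
  by (rule bracket_on_\<mm>)

lemma br_index:
  "i < n \<Longrightarrow> j < n \<Longrightarrow> i \<noteq> r \<or> j \<noteq> r \<Longrightarrow>
    br X Y $$ (i, j) = (\<Sum>k<n. X $$ (i, k) * Y $$ (k, j)) - (\<Sum>k<n. Y $$ (i, k) * X $$ (k, j))"
  by (auto simp: br_def)

lemma br_add_left:
  assumes "X \<in> \<mm>" "Y \<in> \<mm>" "Z \<in> \<mm>"
  shows "br (X + Y) Z = br X Z + br Y Z"
  using assms[THEN \<mm>_carrier]
  by (intro eq_matI) (auto simp: br_def distrib_left distrib_right sum.distrib)

lemma br_add_right:
  assumes "X \<in> \<mm>" "Y \<in> \<mm>" "Z \<in> \<mm>"
  shows "br Z (X + Y) = br Z X + br Z Y"
  using assms[THEN \<mm>_carrier]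
  by (intro eq_matI) (auto simp: br_def distrib_left distrib_right sum.distrib)

lemma br_commute: "br X Y = of_real (-1) \<cdot>\<^sub>m br Y X"
  by (rule eq_matI) (auto simp: br_def)

lemma br_\<gg>_P:
  assumes A: "A \<in> \<gg>"
  shows "br A (P v) = P (act A v)"
proof (rule \<mm>_eqI)
  note A0 = \<gg>_index[OF A]
  show "colr (br A (P v)) = colr (P (act A v))"
  proof
    fix i
    show "colr (br A (P v)) i = colr (P (act A v)) i"
    proof (cases "i \<in> J")
      case True
      then have "br A (P v) $$ (i, r) = (\<Sum>k\<in>J. A $$ (i, k) * v k)"
        using r by (simp add: br_index sum_split A0 P_index)
      with True show ?thesis by (simp add: colr_def P_index act_def)
    qed (simp only: colr_def if_False)
  qed
  fix i j assume ij: "i \<in> J" "j \<in> J"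
  then show "br A (P v) $$ (i, j) = P (act A v) $$ (i, j)"
    using r by (simp add: br_index sum_split A0 P_index)
qed (use \<gg>_\<mm>[OF A] in auto)

text \<open>The commutator of two off-diagonal elements may have a component in the Lie algebra of
  \<open>K\<close>, the entry at \<open>(r, r)\<close>. The product drops it, and only between
  off-diagonal parts can it differ from the commutator.\<close>

lemma br_PP:
  shows "br (P v) (P w) \<in> \<gg>"
    and "i \<in> J \<Longrightarrow> j \<in> J \<Longrightarrow>
      br (P v) (P w) $$ (i, j) = - ((\<epsilon> r * \<epsilon> j) *\<^sub>R (v i * qcnj (w j) - w i * qcnj (v j)))"
proof -
  have "colr (br (P v) (P w)) i = 0" for i
  proof (cases "i \<in> J")
    case True
    with r show ?thesis by (simp add: colr_def br_index sum_split P_index)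
  qed (simp only: colr_def if_False)
  then show "br (P v) (P w) \<in> \<gg>"
    by (simp add: \<gg>_def fun_eq_iff)
  assume ij: "i \<in> J" "j \<in> J"
  then have "br (P v) (P w) $$ (i, j) = v i * - ((\<epsilon> r * \<epsilon> j) *\<^sub>R qcnj (w j)) - w i * - ((\<epsilon> r * \<epsilon> j) *\<^sub>R qcnj (v j))"
    by (simp add: br_index sum_split P_index)
  then show "br (P v) (P w) $$ (i, j) = - ((\<epsilon> r * \<epsilon> j) *\<^sub>R (v i * qcnj (w j) - w i * qcnj (v j)))"
    by (simp add: scaleR_right_diff_distrib)
qed

text \<open>The origin of the triple product. In row \<open>r\<close> of \<open>P w\<close> the sign
  belonging to the column index becomes the sign in the form, and the factor
  \<open>- \<epsilon> r\<close> remains.\<close>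

lemma br_PPP: "br (br (P v) (P w)) (P z) = P (H.triple v w z \<cdot>\<^sub>r of_real (- \<epsilon> r))"
proof -
  have e: "(\<Sum>j\<in>J. br (P v) (P w) $$ (i, j) * z j) = H.triple v w z i * of_real (- \<epsilon> r)" if i: "i \<in> J" for i
  proof -
    have h: "v i * H.hform w z = (\<Sum>j\<in>J. \<epsilon> j *\<^sub>R (v i * qcnj (w j) * z j))" for v w
      unfolding H.hform_def sum_distrib_left
      by (intro sum.cong refl) (simp add: quat_scaleR_conv mult.assoc)
    have "(\<Sum>j\<in>J. br (P v) (P w) $$ (i, j) * z j) =
        (\<Sum>j\<in>J. (- \<epsilon> r) *\<^sub>R (\<epsilon> j *\<^sub>R (v i * qcnj (w j) * z j) - \<epsilon> j *\<^sub>R (w i * qcnj (v j) * z j)))"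
    proof (intro sum.cong refl)
      fix j assume j: "j \<in> J"
      show "br (P v) (P w) $$ (i, j) * z j =
          (- \<epsilon> r) *\<^sub>R (\<epsilon> j *\<^sub>R (v i * qcnj (w j) * z j) - \<epsilon> j *\<^sub>R (w i * qcnj (v j) * z j))"
        unfolding br_PP(2)[OF i j] by (simp add: left_diff_distrib scaleR_right_diff_distrib)
    qed
    also have "\<dots> = (- \<epsilon> r) *\<^sub>R (v i * H.hform w z - w i * H.hform v z)"
      unfolding h sum_subtractf[symmetric] scaleR_right.sum ..
    finally show ?thesis
      by (simp only: quat_scaleR_conv H.triple_def rsmult_apply minus_apply)
  qed
  have "act (br (P v) (P w)) z = (\<lambda>i. if i \<in> J then H.triple v w z i * of_real (- \<epsilon> r) else 0)"
    unfolding act_def by (intro ext) (simp only: e cong: if_cong)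
  then have "P (act (br (P v) (P w)) z) = P (H.triple v w z \<cdot>\<^sub>r of_real (- \<epsilon> r))"
    by (auto simp: P_def intro!: eq_matI)
  then show ?thesis
    by (simp add: br_\<gg>_P[OF br_PP(1)])
qed

lemma act_linear:
  "act A (v + w) = act A v + act A w" "act A (v \<cdot>\<^sub>r c) = act A v \<cdot>\<^sub>r c" "act A (- v) = - act A v"
  by (auto simp: act_def fun_eq_iff distrib_left sum.distrib sum_distrib_right mult.assoc sum_negf)

lemma br_\<gg>:
  assumes A: "A \<in> \<gg>" and B: "B \<in> \<gg>"
  shows "br A B \<in> \<gg>" and "act (br A B) v = act A (act B v) - act B (act A v)"
proof -
  have "colr (br A B) i = 0" for i
  proof (cases "i \<in> J")
    case True
    with r show ?thesis by (simp add: colr_def br_index \<gg>_index[OF A] \<gg>_index[OF B])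
  qed (simp only: colr_def if_False)
  then show "br A B \<in> \<gg>"
    using A B by (simp add: \<gg>_def fun_eq_iff)
  have m: "(\<Sum>j\<in>J. (\<Sum>k\<in>J. A $$ (i, k) * B $$ (k, j)) * v j) = (\<Sum>k\<in>J. A $$ (i, k) * (\<Sum>j\<in>J. B $$ (k, j) * v j))"
    for A B i
    unfolding sum_distrib_left sum_distrib_right by (subst sum.swap) (simp add: mult.assoc)
  have "act (br A B) v i = (act A (act B v) - act B (act A v)) i" for i
  proof (cases "i \<in> J")
    case True
    then have "(\<Sum>j\<in>J. br A B $$ (i, j) * v j) =
        (\<Sum>j\<in>J. (\<Sum>k\<in>J. A $$ (i, k) * B $$ (k, j)) * v j - (\<Sum>k\<in>J. B $$ (i, k) * A $$ (k, j)) * v j)"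
      by (intro sum.cong refl) (simp add: br_index sum_split \<gg>_index[OF A] \<gg>_index[OF B] left_diff_distrib)
    also have "\<dots> = (\<Sum>k\<in>J. A $$ (i, k) * (\<Sum>j\<in>J. B $$ (k, j) * v j)) - (\<Sum>k\<in>J. B $$ (i, k) * (\<Sum>j\<in>J. A $$ (k, j) * v j))"
      by (simp only: sum_subtractf m)
    finally show ?thesis
      using True by (simp add: act_def)
  qed (auto simp: act_def)
  then show "act (br A B) v = act A (act B v) - act B (act A v)" by (rule ext)
qed

lemma act_faithful:
  assumes A: "A \<in> \<gg>" and B: "B \<in> \<gg>" and eq: "\<And>v. v \<in> H.V \<Longrightarrow> act A v = act B v"
  shows "A = B"
proof (rule \<mm>_eqI)
  show "A \<in> \<mm>" "B \<in> \<mm>" "colr A = colr B" using A B by (simp_all add: \<gg>_def)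
  fix i j assume ij: "i \<in> J" "j \<in> J"
  have e: "act A (std_vec j) i = A $$ (i, j)" for A
  proof -
    have "act A (std_vec j) i = (\<Sum>k\<in>J. if k = j then A $$ (i, j) else 0)"
      unfolding act_def using ij by (simp add: std_vec_def if_distrib[of "\<lambda>x. _ * x"] cong: if_cong)
    with ij show ?thesis by simp
  qed
  from eq[of "std_vec j"] ij show "A $$ (i, j) = B $$ (i, j)"
    by (metis e H.V_closed(5))
qed

text \<open>The subalgebra \<open>\<gg>\<close> is intrinsic: it consists of the elements on which the Jacobi identity holds.\<close>

definition jac :: "quat mat \<Rightarrow> quat mat \<Rightarrow> quat mat \<Rightarrow> quat mat" where
  "jac X Y Z = br X (br Y Z) + br Y (br Z X) + br Z (br X Y)"

lemma jac_\<mm>: "X \<in> \<mm> \<Longrightarrow> Y \<in> \<mm> \<Longrightarrow> Z \<in> \<mm> \<Longrightarrow> jac X Y Z \<in> \<mm>"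
  by (simp add: jac_def \<mm>_linear)

lemma commutator_jacobi:
  assumes "(X :: quat mat) \<in> carrier_mat n n" "Y \<in> carrier_mat n n" "Z \<in> carrier_mat n n"
  shows "(X * (Y * Z - Z * Y) - (Y * Z - Z * Y) * X) + (Y * (Z * X - X * Z) - (Z * X - X * Z) * Y) +
    (Z * (X * Y - Y * X) - (X * Y - Y * X) * Z) = 0\<^sub>m n n"
proof -
  have e: "A * (B * C - C * B) - (B * C - C * B) * A =
      A * (B * C) - A * (C * B) - (B * (C * A) - C * (B * A))"
    if "A \<in> carrier_mat n n" "B \<in> carrier_mat n n" "C \<in> carrier_mat n n" for A B C :: "quat mat"
  proof -
    note [simp] = mult_carrier_mat[of _ n n _ n]
    have "A * (B * C - C * B) = A * (B * C) - A * (C * B)"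
      using that by (intro mult_minus_distrib_mat[of _ n n _ n]) simp_all
    moreover have "(B * C - C * B) * A = B * C * A - C * B * A"
      using that by (intro minus_mult_distrib_mat[of _ n n _ _ n]) simp_all
    ultimately show ?thesis
      using that by (simp add: assoc_mult_mat[of _ n n _ n _ n])
  qed
  show ?thesis
    unfolding e[OF assms] e[OF assms(2,3,1)] e[OF assms(3,1,2)]
    using assms by (intro eq_matI) (simp_all del: index_mult_mat(1))
qed

text \<open>Row and column \<open>r\<close> of an element of \<open>\<gg>\<close> vanish, so
  brackets with it are full commutators and do not see what was removed at \<open>(r, r)\<close>.
  Away from \<open>(r, r)\<close> the sum is therefore that of matrix commutators.\<close>

lemma jac_\<gg>:
  assumes A: "A \<in> \<gg>" and Y: "Y \<in> \<mm>" and Z: "Z \<in> \<mm>"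
  shows "jac A Y Z = 0\<^sub>m n n"
proof (rule eq_matI)
  note c = \<mm>_carrier[OF \<gg>_\<mm>[OF A]] \<mm>_carrier[OF Y] \<mm>_carrier[OF Z]
  note [simp] = mult_carrier_mat[of _ n n _ n] and [intro] = minus_carrier_mat
  have full: "br A X $$ (i, j) = (A * X - X * A) $$ (i, j)" "br X A $$ (i, j) = (X * A - A * X) $$ (i, j)"
    if "X \<in> \<mm>" "i < n" "j < n" for X i j
    using that \<mm>_carrier[OF that(1)] c(1)
    by (auto simp: br_def mult_mat_index \<gg>_index[OF A] simp del: index_mult_mat(1))
  have ic: "(X * Y - Y * X) $$ (i, j) = (\<Sum>k<n. X $$ (i, k) * Y $$ (k, j)) - (\<Sum>k<n. Y $$ (i, k) * X $$ (k, j))"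
    if "X \<in> carrier_mat n n" "Y \<in> carrier_mat n n" "i < n" "j < n" for X Y i j
    using that by (simp add: mult_mat_index del: index_mult_mat(1))
  have yz: "br Y Z $$ (i, j) = (if i = r \<and> j = r then 0 else (Y * Z - Z * Y) $$ (i, j))" if "i < n" "j < n" for i j
    using that c by (simp add: br_def ic del: index_mult_mat(1) index_minus_mat(1))
  fix i j assume "i < dim_row (0\<^sub>m n n :: quat mat)" "j < dim_col (0\<^sub>m n n :: quat mat)"
  then have ij: "i < n" "j < n" by simp_all
  show "jac A Y Z $$ (i, j) = 0\<^sub>m n n $$ (i, j)"
  proof (cases "i = r \<and> j = r")
    case True
    have "jac A Y Z \<in> \<mm>" using A Y Z by (intro jac_\<mm>) (auto simp: \<gg>_\<mm>)
    with True r show ?thesis by (simp add: \<mm>_index)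
  next
    case False
    have p: "br A (br Y Z) $$ (i, j) = (A * (Y * Z - Z * Y) - (Y * Z - Z * Y) * A) $$ (i, j)"
    proof -
      have "br A (br Y Z) $$ (i, j) = (\<Sum>k<n. A $$ (i, k) * br Y Z $$ (k, j)) - (\<Sum>k<n. br Y Z $$ (i, k) * A $$ (k, j))"
        using False ij by (simp add: br_index)
      also have "(\<Sum>k<n. A $$ (i, k) * br Y Z $$ (k, j)) = (\<Sum>k<n. A $$ (i, k) * (Y * Z - Z * Y) $$ (k, j))"
        using ij by (intro sum.cong refl) (auto simp: yz \<gg>_index[OF A])
      also have "(\<Sum>k<n. br Y Z $$ (i, k) * A $$ (k, j)) = (\<Sum>k<n. (Y * Z - Z * Y) $$ (i, k) * A $$ (k, j))"
        using ij by (intro sum.cong refl) (auto simp: yz \<gg>_index[OF A])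
      finally show ?thesis
        using c ij by (subst ic) auto
    qed
    have q: "br Y (br Z A) $$ (i, j) = (Y * (Z * A - A * Z) - (Z * A - A * Z) * Y) $$ (i, j)"
      "br Z (br A Y) $$ (i, j) = (Z * (A * Y - Y * A) - (A * Y - Y * A) * Z) $$ (i, j)"
      using False ij c by (subst ic; auto simp: br_index full[OF Y] full[OF Z] intro!: arg_cong2[of _ _ _ _ minus] sum.cong)+
    have "jac A Y Z $$ (i, j) = br A (br Y Z) $$ (i, j) + br Y (br Z A) $$ (i, j) + br Z (br A Y) $$ (i, j)"
      using ij A Y Z by (simp add: jac_def br_def)
    also have "\<dots> = ((A * (Y * Z - Z * Y) - (Y * Z - Z * Y) * A) + (Y * (Z * A - A * Z) - (Z * A - A * Z) * Y) +
        (Z * (A * Y - Y * A) - (A * Y - Y * A) * Z)) $$ (i, j)"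
      unfolding p q using ij c by simp
    finally show ?thesis
      by (simp only: commutator_jacobi[OF c])
  qed
qed (simp_all add: jac_def br_def)

text \<open>Exchanging the outer factors costs a sign, so \<open>\<epsilon> r\<close> replaces the
  \<open>- \<epsilon> r\<close> of \<open>br_PPP\<close>.\<close>

lemma jac_P:
  "jac (P x) (P y) (P z) = P ((H.triple y z x + H.triple z x y + H.triple x y z) \<cdot>\<^sub>r of_real (\<epsilon> r))"
proof -
  have e: "br (P a) (br (P b) (P c)) = P (H.triple b c a \<cdot>\<^sub>r of_real (\<epsilon> r))" for a b c
  proof -
    have "br (P a) (br (P b) (P c)) = P (H.triple b c a \<cdot>\<^sub>r of_real (- \<epsilon> r) \<cdot>\<^sub>r of_real (-1))"
      by (simp only: br_commute[of "P a"] br_PPP P_linear)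
    then show ?thesis by (simp add: rsmult_simps)
  qed
  show ?thesis
    by (simp add: jac_def e P_linear(1) rsmult_simps)
qed

text \<open>The cyclic sum of triples for \<open>d\<close>, \<open>d i\<close>, \<open>d j\<close>
  in one coordinate, with the sign of the form left out; each of the six signed terms is
  \<open>- |d|^2 d k\<close>.\<close>

lemma quat_triple_witness:
  "d * \<i>\<i> * (qcnj (d * \<j>\<j>) * d) - d * \<j>\<j> * (qcnj (d * \<i>\<i>) * d) +
    (d * \<j>\<j> * (qcnj d * (d * \<i>\<i>)) - d * (qcnj (d * \<j>\<j>) * (d * \<i>\<i>))) +
    (d * (qcnj (d * \<i>\<i>) * (d * \<j>\<j>)) - d * \<i>\<i> * (qcnj d * (d * \<j>\<j>))) = (- 6 * inner d d) *\<^sub>R (d * \<k>\<k>)"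
proof -
  define t where "t = inner d d *\<^sub>R (d * \<k>\<k>)"
  have N: "qcnj d * d = of_real (inner d d)" "qcnj d * (d * x) = inner d d *\<^sub>R x" for x
    by (simp_all add: qcnj_mult_self quat_scaleR_conv flip: mult.assoc)
  have u: "qcnj \<i>\<i> = - \<i>\<i>" "qcnj \<j>\<j> = - \<j>\<j>" "\<i>\<i> * \<j>\<j> = \<k>\<k>" "\<j>\<j> * \<i>\<i> = - \<k>\<k>"
    by (simp_all add: quat_simps)
  have "- t - t + (- t - t) + (- t - t) = (- 6) *\<^sub>R t"
    by (simp add: quat_simps)
  then show ?thesis
    by (simp add: t_def u N quat_scaleR_conv mult.assoc)
qed

text \<open>The part of \<open>X\<close> in \<open>\<gg>\<close> contributes nothing to the Jacobi
  sum. If the column of \<open>X\<close> is nonzero at \<open>a\<close>, two test vectors supported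
  at \<open>a\<close> reduce the sum there to \<open>quat_triple_witness\<close>.\<close>

lemma \<gg>_iff_jac: "X \<in> \<gg> \<longleftrightarrow> X \<in> \<mm> \<and> (\<forall>Y\<in>\<mm>. \<forall>Z\<in>\<mm>. jac X Y Z = 0\<^sub>m n n)"
proof safe
  assume X: "X \<in> \<mm>" and j: "\<forall>Y\<in>\<mm>. \<forall>Z\<in>\<mm>. jac X Y Z = 0\<^sub>m n n"
  show "X \<in> \<gg>"
  proof (rule ccontr)
    define x where "x = colr X"
    assume "X \<notin> \<gg>"
    then have "x \<noteq> 0" using X by (simp add: \<gg>_def x_def)
    then obtain a where a: "x a \<noteq> 0" by (auto simp: fun_eq_iff)
    then have aJ: "a \<in> J" by (auto simp: x_def colr_def split: if_splits)
    obtain A where A: "A \<in> \<gg>" "X = A + P x" using \<mm>_decomp[OF X] unfolding x_def by blast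
    \<comment> \<open>The cyclic sum is alternating, so the three entries at \<open>a\<close> have
      to be independent over the reals; multiplying by i and j achieves this.\<close>
    define y z where "y = std_vec a \<cdot>\<^sub>r (x a * \<i>\<i>)" and "z = std_vec a \<cdot>\<^sub>r (x a * \<j>\<j>)"
    have "jac X (P y) (P z) = jac A (P y) (P z) + jac (P x) (P y) (P z)"
      unfolding jac_def A(2) using A(1)
      by (simp add: br_add_left br_add_right \<gg>_\<mm>, intro eq_matI) (auto simp: br_def)
    also have "\<dots> = jac (P x) (P y) (P z)"
      using jac_\<gg>[OF A(1), of "P y" "P z"] \<mm>_carrier[OF jac_\<mm>, of "P x" "P y" "P z"] by simp
    finally have "jac (P x) (P y) (P z) = 0\<^sub>m n n"
      using j by simp
    then have "colr (jac (P x) (P y) (P z)) = 0"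
      using colr_linear(4)[OF X] by simp
    moreover have "x \<in> H.V" "y \<in> H.V" "z \<in> H.V"
      using aJ by (simp_all add: x_def y_def z_def)
    ultimately have "(H.triple y z x + H.triple z x y + H.triple x y z) \<cdot>\<^sub>r of_real (\<epsilon> r) = 0"
      by (simp add: jac_P colr_P)
    from fun_cong[OF this, of a]
    have "(H.triple y z x a + H.triple z x y a + H.triple x y z a) * of_real (\<epsilon> r) = 0"
      by simp
    then have eq0: "H.triple y z x a + H.triple z x y a + H.triple x y z a = 0"
      by (simp add: sgnat_def split: if_splits)
    define d where "d = x a"
    have hx: "H.hform w (std_vec a) = qcnj (w a) * of_real (\<epsilon> a)" for w
    proof -
      have "H.hform w (std_vec a) = (\<Sum>i\<in>J. if i = a then qcnj (w a) * of_real (\<epsilon> a) else 0)"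
        unfolding H.hform_def by (intro sum.cong refl) (auto simp: std_vec_def)
      with aJ show ?thesis by simp
    qed
    have "H.triple y z x a + H.triple z x y a + H.triple x y z a = \<epsilon> a *\<^sub>R (- 6 * inner d d) *\<^sub>R (d * \<k>\<k>)"
      unfolding quat_triple_witness[symmetric] using aJ unfolding H.triple_def y_def z_def
      by (simp add: H.hform_simps H.hform_std_vec hx quat_scaleR_conv scaleR_right_diff_distrib scaleR_right_distrib
          mult.assoc flip: d_def)
    with eq0 have "\<epsilon> a *\<^sub>R (- 6 * inner d d) *\<^sub>R (d * \<k>\<k>) = 0" by simp
    moreover have "\<epsilon> a \<noteq> 0" by (simp add: sgnat_def)
    moreover have "\<k>\<k> \<noteq> 0" by (simp add: zero_quat_def)
    ultimately show False
      using a by (simp add: d_def)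
  qed
qed (auto simp: \<gg>_\<mm> jac_\<gg>)

section \<open>The action of a fixed automorphism on the two summands\<close>

context
  fixes T assumes T: "T \<in> Aut \<mm>"
begin

lemma T_\<mm> [simp]: "X \<in> \<mm> \<Longrightarrow> T X \<in> \<mm>"
  and T_add: "X \<in> \<mm> \<Longrightarrow> Y \<in> \<mm> \<Longrightarrow> T (X + Y) = T X + T Y"
  and T_smult: "X \<in> \<mm> \<Longrightarrow> T (of_real c \<cdot>\<^sub>m X) = of_real c \<cdot>\<^sub>m T X"
  using T by (auto simp: Aut_iff linear_endo_def)

lemma T_br: "X \<in> \<mm> \<Longrightarrow> Y \<in> \<mm> \<Longrightarrow> T (br X Y) = br (T X) (T Y)"
  using T unfolding Aut_iff by (metis T_\<mm> bracket_on_\<mm>(1))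

lemma T_bij: "bij_betw T \<mm> \<mm>"
  using T by (simp add: Aut_iff Bij_def)

lemma T_inj: "X \<in> \<mm> \<Longrightarrow> Y \<in> \<mm> \<Longrightarrow> T X = T Y \<Longrightarrow> X = Y"
  using T_bij by (auto simp: bij_betw_def inj_on_def)

lemma T_surj: "Y \<in> \<mm> \<Longrightarrow> \<exists>X\<in>\<mm>. T X = Y"
  by (metis bij_betw_imp_surj_on[OF T_bij] imageE)

lemma T_zero: "T (0\<^sub>m n n) = 0\<^sub>m n n"
proof -
  have e: "of_real 0 \<cdot>\<^sub>m X = 0\<^sub>m n n" if "X \<in> \<mm>" for X
    using \<mm>_carrier[OF that] by (intro eq_matI) auto
  show ?thesis
    using T_smult[of "0\<^sub>m n n" 0] \<mm>_linear(4) by (simp only: e T_\<mm>)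
qed

lemma T_jac: "X \<in> \<mm> \<Longrightarrow> Y \<in> \<mm> \<Longrightarrow> Z \<in> \<mm> \<Longrightarrow> T (jac X Y Z) = jac (T X) (T Y) (T Z)"
  by (simp add: jac_def T_add T_br \<mm>_linear)

text \<open>The characterisation by \<open>jac\<close> quantifies over all of \<open>\<mm>\<close>,
  and every element of \<open>\<mm>\<close> is an image under \<open>T\<close>.\<close>

lemma T_\<gg>: "A \<in> \<gg> \<Longrightarrow> T A \<in> \<gg>"
proof -
  assume A: "A \<in> \<gg>"
  have "jac (T A) Y Z = 0\<^sub>m n n" if YZ: "Y \<in> \<mm>" "Z \<in> \<mm>" for Y Z
  proof -
    obtain Y' Z' where "Y' \<in> \<mm>" "T Y' = Y" "Z' \<in> \<mm>" "T Z' = Z"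
      using T_surj[OF YZ(1)] T_surj[OF YZ(2)] by blast
    then show ?thesis
      using T_jac[OF \<gg>_\<mm>[OF A], of Y' Z'] jac_\<gg>[OF A] T_zero by simp
  qed
  then show ?thesis
    unfolding \<gg>_iff_jac using A by (simp add: \<gg>_\<mm>)
qed

text \<open>\<open>A\<^sub>0 = diag(i, ..., i)\<close> acts on the off-diagonal part with square \<open>-1\<close>; on \<open>\<gg>\<close> its adjoint
  action has only eigenvalues \<open>0\<close> and \<open>\<plusminus>2i\<close>. As \<open>T\<close> transports this to \<open>T A\<^sub>0\<close>, it preserves the
  off-diagonal part.\<close>

lemma T_P: "v \<in> H.V \<Longrightarrow> T (P v) = P (colr (T (P v)))"
proof -
  assume v: "v \<in> H.V"
  define A0 where "A0 = mat n n (\<lambda>(i, j). if i = j \<and> i \<noteq> r then \<i>\<i> else 0)"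
  have "A0 \<in> skew_Sp p q"
  proof (rule skew_SpI)
    fix i j assume "i < n" "j < n"
    moreover have "\<i>\<i> = - qcnj \<i>\<i>" by (simp add: quat_simps)
    ultimately show "A0 $$ (j, i) = - (of_real (\<epsilon> i * \<epsilon> j) * qcnj (A0 $$ (i, j)))"
      by (cases "i = j") (simp_all add: A0_def)
  qed (simp add: A0_def)
  then have A0: "A0 \<in> \<gg>"
    using r by (auto simp: \<gg>_def \<mm>_def A0_def colr_def fun_eq_iff)
  have actA0: "act A0 (act A0 w) = - w" if "w \<in> H.V" for w
  proof -
    have a: "act A0 w = (\<lambda>i. \<i>\<i> * w i)" if "w \<in> H.V" for w
    proof
      fix i
      show "act A0 w i = \<i>\<i> * w i"
      proof (cases "i \<in> J")
        case True
        then have "(\<Sum>j\<in>J. A0 $$ (i, j) * w j) = (\<Sum>j\<in>J. if j = i then \<i>\<i> * w i else 0)"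
          by (intro sum.cong refl) (auto simp: A0_def)
        with True show ?thesis by (simp add: act_def)
      next
        case False
        then have "w i = 0" using that unfolding H.V_def by blast
        with False show ?thesis by (simp only: act_def if_False mult_zero_right)
      qed
    qed
    have "\<i>\<i> * (\<i>\<i> * x) = - x" for x by (simp add: quat_simps)
    with that show ?thesis
      using a[OF that] a[OF act_V[of A0 w]] by (simp add: fun_eq_iff)
  qed
  define B where "B = T A0"
  have B: "B \<in> \<gg>" unfolding B_def by (rule T_\<gg>[OF A0])
  have neg: "- w = w \<cdot>\<^sub>r of_real (-1)" for w :: "nat \<Rightarrow> quat"
    by (simp add: fun_eq_iff)
  have TB: "br B (br B (T X)) = T (br A0 (br A0 X))" if "X \<in> \<mm>" for X
    using that A0 by (simp add: B_def T_br \<gg>_\<mm>)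
  \<comment> \<open>Since \<open>T\<close> is onto, \<open>P w\<close> is the image of some
    \<open>X\<close>. Modulo \<open>\<gg>\<close>, which \<open>T\<close> preserves, only the
    off-diagonal part of \<open>X\<close> matters.\<close>
  have BB: "act B (act B w) = - w" if w: "w \<in> H.V" for w
  proof -
    obtain X where X: "X \<in> \<mm>" "T X = P w" using T_surj[of "P w"] by auto
    obtain A v where A: "A \<in> \<gg>" "X = A + P v" and v: "v \<in> H.V" using \<mm>_decomp[OF X(1)] colr_V by metis
    have "br A0 (br A0 X) = br A0 (br A0 A) + P (- v)"
      using A0 A(1) v by (simp add: A(2) br_add_right \<gg>_\<mm> br_\<gg>_P actA0)
    then have "P (act B (act B w)) = T (br A0 (br A0 A)) + T (P (- v))"
      using TB[OF X(1)] A0 A(1) by (simp add: X(2) br_\<gg>_P[OF B] T_add \<gg>_\<mm>)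
    then have "act B (act B w) = colr (T (br A0 (br A0 A))) + colr (T (P (- v)))"
      using A0 A(1) by (drule_tac arg_cong[of _ _ colr]) (simp add: colr_P colr_linear \<gg>_\<mm>)
    also have "colr (T (br A0 (br A0 A))) = 0"
      using T_\<gg>[OF br_\<gg>(1)[OF A0 br_\<gg>(1)[OF A0 A(1)]]] by (simp add: \<gg>_def)
    also have "colr (T (P (- v))) = - colr (T (P v))"
      unfolding neg P_linear(2) by (simp only: T_smult P_\<mm> colr_linear T_\<mm>)
    also have "colr (T (P v)) = w"
    proof -
      have "colr (T X) = colr (T A) + colr (T (P v))"
        using A by (simp add: T_add \<gg>_\<mm> colr_linear)
      with T_\<gg>[OF A(1)] X(2) w show ?thesis by (simp add: \<gg>_def colr_P)
    qed
    finally show ?thesis by (simp add: fun_eq_iff)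
  qed
  \<comment> \<open>\<open>C\<close> is the component in \<open>\<gg>\<close> that has to
    vanish.\<close>
  obtain C w where C: "C \<in> \<gg>" "T (P v) = C + P w" and w: "w \<in> H.V"
    using \<mm>_decomp[OF T_\<mm>[OF P_\<mm>[of v]]] colr_V by metis
  have "br B (br B C) + P (- w) = of_real (-1) \<cdot>\<^sub>m (C + P w)"
  proof -
    have "br B (br B C) + P (- w) = br B (br B (T (P v)))"
      using B C(1) w by (simp add: C(2) br_add_right \<gg>_\<mm> br_\<gg>_P BB)
    also have "\<dots> = T (P (- v))"
      using TB[of "P v"] A0 v by (simp add: br_\<gg>_P actA0)
    also have "\<dots> = of_real (-1) \<cdot>\<^sub>m T (P v)"
      unfolding neg P_linear(2) by (simp only: T_smult P_\<mm>)
    finally show ?thesis by (simp only: C(2))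
  qed
  then have "br B (br B C) $$ (i, j) = - (C $$ (i, j))" if "i \<in> J" "j \<in> J" for i j
  proof -
    have "(br B (br B C) + P (- w)) $$ (i, j) = (of_real (-1) \<cdot>\<^sub>m (C + P w)) $$ (i, j)"
      using \<open>_ = of_real (-1) \<cdot>\<^sub>m (C + P w)\<close> by simp
    with that \<mm>_carrier[OF P_\<mm>[of w]] \<mm>_carrier[OF P_\<mm>[of "- w"]] \<mm>_carrier[OF \<gg>_\<mm>[OF C(1)]]
    show ?thesis by (simp add: P_index)
  qed
  then have BBC: "act (br B (br B C)) x = - act C x" for x
    by (auto simp: act_def fun_eq_iff sum_negf[symmetric] intro!: sum.cong)
  \<comment> \<open>The double commutator expands to \<open>B^2 C - 2 B C B + C B^2 = - C\<close>,
    and \<open>B^2 = -1\<close> turns this into \<open>2 B C B = - C\<close>.\<close>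
  have half: "act B (act C (act B x)) + act B (act C (act B x)) = - act C x" if x: "x \<in> H.V" for x
  proof -
    let ?y = "act B (act C (act B x))"
    have "act (br B (br B C)) x = act B (act B (act C x)) - ?y - (?y - act C (act B (act B x)))"
      using B C(1) by (simp add: br_\<gg> act_linear flip: add_uminus_conv_diff)
    then have "- act C x = - act C x - ?y - (?y - - act C x)"
      using x by (simp add: BBC BB act_linear)
    then show ?thesis
      by (simp add: algebra_simps)
  qed
  \<comment> \<open>Multiplying \<open>2 B C B = - C\<close> by \<open>B\<close> on both sides gives
    \<open>2 C = - B C B\<close>; together these yield \<open>4 C = C\<close>.\<close>
  have "act C x = 0" if x: "x \<in> H.V" for x
  proof -
    let ?y = "act B (act C (act B x))"
    have aux: "a + a = b" if "- a - a = - b" for a b :: "nat \<Rightarrow> quat"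
    proof -
      have "a + a = - (- a - a)" by simp
      with that show ?thesis by simp
    qed
    have "act B (act C (act B (act B x))) + act B (act C (act B (act B x))) = - act C (act B x)"
      by (rule half) simp
    then have "act B (act C x) + act B (act C x) = act C (act B x)"
      using x by (intro aux) (simp add: BB act_linear)
    then have "act B (act B (act C x) + act B (act C x)) = ?y"
      by (rule arg_cong)
    then have "act B (act B (act C x)) + act B (act B (act C x)) = ?y"
      by (simp only: act_linear(1))
    then have "act C x + act C x = - ?y"
      by (intro aux) (simp add: BB)
    then have "act C x + act C x + (act C x + act C x) = - ?y + - ?y"
      by (simp only:)
    also have "\<dots> = - (?y + ?y)"
      by (simp only: minus_add_distrib add.commute)
    also have "\<dots> = act C x"
      by (simp only: half[OF x] minus_minus)
    finally show ?thesis
      by (auto simp: fun_eq_iff quat_simps)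
  qed
  moreover have "act (0\<^sub>m n n) x = 0" for x
    by (auto simp: act_def fun_eq_iff)
  moreover have "0\<^sub>m n n \<in> \<gg>"
    using r by (auto simp: \<gg>_def \<mm>_linear colr_def fun_eq_iff)
  ultimately have "C = 0\<^sub>m n n"
    using act_faithful[OF C(1)] by simp
  then have "T (P v) = P w"
    using C(2) \<mm>_carrier[OF P_\<mm>[of w]] by simp
  then show ?thesis
    using w by (simp add: colr_P)
qed

text \<open>The block matrix is read off from the action \<open>\<tau>\<close> on the off-diagonal
  part. Agreement on \<open>\<gg>\<close> follows, since an element of \<open>\<gg>\<close> is known
  from its brackets with that part and both maps respect the product.\<close>

theorem Aut_is_Ad: "\<exists>h\<in>block_Sp. T = Ad_restr p q \<mm> h"
proof -
  define \<tau> where "\<tau> v = colr (T (P v))" for v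
  have TP: "T (P v) = P (\<tau> v)" if "v \<in> H.V" for v
    using T_P[OF that] by (simp add: \<tau>_def)
  have \<tau>V [simp]: "\<tau> v \<in> H.V" for v by (simp add: \<tau>_def)
  have \<tau>_surj: "\<exists>v\<in>H.V. \<tau> v = w" if w: "w \<in> H.V" for w
  proof -
    obtain X where X: "X \<in> \<mm>" "T X = P w" using T_surj[of "P w"] by auto
    obtain A v where A: "A \<in> \<gg>" "X = A + P v" and v: "v \<in> H.V" using \<mm>_decomp[OF X(1)] colr_V by metis
    have "colr (T X) = colr (T A) + \<tau> v"
      using A by (simp add: T_add \<gg>_\<mm> colr_linear \<tau>_def)
    with T_\<gg>[OF A(1)] X(2) w have "\<tau> v = w" by (simp add: \<gg>_def colr_P)
    with v show ?thesis by blast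
  qed
  have \<tau>_real: "\<tau> (v \<cdot>\<^sub>r of_real c) = \<tau> v \<cdot>\<^sub>r of_real c" for v c
    by (simp only: \<tau>_def P_linear T_smult P_\<mm> colr_linear T_\<mm>)
  have \<tau>_bij: "bij_betw \<tau> H.V H.V"
    unfolding bij_betw_def
  proof
    show "inj_on \<tau> H.V"
      by (rule inj_onI) (metis P_\<mm> P_inj TP T_inj)
    show "\<tau> ` H.V = H.V" using \<tau>_surj by auto
  qed
  have \<tau>_add: "\<tau> (v + w) = \<tau> v + \<tau> w" for v w
    by (simp add: \<tau>_def P_linear(1) T_add colr_linear)
  have \<tau>_triple: "\<tau> (H.triple v w z) = H.triple (\<tau> v) (\<tau> w) (\<tau> z)" if "v \<in> H.V" "w \<in> H.V" "z \<in> H.V" for v w z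
  proof -
    let ?c = "of_real (- \<epsilon> r) :: quat"
    have "P (\<tau> (H.triple v w z \<cdot>\<^sub>r ?c)) = T (br (br (P v) (P w)) (P z))"
      using that by (simp only: br_PPP TP H.V_closed)
    also have "\<dots> = P (H.triple (\<tau> v) (\<tau> w) (\<tau> z) \<cdot>\<^sub>r ?c)"
      using that by (simp only: br_PPP[symmetric]) (simp add: T_br TP)
    finally have "\<tau> (H.triple v w z) \<cdot>\<^sub>r ?c = H.triple (\<tau> v) (\<tau> w) (\<tau> z) \<cdot>\<^sub>r ?c"
      unfolding \<tau>_real by (rule P_inj[rotated 2]) (auto intro!: H.V_closed)
    \<comment> \<open>The factor \<open>- \<epsilon> r\<close> has square 1, so multiplying by it
      once more removes it.\<close>
    then have "\<tau> (H.triple v w z) \<cdot>\<^sub>r ?c \<cdot>\<^sub>r ?c = H.triple (\<tau> v) (\<tau> w) (\<tau> z) \<cdot>\<^sub>r ?c \<cdot>\<^sub>r ?c" by simp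
    then show ?thesis
      by (simp only: rsmult_simps of_real_mult[symmetric] minus_mult_minus sgnat_square of_real_1)
  qed
  have "\<exists>g u. qcnj u * u = 1 \<and> u * qcnj u = 1 \<and>
    (\<forall>v\<in>H.V. \<forall>i. \<tau> v i = (\<Sum>j\<in>J. g i j * v j) * u) \<and>
    (\<forall>j\<in>J. \<forall>k\<in>J. (\<Sum>i\<in>J. qcnj (g i j) * of_real (\<epsilon> i) * g i k) = (if j = k then of_real (\<epsilon> j) else 0))"
    by (rule H.triple_automorphism) (simp_all only: \<tau>_bij \<tau>_add \<tau>_real \<tau>_triple)
  then obtain g u where u: "qcnj u * u = 1" "u * qcnj u = 1" and
    g0: "\<forall>v\<in>H.V. \<forall>i. \<tau> v i = (\<Sum>j\<in>J. g i j * v j) * u" and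
    gu0: "\<forall>j\<in>J. \<forall>k\<in>J.
      (\<Sum>i\<in>J. qcnj (g i j) * of_real (\<epsilon> i) * g i k) = (if j = k then of_real (\<epsilon> j) else 0)"
    by (elim exE conjE)
  note g = g0[rule_format] and gu = gu0[rule_format]
  \<comment> \<open>The corner entry is \<open>qcnj u\<close> because conjugation multiplies column
    \<open>r\<close> on the right by the conjugate of the \<open>(r, r)\<close> entry.\<close>
  define h where "h = mat n n (\<lambda>(i, j). if i = r \<or> j = r then if i = j then qcnj u else 0 else g i j)"
  have hi: "h $$ (r, r) = qcnj u" "i \<in> J \<Longrightarrow> h $$ (i, r) = 0" "i \<in> J \<Longrightarrow> h $$ (r, i) = 0"
    "i \<in> J \<Longrightarrow> j \<in> J \<Longrightarrow> h $$ (i, j) = g i j" for i j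
    using r by (auto simp: h_def)
  have "h \<in> Sp p q"
    unfolding Sp_iff
  proof (intro conjI allI impI)
    fix i j assume "i < n" "j < n"
    then consider "i = r" "j = r" | "i = r" "j \<in> J" | "i \<in> J" "j = r" | "i \<in> J" "j \<in> J" by blast
    then show "(\<Sum>k<n. qcnj (h $$ (k, i)) * of_real (\<epsilon> k) * h $$ (k, j)) = (if i = j then of_real (\<epsilon> i) else 0)"
    proof cases
      case 1
      have "u * of_real (\<epsilon> r) * qcnj u = of_real (\<epsilon> r)"
        using u by (simp add: quat_scaleR_conv) (simp add: scaleR_conv_of_real)
      with 1 show ?thesis by (simp add: sum_split hi)
    next
      case 4
      have "(\<Sum>k\<in>J. qcnj (h $$ (k, i)) * of_real (\<epsilon> k) * h $$ (k, j)) =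
          (\<Sum>k\<in>J. qcnj (g k i) * of_real (\<epsilon> k) * g k j)"
        using 4 by (intro sum.cong refl) (simp add: hi)
      with 4 show ?thesis by (simp add: sum_split hi gu)
    qed (simp_all add: sum_split hi)
  qed (simp add: h_def)
  then have h: "h \<in> block_Sp"
    by (simp add: block_Sp_def hi)
  have hS: "h \<in> Sp p q" using h by (simp add: block_Sp_def)
  have AdP: "Ad h (P v) = T (P v)" if v: "v \<in> H.V" for v
    unfolding TP[OF v]
  proof (rule \<mm>_eqI)
    note Pc = \<mm>_carrier[OF P_\<mm>[of v]]
    show "Ad h (P v) \<in> \<mm>" by (rule Ad_\<mm>[OF h P_\<mm>])
    show "colr (Ad h (P v)) = colr (P (\<tau> v))"
    proof
      fix i
      show "colr (Ad h (P v)) i = colr (P (\<tau> v)) i"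
      proof (cases "i \<in> J")
        case True
        then have "Ad h (P v) $$ (i, r) = (\<Sum>k<n. h $$ (i, k) * P v $$ (k, r)) * u"
          using Ad_block_index[OF h Pc, of i r] r by (simp add: hi)
        also have "\<dots> = \<tau> v i"
          using True v by (simp add: sum_split hi P_index g)
        finally show ?thesis
          using True by (simp add: colr_def P_index)
      qed (simp only: colr_def if_False)
    qed
    fix i j assume ij: "i \<in> J" "j \<in> J"
    then have "i < n" "j < n" by auto
    from Ad_index[OF hS Pc this] ij show "Ad h (P v) $$ (i, j) = P (\<tau> v) $$ (i, j)"
      by (simp add: sum_split hi P_index)
  qed simp
  have AdA: "Ad h A = T A" if A: "A \<in> \<gg>" for A
  proof (rule act_faithful)
    have "colr (Ad h A) i = 0" for i
    proof (cases "i \<in> J")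
      case True
      then have "Ad h A $$ (i, r) = 0"
        using Ad_block_index[OF h \<mm>_carrier[OF \<gg>_\<mm>[OF A]], of i r] r by (simp add: \<gg>_index[OF A])
      then show ?thesis by (simp add: colr_def)
    qed (simp only: colr_def if_False)
    then show AdA: "Ad h A \<in> \<gg>"
      using Ad_\<mm>[OF h \<gg>_\<mm>[OF A]] by (simp add: \<gg>_def fun_eq_iff)
    show TA: "T A \<in> \<gg>" by (rule T_\<gg>[OF A])
    fix w assume "w \<in> H.V"
    \<comment> \<open>On a vector \<open>\<tau> v\<close> both actions can be computed inside the
      images of \<open>A\<close> and \<open>P v\<close>, where \<open>Ad h\<close> and
      \<open>T\<close> already agree on \<open>P v\<close>.\<close>
    then obtain v where v: "v \<in> H.V" "w = \<tau> v" using \<tau>_surj by blast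
    have "P (act (Ad h A) w) = br (Ad h A) (Ad h (P v))"
      using v by (simp add: br_\<gg>_P[OF AdA] AdP TP)
    also have "\<dots> = Ad h (P (act A v))"
      using A by (simp add: \<gg>_\<mm> br_\<gg>_P flip: Ad_br[OF h])
    also have "\<dots> = br (T A) (T (P v))"
      using A by (simp add: AdP \<gg>_\<mm> br_\<gg>_P flip: T_br)
    also have "\<dots> = P (act (T A) w)"
      using v by (simp add: br_\<gg>_P[OF TA] TP)
    finally show "act (Ad h A) w = act (T A) w"
      by (rule P_inj[rotated 2]) simp_all
  qed
  have "T X = Ad h X" if X: "X \<in> \<mm>" for X
  proof -
    obtain A where A: "A \<in> \<gg>" "X = A + P (colr X)" using \<mm>_decomp[OF X] .
    have "T X = T A + T (P (colr X))"
      using A(1) by (subst A(2)) (simp add: T_add \<gg>_\<mm>)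
    also have "\<dots> = Ad h (A + P (colr X))"
      using A(1) by (simp add: AdA AdP Ad_linear[OF hS] \<mm>_carrier \<gg>_\<mm>)
    finally show ?thesis by (simp flip: A(2))
  qed
  moreover have "T \<in> extensional \<mm>"
    using T by (simp add: Aut_iff Bij_def)
  ultimately have "T = restrict (Ad h) \<mm>"
    by (auto simp: fun_eq_iff extensional_def)
  then show ?thesis
    using h Ad_restr_eq[OF hS] by metis
qed

end

lemma Aut_eq: "Aut \<mm> = {Ad_restr p q \<mm> h | h. h \<in> block_Sp}"
  using Ad_in_Aut Aut_is_Ad by blast

end

section \<open>The block-diagonal embeddings\<close>

lemma Sp_1_iff: "\<eta> \<in> Sp 1 0 \<longleftrightarrow> (\<exists>x. qcnj x * x = 1 \<and> \<eta> = mat 1 1 (\<lambda>_. x))"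
proof
  assume "\<eta> \<in> Sp 1 0"
  then have c: "\<eta> \<in> carrier_mat 1 1" and "qcnj (\<eta> $$ (0, 0)) * \<eta> $$ (0, 0) = 1"
    unfolding Sp_iff by (auto simp: sgnat_def)
  moreover have "\<eta> = mat 1 1 (\<lambda>_. \<eta> $$ (0, 0))"
    using c by (intro eq_matI) auto
  ultimately show "\<exists>x. qcnj x * x = 1 \<and> \<eta> = mat 1 1 (\<lambda>_. x)" by blast
next
  assume "\<exists>x. qcnj x * x = 1 \<and> \<eta> = mat 1 1 (\<lambda>_. x)"
  then show "\<eta> \<in> Sp 1 0"
    unfolding Sp_iff by (auto simp: sgnat_def)
qed

text \<open>Both embeddings are treated at once: \<open>r\<close> is the coordinate on which \<open>Sp(1)\<close> acts, and \<open>skip\<close>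
  enumerates the others.\<close>

context Sp_complement
begin

definition skip :: "nat \<Rightarrow> nat" where
  "skip k = (if k < r then k else Suc k)"

definition unskip :: "nat \<Rightarrow> nat" where
  "unskip i = (if i < r then i else i - 1)"

text \<open>For \<open>r = 0\<close> the entry \<open>x\<close> stands in front of the block
  \<open>g\<close>, for \<open>r = p + q - 1\<close> behind it; these are the two
  embeddings.\<close>

definition embed :: "quat mat \<Rightarrow> quat \<Rightarrow> quat mat" where
  "embed g x = mat n n (\<lambda>(i, j). if i = r \<or> j = r then if i = j then x else 0 else g $$ (unskip i, unskip j))"

lemma bij_skip: "bij_betw skip {..<n - 1} J"
  by (rule bij_betw_byWitness[where f' = unskip]) (use r in \<open>auto simp: skip_def unskip_def\<close>)

text \<open>Deleting coordinate \<open>r\<close> from the signs of the form leaves those of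
  \<open>Sp p' q'\<close>, and the orthonormality relations separate into blocks. The sign at
  \<open>r\<close> cancels, so the condition on \<open>x\<close> is that of \<open>Sp(1)\<close> in
  either case.\<close>

lemma embed_in_block_Sp:
  assumes p': "p' + q' = n - 1" and sg: "\<And>k. k < n - 1 \<Longrightarrow> sgnat p' k = sgnat p (skip k)"
    and g: "g \<in> carrier_mat (n - 1) (n - 1)"
  shows "embed g x \<in> block_Sp \<longleftrightarrow> g \<in> Sp p' q' \<and> qcnj x * x = 1"
proof -
  let ?h = "embed g x"
  have hi: "?h $$ (r, r) = x" "i \<in> J \<Longrightarrow> ?h $$ (i, r) = 0" "i \<in> J \<Longrightarrow> ?h $$ (r, i) = 0"
    "i \<in> J \<Longrightarrow> j \<in> J \<Longrightarrow> ?h $$ (i, j) = g $$ (unskip i, unskip j)" for i j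
    using r by (auto simp: embed_def)
  have us: "unskip (skip k) = k" for k by (simp add: skip_def unskip_def)
  have sk: "skip k \<in> J" if "k < n - 1" for k using bij_betwE[OF bij_skip] that by blast
  define S where "S i j = (\<Sum>k<n. qcnj (?h $$ (k, i)) * of_real (\<epsilon> k) * ?h $$ (k, j))" for i j
  define R where "R i j = (\<Sum>k<n - 1. qcnj (g $$ (k, i)) * of_real (sgnat p' k) * g $$ (k, j))" for i j
  have Sr: "S r r = of_real (\<epsilon> r) * (qcnj x * x)"
    by (simp add: S_def sum_split hi quat_scaleR_conv mult.assoc)
  have S0: "S i r = 0" "S r i = 0" if "i \<in> J" for i
    using that by (simp_all add: S_def sum_split hi)
  have SR: "S (skip i) (skip j) = R i j" if ij: "i < n - 1" "j < n - 1" for i j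
  proof -
    have "S (skip i) (skip j) =
        (\<Sum>k\<in>J. qcnj (?h $$ (k, skip i)) * of_real (\<epsilon> k) * ?h $$ (k, skip j))"
      using hi(3)[OF sk[OF ij(1)]] by (simp add: S_def sum_split)
    also have "\<dots> = (\<Sum>k<n - 1. qcnj (?h $$ (skip k, skip i)) * of_real (\<epsilon> (skip k)) * ?h $$ (skip k, skip j))"
      by (rule sum.reindex_bij_betw[OF bij_skip, symmetric])
    also have "\<dots> = R i j"
      unfolding R_def
    proof (intro sum.cong refl)
      fix k assume "k \<in> {..<n - 1}"
      then have k: "k < n - 1" by simp
      show "qcnj (?h $$ (skip k, skip i)) * of_real (\<epsilon> (skip k)) * ?h $$ (skip k, skip j) =
          qcnj (g $$ (k, i)) * of_real (sgnat p' k) * g $$ (k, j)"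
        by (simp only: hi(4)[OF sk[OF k] sk[OF ij(1)]] hi(4)[OF sk[OF k] sk[OF ij(2)]] us sg[OF k])
    qed
    finally show ?thesis .
  qed
  have c: "?h \<in> carrier_mat n n" by (simp add: embed_def)
  have z: "\<forall>i<n. i \<noteq> r \<longrightarrow> ?h $$ (i, r) = 0 \<and> ?h $$ (r, i) = 0"
    using hi(2,3) by simp
  have "?h \<in> block_Sp \<longleftrightarrow> ?h \<in> Sp p q"
    unfolding block_Sp_def using z by blast
  also have "\<dots> \<longleftrightarrow> (\<forall>i<n. \<forall>j<n. S i j = (if i = j then of_real (\<epsilon> i) else 0))"
    by (simp only: Sp_iff S_def c simp_thms)
  also have "\<dots> \<longleftrightarrow> (\<forall>i<n - 1. \<forall>j<n - 1. R i j = (if i = j then of_real (sgnat p' i) else 0)) \<and> qcnj x * x = 1"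
  proof (intro iffI conjI allI impI)
    assume A: "\<forall>i<n. \<forall>j<n. S i j = (if i = j then of_real (\<epsilon> i) else 0)"
    show "R i j = (if i = j then of_real (sgnat p' i) else 0)" if "i < n - 1" "j < n - 1" for i j
    proof -
      have "skip i < n" "skip j < n" "skip i = skip j \<longleftrightarrow> i = j"
        using sk[OF that(1)] sk[OF that(2)] by (simp_all add: skip_def)
      note s = this
      have "S (skip i) (skip j) = (if skip i = skip j then of_real (\<epsilon> (skip i)) else 0)"
        using A s(1,2) by blast
      then show ?thesis
        by (simp only: SR[OF that] s(3) sg[OF that(1)])
    qed
    have eq: "of_real (\<epsilon> r) * (qcnj x * x) = of_real (\<epsilon> r)"
    proof -
      have "S r r = of_real (\<epsilon> r)" using A r by presburger
      then show ?thesis by (simp only: Sr)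
    qed
    have "qcnj x * x = of_real (\<epsilon> r) * (of_real (\<epsilon> r) * (qcnj x * x))"
      by (simp only: of_real_sgnat_cancel)
    also have "\<dots> = 1"
      unfolding eq by (simp add: sgnat_def)
    finally show "qcnj x * x = 1" .
  next
    fix i j
    assume A: "(\<forall>i<n - 1. \<forall>j<n - 1. R i j = (if i = j then of_real (sgnat p' i) else 0)) \<and> qcnj x * x = 1"
      and ij: "i < n" "j < n"
    consider "i = r" "j = r" | "i = r" "j \<in> J" | "i \<in> J" "j = r" | "i \<in> J" "j \<in> J" using ij by blast
    then show "S i j = (if i = j then of_real (\<epsilon> i) else 0)"
    proof cases
      case 4
      then have "i \<in> skip ` {..<n - 1}" "j \<in> skip ` {..<n - 1}"
        by (simp_all only: bij_betw_imp_surj_on[OF bij_skip])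
      then obtain k l where kl: "i = skip k" "j = skip l" "k < n - 1" "l < n - 1"
        by blast
      have e: "skip k = skip l \<longleftrightarrow> k = l" by (auto simp: skip_def)
      have "R k l = (if k = l then of_real (sgnat p' k) else 0)"
        using A kl(3,4) by blast
      then show ?thesis
        by (simp only: kl(1,2) SR[OF kl(3,4)] e sg[OF kl(3)])
    next
      case 1
      then show ?thesis
        by (simp add: Sr conjunct2[OF A])
    qed (simp_all add: S0)
  qed
  also have "\<dots> \<longleftrightarrow> g \<in> Sp p' q' \<and> qcnj x * x = 1"
    unfolding Sp_iff R_def p' using g by blast
  finally show ?thesis .
qed

lemma block_Sp_embed:
  assumes h: "h \<in> block_Sp"
  obtains g where "g \<in> carrier_mat (n - 1) (n - 1)" "h = embed g (h $$ (r, r))"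
proof
  let ?g = "mat (n - 1) (n - 1) (\<lambda>(k, l). h $$ (skip k, skip l))"
  show "h = embed ?g (h $$ (r, r))"
  proof (rule eq_matI)
    fix i j assume "i < dim_row (embed ?g (h $$ (r, r)))" "j < dim_col (embed ?g (h $$ (r, r)))"
    then have ij: "i < n" "j < n" by (auto simp: embed_def)
    have su: "skip (unskip i) = i" "unskip i < n - 1" if "i \<in> J" for i
      using that r by (auto simp: skip_def unskip_def)
    show "h $$ (i, j) = embed ?g (h $$ (r, r)) $$ (i, j)"
      using h ij su[of i] su[of j] by (auto simp: embed_def block_Sp_def)
  qed (use h Sp_carrier[of h p q] in \<open>auto simp: embed_def block_Sp_def\<close>)
qed simp

text \<open>The common core of both choices of \<open>G\<close>: the embedding enters only through
  its agreement with \<open>embed\<close>, and the choice of \<open>G\<close> through its sign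
  pattern.\<close>

lemma Aut_embedded:
  assumes p': "p' + q' = n - 1" and sg: "\<And>k. k < n - 1 \<Longrightarrow> sgnat p' k = sgnat p (skip k)"
    and emb: "\<And>g x. g \<in> carrier_mat (n - 1) (n - 1) \<Longrightarrow> emb g (mat 1 1 (\<lambda>_. x)) = embed g x"
    and \<kk>: "\<kk> = lie_algebra n {emb (1\<^sub>m (n - 1)) \<eta> | \<eta>. \<eta> \<in> Sp 1 0}"
    and V: "V = borth_compl (lie_algebra n (Sp p q)) \<kk>"
  shows "algebraic_group V (Aut V) \<and>
    finite_index_subgroup {Ad_restr p q V (emb g \<eta>) | g \<eta>. g \<in> Sp p' q' \<and> \<eta> \<in> Sp 1 0} (Aut_group V)"
proof -
  have "{emb (1\<^sub>m (n - 1)) \<eta> | \<eta>. \<eta> \<in> Sp 1 0} =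
      {mat n n (\<lambda>(i, j). if i = j then if i = r then x else 1 else 0) | x. qcnj x * x = 1}"
  proof -
    have "embed (1\<^sub>m (n - 1)) x = mat n n (\<lambda>(i, j). if i = j then if i = r then x else 1 else 0)" for x
    proof (rule eq_matI)
      fix i j
      assume "i < dim_row (mat n n (\<lambda>(i, j). if i = j then if i = r then x else 1 else 0))"
        "j < dim_col (mat n n (\<lambda>(i, j). if i = j then if i = r then x else 1 else 0))"
      then have ij: "i < n" "j < n" by auto
      show "embed (1\<^sub>m (n - 1)) x $$ (i, j) = mat n n (\<lambda>(i, j). if i = j then if i = r then x else 1 else 0) $$ (i, j)"
      proof (cases "i = r \<or> j = r")
        case False
        then have "unskip i < n - 1" "unskip j < n - 1" "unskip i = unskip j \<longleftrightarrow> i = j"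
          using ij r by (auto simp: unskip_def split: if_splits)
        with False ij show ?thesis by (simp add: embed_def)
      qed (use ij in \<open>auto simp: embed_def\<close>)
    qed (simp_all add: embed_def)
    note e = this
    have "{emb (1\<^sub>m (n - 1)) \<eta> | \<eta>. \<eta> \<in> Sp 1 0} = {emb (1\<^sub>m (n - 1)) (mat 1 1 (\<lambda>_. x)) | x. qcnj x * x = 1}"
      unfolding Sp_1_iff by blast
    then show ?thesis
      by (simp only: emb[OF one_carrier_mat] e)
  qed
  then have "\<kk> = {mat n n (\<lambda>x. if x = (r, r) then a else 0) | a. qre a = 0}"
    unfolding \<kk> by (simp only: lie_algebra_circle[OF r])
  then have Vm: "V = \<mm>"
    unfolding V lie_algebra_Sp by (simp only: borth_compl_eq)
  have "{Ad_restr p q \<mm> (emb g \<eta>) | g \<eta>. g \<in> Sp p' q' \<and> \<eta> \<in> Sp 1 0} = {Ad_restr p q \<mm> h | h. h \<in> block_Sp}"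
  proof -
    have gc: "g \<in> carrier_mat (n - 1) (n - 1)" if "g \<in> Sp p' q'" for g
      using Sp_carrier[OF that] by (simp only: p')
    have "emb g \<eta> \<in> block_Sp" if g: "g \<in> Sp p' q'" and \<eta>: "\<eta> \<in> Sp 1 0" for g \<eta>
    proof -
      obtain x where "qcnj x * x = 1" "\<eta> = mat 1 1 (\<lambda>_. x)"
        using \<eta> unfolding Sp_1_iff by blast
      then show ?thesis
        using embed_in_block_Sp[OF p' sg gc[OF g], of x] g by (simp only: emb[OF gc[OF g]])
    qed
    moreover have "\<exists>g \<eta>. h = emb g \<eta> \<and> g \<in> Sp p' q' \<and> \<eta> \<in> Sp 1 0" if h: "h \<in> block_Sp" for h
    proof -
      obtain g where g: "g \<in> carrier_mat (n - 1) (n - 1)" "h = embed g (h $$ (r, r))"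
        using block_Sp_embed[OF h] .
      then have "g \<in> Sp p' q' \<and> qcnj (h $$ (r, r)) * h $$ (r, r) = 1"
        using embed_in_block_Sp[OF p' sg g(1), of "h $$ (r, r)"] h by metis
      with g show ?thesis
        using emb[OF g(1), of "h $$ (r, r)"] Sp_1_iff by metis
    qed
    ultimately show ?thesis by blast
  qed
  also have "\<dots> = Aut \<mm>"
    by (rule Aut_eq[symmetric])
  finally show ?thesis
    unfolding Vm using algebraic_Aut finite_index_Aut by simp
qed

end

theorem corollary3p5:
  fixes p q :: nat
    and H K G \<kk> \<mm> :: "quat mat set"
    and emb :: "quat mat \<Rightarrow> quat mat \<Rightarrow> quat mat"
  assumes "p \<ge> 1" and "q \<ge> 1"
    and "H = Sp p q"
    and "K = Sp 1 0"
    and "(G = Sp (p - 1) q \<and> emb = (\<lambda>g \<eta>. diag_block_mat [\<eta>, g])) \<or>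
         (G = Sp p (q - 1) \<and> emb = (\<lambda>g \<eta>. diag_block_mat [g, \<eta>]))"
    and "\<kk> = lie_algebra (p + q) {emb (1\<^sub>m (p + q - 1)) \<eta> | \<eta>. \<eta> \<in> K}"
    and "\<mm> = borth_compl (lie_algebra (p + q) H) \<kk>"
  shows "algebraic_group \<mm> (Aut \<mm>) \<and>
         finite_index_subgroup {Ad_restr p q \<mm> (emb g \<eta>) | g \<eta>. g \<in> G \<and> \<eta> \<in> K} (Aut_group \<mm>)"
proof -
  have diag: "diag_block_mat [A, B] = mat (a + b) (a + b) (\<lambda>(i, j).
      if i < a then if j < a then A $$ (i, j) else 0 else if j < a then 0 else B $$ (i - a, j - a))"
    if "A \<in> carrier_mat a a" "B \<in> carrier_mat b b" for A B :: "quat mat" and a b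
    using that by (intro eq_matI) (auto simp: Let_def)
  from assms(5) show ?thesis
  proof
    assume G: "G = Sp (p - 1) q \<and> emb = (\<lambda>g \<eta>. diag_block_mat [\<eta>, g])"
    \<comment> \<open>\<open>K\<close> occupies the first coordinate, which has a positive sign as
      \<open>p \<ge> 1\<close>; the block of \<open>G\<close> is shifted by one.\<close>
    interpret Sp_complement p q 0
      by unfold_locales (use assms(1,2) in auto)
    have "emb g (mat 1 1 (\<lambda>_. x)) = embed g x" if g: "g \<in> carrier_mat (p + q - 1) (p + q - 1)" for g x
    proof -
      have "emb g (mat 1 1 (\<lambda>_. x)) = diag_block_mat [mat 1 1 (\<lambda>_. x), g]"
        using G by simp
      also have "\<dots> = embed g x"
        unfolding diag[OF mat_carrier g] embed_def using assms(1)
        by (intro eq_matI) (auto simp: unskip_def)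
      finally show ?thesis .
    qed
    moreover have "sgnat (p - 1) k = sgnat p (skip k)" for k
      using assms(1) by (auto simp: sgnat_def skip_def)
    moreover have "p - 1 + q = p + q - 1"
      using assms(1) by simp
    ultimately show ?thesis
      using Aut_embedded[of "p - 1" q emb \<kk> \<mm>] assms(6,7) unfolding assms(3,4) conjunct1[OF G] by blast
  next
    assume G: "G = Sp p (q - 1) \<and> emb = (\<lambda>g \<eta>. diag_block_mat [g, \<eta>])"
    \<comment> \<open>\<open>K\<close> occupies the last coordinate, which has a negative sign as
      \<open>q \<ge> 1\<close>; the other coordinates keep their numbers.\<close>
    interpret Sp_complement p q "p + q - 1"
      by unfold_locales (use assms(1,2) in auto)
    have "emb g (mat 1 1 (\<lambda>_. x)) = embed g x" if g: "g \<in> carrier_mat (p + q - 1) (p + q - 1)" for g x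
    proof -
      have "emb g (mat 1 1 (\<lambda>_. x)) = diag_block_mat [g, mat 1 1 (\<lambda>_. x)]"
        using G by simp
      also have "\<dots> = embed g x"
        unfolding diag[OF g mat_carrier] embed_def using assms(1)
        by (intro eq_matI) (auto simp: unskip_def[unfolded One_nat_def])
      finally show ?thesis .
    qed
    moreover have "sgnat p k = sgnat p (skip k)" if "k < p + q - 1" for k
      using that by (simp only: skip_def if_True)
    moreover have "p + (q - 1) = p + q - 1"
      using assms(2) by simp
    ultimately show ?thesis
      using Aut_embedded[of p "q - 1" emb \<kk> \<mm>] assms(6,7) unfolding assms(3,4) conjunct1[OF G] by blast
  qed
qed

end
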